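(* Let $\mathbf{A}=(A,\cdot)$ be a finite nilpotent loop with a normal subloop $N$ such that $\mathbf{A}/N$ is supernilpotent. Then $\mathbf{A}$ is term equivalent to an algebra $(A,*,r)$ such that $(A,* )$ is a supernilpotent loop with $(A,* )/N=\mathbf{A}/N$ and $r$ is a binary operation $r\colon A^2\to N$.
   Context: An algebra $\mathbf{A}=(A,F)$ is a set $A$ with a list $F$ of basic operations. A term operation of $\mathbf{A}$ is a finitary operation on $A$ obtained by composing basic operations and projections; a polynomial operation is obtained by composing basic operations, projections and constants. Two algebras on the same universe are term equivalent if they have the same term operations. A loop is an algebra $(A,\cdot,\backslash,/,1)$ satisfying $x\backslash(xy)=y$, $x(x\backslash y)=y$, $(yx)/x=y$, $(y/x)x=y$, $x\cdot 1=1\cdot x=x$; equivalently a groupoid $(A,\cdot)$ with identity $1$ such that for all $a,b\in A$ the equations $ax=b$ and $ya=b$ have unique solutions. A finite loop $(A,\cdot,\backslash,/,1)$ has the same term operations as $(A,\cdot)$, so the two presentations are not distinguished. A subloop $N$ of a loop $\mathbf{A}$ is normal if $aN=Na$, $a(bN)=(ab)N$ and $(Na)b=N(ab)$ for all $a,b\in A$; equivalently, $N$ is the class of $1$ of a congruence $\equiv_N$ of $\mathbf{A}$, which is then $\{(x,y): x/y\in N\}$ and whose classes are the cosets $aN$. The quotient loop $\mathbf{A}/N$ is the set of cosets with $(aN)\cdot(bN):=(ab)N$. If $(A,* )$ is a loop whose multiplication is a term operation of $\mathbf{A}$, then $\equiv_N$ is also a congruence of $(A,* )$, and $(A,* )/N$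 is the quotient by it; $(A,* )/N=\mathbf{A}/N$ means that $*$ and $\cdot$ induce the same operation on $A/N$. Commutators: for congruences $\alpha_1,\dots,\alpha_n$ ($n\ge 2$) of an algebra $\mathbf{A}$, the ($n$-ary, term condition) commutator $[\alpha_1,\dots,\alpha_n]$ is the smallest congruence $\delta$ such that for all polynomial operations $f$ of $\mathbf{A}$ (with variables split into $n$ blocks) and all tuples $a_i,b_i$ of the corresponding block lengths that are coordinatewise congruent modulo $\alpha_i$: if $f(x_1,\dots,x_{n-1},a_n)\equiv_\delta f(x_1,\dots,x_{n-1},b_n)$ for all $(x_1,\dots,x_{n-1})\in\prod_{i<n}\{a_i,b_i\}$ different from $(b_1,\dots,b_{n-1})$, then $f(b_1,\dots,b_{n-1},a_n)\equiv_\delta f(b_1,\dots,b_{n-1},b_n)$. Let $0_A$ be equality and $1_A$ the total congruence. $\mathbf{A}$ is nilpotent if for some $k\ge 1$ there are congruences $1_A=\alpha_0\ge\alpha_1\ge\dots\ge\alpha_k=0_A$ with $[\alpha_i,1_A]\le\alpha_{i+1}$ for all $i<k$. (For loops this is the same as central nilpotence in the sense of Bruck.) $\mathbf{A}$ is supernilpotent if for some $k\ge 1$ the $(k+1)$-ary commutator $[1_A,\dots,1_A]$ equals $0_A$. (It is known that a finite loop is supernilpotent iff it is a direct product of nilpotent loops of prime power order.) *)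

theory Defs
  imports Main "HOL-Library.FuncSet"
begin

section \<open>Algebras, term operations and polynomial operations\<close>

text \<open>An algebra is given by a universe \<open>A\<close> and a set \<open>F\<close> of basic operations. A basic operation
  is a pair \<open>(n, f)\<close> of an arity and a function on lists, of which only the values on lists over \<open>A\<close>
  of length \<open>n\<close> matter.\<close>

type_synonym 'a operation = "nat \<times> ('a list \<Rightarrow> 'a)"

definition tuples :: "'a set \<Rightarrow> nat \<Rightarrow> 'a list set" where
  "tuples A n = {xs. length xs = n \<and> set xs \<subseteq> A}"

definition algebra_on :: "'a set \<Rightarrow> 'a operation set \<Rightarrow> bool" where
  "algebra_on A F \<longleftrightarrow> (\<forall>(n, f) \<in> F. \<forall>xs \<in> tuples A n. f xs \<in> A)"

definition binop :: "('a \<Rightarrow> 'a \<Rightarrow> 'a) \<Rightarrow> 'a operation" where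
  "binop m = (2, \<lambda>xs. m (xs ! 0) (xs ! 1))"

text \<open>Term operations are \<open>undefined\<close> outside \<open>tuples A n\<close>, so that equality of term operations is
  equality of functions on \<open>A\<close>.\<close>

inductive_set term_ops :: "'a set \<Rightarrow> 'a operation set \<Rightarrow> nat \<Rightarrow> ('a list \<Rightarrow> 'a) set"
  for A :: "'a set" and F :: "'a operation set" and n :: nat
  where
    proj: "i < n \<Longrightarrow> restrict (\<lambda>xs. xs ! i) (tuples A n) \<in> term_ops A F n"
  | comp: "(k, f) \<in> F \<Longrightarrow> length gs = k \<Longrightarrow> \<forall>g \<in> set gs. g \<in> term_ops A F n \<Longrightarrow>
      restrict (\<lambda>xs. f (map (\<lambda>g. g xs) gs)) (tuples A n) \<in> term_ops A F n"

definition poly_ops :: "'a set \<Rightarrow> 'a operation set \<Rightarrow> nat \<Rightarrow> ('a list \<Rightarrow> 'a) set" where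
  "poly_ops A F n = term_ops A (F \<union> (\<lambda>a. (0, \<lambda>_. a)) ` A) n"

definition term_equivalent :: "'a set \<Rightarrow> 'a operation set \<Rightarrow> 'a operation set \<Rightarrow> bool" where
  "term_equivalent A F G \<longleftrightarrow> (\<forall>n. term_ops A F n = term_ops A G n)"


section \<open>Congruences and higher commutators\<close>

definition congruence :: "'a set \<Rightarrow> 'a operation set \<Rightarrow> 'a rel \<Rightarrow> bool" where
  "congruence A F \<theta> \<longleftrightarrow> equiv A \<theta> \<and>
     (\<forall>(n, f) \<in> F. \<forall>xs ys. length xs = n \<longrightarrow> list_all2 (\<lambda>x y. (x, y) \<in> \<theta>) xs ys \<longrightarrow> (f xs, f ys) \<in> \<theta>)"

text \<open>\<open>as\<close> and \<open>bs\<close> are lists of blocks of variables; block \<open>i\<close> is taken from \<open>bs\<close> if \<open>i \<in> S\<close> and from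
  \<open>as\<close> otherwise.\<close>

definition corner :: "'a list list \<Rightarrow> 'a list list \<Rightarrow> nat set \<Rightarrow> 'a list" where
  "corner as bs S = concat (map (\<lambda>i. if i \<in> S then bs ! i else as ! i) [0..<length as])"

text \<open>With blocks numbered \<open>0, \<dots>, k\<close>, the choices \<open>(x\<^sub>0, \<dots>, x\<^sub>k\<^sub>-\<^sub>1)\<close> in
  \<open>{a\<^sub>0, b\<^sub>0} \<times> \<dots> \<times> {a\<^sub>k\<^sub>-\<^sub>1, b\<^sub>k\<^sub>-\<^sub>1}\<close> other than \<open>(b\<^sub>0, \<dots>, b\<^sub>k\<^sub>-\<^sub>1)\<close> are indexed by the
  proper subsets of \<open>{..<k}\<close>. Indexing by positions rather than by values matters
  when \<open>a\<^sub>i = b\<^sub>i\<close> for some \<open>i\<close>: excluding the value \<open>(b\<^sub>0, \<dots>, b\<^sub>k\<^sub>-\<^sub>1)\<close> would then also discard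
  choices that are meant to be premises.\<close>

definition centralizes :: "'a set \<Rightarrow> 'a operation set \<Rightarrow> 'a rel list \<Rightarrow> 'a rel \<Rightarrow> bool" where
  "centralizes A F \<alpha>s \<delta> \<longleftrightarrow>
     (let k = length \<alpha>s - 1 in
      \<forall>as bs. \<forall>f \<in> poly_ops A F (length (concat as)).
        length as = length \<alpha>s \<longrightarrow> length bs = length \<alpha>s \<longrightarrow>
        (\<forall>i < length \<alpha>s. list_all2 (\<lambda>x y. (x, y) \<in> \<alpha>s ! i) (as ! i) (bs ! i)) \<longrightarrow>
        (\<forall>S. S \<subset> {..<k} \<longrightarrow> (f (corner as bs S), f (corner as bs (insert k S))) \<in> \<delta>) \<longrightarrow>
        (f (corner as bs {..<k}), f (corner as bs (insert k {..<k}))) \<in> \<delta>)"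

definition commutator :: "'a set \<Rightarrow> 'a operation set \<Rightarrow> 'a rel list \<Rightarrow> 'a rel" where
  "commutator A F \<alpha>s = \<Inter>{\<delta>. congruence A F \<delta> \<and> centralizes A F \<alpha>s \<delta>}"

definition nilpotent :: "'a set \<Rightarrow> 'a operation set \<Rightarrow> bool" where
  "nilpotent A F \<longleftrightarrow> (\<exists>k \<ge> 1. \<exists>\<alpha> :: nat \<Rightarrow> 'a rel.
     (\<forall>i \<le> k. congruence A F (\<alpha> i)) \<and> \<alpha> 0 = A \<times> A \<and> \<alpha> k = Id_on A \<and>
     (\<forall>i < k. \<alpha> (Suc i) \<subseteq> \<alpha> i \<and> commutator A F [\<alpha> i, A \<times> A] \<subseteq> \<alpha> (Suc i)))"

definition supernilpotent :: "'a set \<Rightarrow> 'a operation set \<Rightarrow> bool" where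
  "supernilpotent A F \<longleftrightarrow> (\<exists>k \<ge> 1. commutator A F (replicate (k + 1) (A \<times> A)) = Id_on A)"

lemma poly_ops_closed:
  assumes "algebra_on A F" "f \<in> poly_ops A F n" "xs \<in> tuples A n"
  shows "f xs \<in> A"
  using assms(2) unfolding poly_ops_def
proof induction
  case (proj i)
  then show ?case using assms(3) by (auto simp: tuples_def)
next
  case (comp k f gs)
  have "map (\<lambda>g. g xs) gs \<in> tuples A k" using comp by (auto simp: tuples_def)
  then have "f (map (\<lambda>g. g xs) gs) \<in> A" using comp assms(1) by (auto simp: algebra_on_def)
  then show ?case using assms(3) by simp
qed

lemma corner_in_tuples:
  assumes "length as = length \<alpha>s" "length bs = length \<alpha>s" "\<forall>\<alpha> \<in> set \<alpha>s. \<alpha> \<subseteq> A \<times> A"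
    "\<forall>i < length \<alpha>s. list_all2 (\<lambda>x y. (x, y) \<in> \<alpha>s ! i) (as ! i) (bs ! i)"
  shows "corner as bs S \<in> tuples A (length (concat as))"
proof -
  have len: "length (bs ! i) = length (as ! i)" if "i < length as" for i
    using assms(1,4) that list_all2_lengthD by metis
  have "length (corner as bs S) = sum_list (map (\<lambda>i. length (as ! i)) [0..<length as])"
    unfolding corner_def length_concat map_map
    by (rule arg_cong[where f = sum_list], rule map_cong) (auto simp: len)
  also have "map (\<lambda>i. length (as ! i)) [0..<length as] = map length as"
    by (rule nth_equalityI) auto
  finally have l: "length (corner as bs S) = length (concat as)"
    by (simp add: length_concat)
  have in_A: "set (as ! i) \<subseteq> A \<and> set (bs ! i) \<subseteq> A" if "i < length as" for i
  proof -
    have "\<alpha>s ! i \<subseteq> A \<times> A" using that assms(1,3) by simp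
    then have "list_all2 (\<lambda>x y. x \<in> A \<and> y \<in> A) (as ! i) (bs ! i)"
      using assms(1,4) that by (auto elim!: list_all2_mono)
    then show ?thesis by (fastforce simp: list_all2_conv_all_nth in_set_conv_nth)
  qed
  have "set (corner as bs S) \<subseteq> A"
    unfolding corner_def using in_A by (fastforce split: if_splits)
  with l show ?thesis by (simp add: tuples_def)
qed

text \<open>The intersection in \<open>commutator\<close> is itself a congruence with the defining property, hence the
  smallest one.\<close>

lemma commutator_least:
  assumes alg: "algebra_on A F" and \<alpha>s: "\<forall>\<alpha> \<in> set \<alpha>s. \<alpha> \<subseteq> A \<times> A"
  shows "congruence A F (commutator A F \<alpha>s)"
    and "centralizes A F \<alpha>s (commutator A F \<alpha>s)"
    and "congruence A F \<delta> \<Longrightarrow> centralizes A F \<alpha>s \<delta> \<Longrightarrow> commutator A F \<alpha>s \<subseteq> \<delta>"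
proof -
  have tot_cong: "congruence A F (A \<times> A)"
    unfolding congruence_def
  proof (intro conjI)
    show "equiv A (A \<times> A)" by (auto simp: equiv_def refl_on_def sym_def trans_def)
    have "f xs \<in> A \<and> f ys \<in> A"
      if "(n, f) \<in> F" "length xs = n" "list_all2 (\<lambda>x y. (x, y) \<in> A \<times> A) xs ys" for n f xs ys
    proof -
      have "xs \<in> tuples A n" "ys \<in> tuples A n"
        using that(2,3) by (fastforce simp: tuples_def list_all2_conv_all_nth in_set_conv_nth)+
      then show ?thesis using alg that(1) by (auto simp: algebra_on_def)
    qed
    then show "\<forall>(n, f) \<in> F. \<forall>xs ys. length xs = n \<longrightarrow>
        list_all2 (\<lambda>x y. (x, y) \<in> A \<times> A) xs ys \<longrightarrow> (f xs, f ys) \<in> A \<times> A"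
      by (auto split: prod.splits)
  qed
  have tot_cent: "centralizes A F \<alpha>s (A \<times> A)"
    unfolding centralizes_def Let_def
    using poly_ops_closed[OF alg] corner_in_tuples[OF _ _ \<alpha>s] by (auto intro!: SigmaI)
  let ?D = "{\<delta>. congruence A F \<delta> \<and> centralizes A F \<alpha>s \<delta>}"
  have eqv: "equiv A \<delta>" if "\<delta> \<in> ?D" for \<delta>
    using that by (simp add: congruence_def)
  have sub: "\<Inter>?D \<subseteq> A \<times> A" using tot_cong tot_cent by blast
  have "equiv A (\<Inter>?D)"
  proof (rule equivI)
    show "\<Inter>?D \<subseteq> A \<times> A" by (rule sub)
    show "refl_on A (\<Inter>?D)"
      using eqv sub unfolding equiv_def refl_on_def by blast
    show "sym (\<Inter>?D)"
      using eqv unfolding equiv_def sym_def by blast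
    show "trans (\<Inter>?D)"
      using eqv unfolding equiv_def trans_def by blast
  qed
  moreover have "(f xs, f ys) \<in> \<Inter>?D"
    if "(n, f) \<in> F" "length xs = n" "list_all2 (\<lambda>x y. (x, y) \<in> \<Inter>?D) xs ys" for n f xs ys
  proof
    fix \<delta> assume \<delta>: "\<delta> \<in> ?D"
    have "list_all2 (\<lambda>x y. (x, y) \<in> \<delta>) xs ys"
      using that(3) by (rule list_all2_mono) (use \<delta> in blast)
    then show "(f xs, f ys) \<in> \<delta>" using \<delta> that(1,2) by (auto simp: congruence_def)
  qed
  ultimately show "congruence A F (commutator A F \<alpha>s)"
    unfolding congruence_def[of A F "commutator A F \<alpha>s"] unfolding commutator_def by blast
  show "centralizes A F \<alpha>s (commutator A F \<alpha>s)"
    unfolding centralizes_def Let_def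
  proof (intro allI ballI impI)
    fix as bs f
    let ?k = "length \<alpha>s - 1"
    assume *: "f \<in> poly_ops A F (length (concat as))" "length as = length \<alpha>s"
      "length bs = length \<alpha>s"
      "\<forall>i < length \<alpha>s. list_all2 (\<lambda>x y. (x, y) \<in> \<alpha>s ! i) (as ! i) (bs ! i)"
      and prem: "\<forall>S \<subset> {..<?k}. (f (corner as bs S), f (corner as bs (insert ?k S))) \<in> commutator A F \<alpha>s"
    show "(f (corner as bs {..<?k}), f (corner as bs (insert ?k {..<?k}))) \<in> commutator A F \<alpha>s"
      unfolding commutator_def
    proof
      fix \<delta> assume \<delta>: "\<delta> \<in> ?D"
      have "\<forall>S \<subset> {..<?k}. (f (corner as bs S), f (corner as bs (insert ?k S))) \<in> \<delta>"
        using prem \<delta> unfolding commutator_def by blast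
      then show "(f (corner as bs {..<?k}), f (corner as bs (insert ?k {..<?k}))) \<in> \<delta>"
        using \<delta> * unfolding centralizes_def Let_def by blast
    qed
  qed
  show "commutator A F \<alpha>s \<subseteq> \<delta>" if "congruence A F \<delta>" "centralizes A F \<alpha>s \<delta>"
    using that unfolding commutator_def by blast
qed


section \<open>Loops, normal subloops and quotients\<close>

definition is_loop :: "'a set \<Rightarrow> ('a \<Rightarrow> 'a \<Rightarrow> 'a) \<Rightarrow> bool" where
  "is_loop A m \<longleftrightarrow>
     (\<forall>x \<in> A. \<forall>y \<in> A. m x y \<in> A) \<and>
     (\<exists>e \<in> A. \<forall>x \<in> A. m e x = x \<and> m x e = x) \<and>
     (\<forall>a \<in> A. \<forall>b \<in> A. (\<exists>!x. x \<in> A \<and> m a x = b) \<and> (\<exists>!y. y \<in> A \<and> m y a = b))"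

definition subloop :: "'a set \<Rightarrow> ('a \<Rightarrow> 'a \<Rightarrow> 'a) \<Rightarrow> 'a set \<Rightarrow> bool" where
  "subloop A m N \<longleftrightarrow> N \<subseteq> A \<and> is_loop N m"

definition lcoset :: "('a \<Rightarrow> 'a \<Rightarrow> 'a) \<Rightarrow> 'a \<Rightarrow> 'a set \<Rightarrow> 'a set" where
  "lcoset m a X = (\<lambda>x. m a x) ` X"

definition rcoset :: "('a \<Rightarrow> 'a \<Rightarrow> 'a) \<Rightarrow> 'a set \<Rightarrow> 'a \<Rightarrow> 'a set" where
  "rcoset m X a = (\<lambda>x. m x a) ` X"

definition normal_subloop :: "'a set \<Rightarrow> ('a \<Rightarrow> 'a \<Rightarrow> 'a) \<Rightarrow> 'a set \<Rightarrow> bool" where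
  "normal_subloop A m N \<longleftrightarrow> subloop A m N \<and>
     (\<forall>a \<in> A. lcoset m a N = rcoset m N a) \<and>
     (\<forall>a \<in> A. \<forall>b \<in> A. lcoset m a (lcoset m b N) = lcoset m (m a b) N) \<and>
     (\<forall>a \<in> A. \<forall>b \<in> A. rcoset m (rcoset m N a) b = rcoset m N (m a b))"

definition rdiv :: "'a set \<Rightarrow> ('a \<Rightarrow> 'a \<Rightarrow> 'a) \<Rightarrow> 'a \<Rightarrow> 'a \<Rightarrow> 'a" where
  "rdiv A m x y = (THE z. z \<in> A \<and> m z y = x)"

definition loop_cong :: "'a set \<Rightarrow> ('a \<Rightarrow> 'a \<Rightarrow> 'a) \<Rightarrow> 'a set \<Rightarrow> 'a rel" where
  "loop_cong A m N = {(x, y). x \<in> A \<and> y \<in> A \<and> rdiv A m x y \<in> N}"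

text \<open>The operation induced on \<open>A // \<theta>\<close> by a binary operation compatible with \<open>\<theta>\<close>.\<close>

definition quotient_op :: "'a rel \<Rightarrow> ('a \<Rightarrow> 'a \<Rightarrow> 'a) \<Rightarrow> 'a set \<Rightarrow> 'a set \<Rightarrow> 'a set" where
  "quotient_op \<theta> m C D = (\<Union>x \<in> C. \<Union>y \<in> D. \<theta> `` {m x y})"

lemma is_loopD:
  assumes "is_loop A m"
  shows "x \<in> A \<Longrightarrow> y \<in> A \<Longrightarrow> m x y \<in> A"
    and "\<exists>e \<in> A. \<forall>x \<in> A. m e x = x \<and> m x e = x"
    and "a \<in> A \<Longrightarrow> b \<in> A \<Longrightarrow> \<exists>!x. x \<in> A \<and> m a x = b"
    and "a \<in> A \<Longrightarrow> b \<in> A \<Longrightarrow> \<exists>!y. y \<in> A \<and> m y a = b"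
  using assms unfolding is_loop_def by simp_all

lemma loop_cong_iff_lcoset:
  assumes A: "is_loop A m" and N: "normal_subloop A m N"
  shows "(x, y) \<in> loop_cong A m N \<longleftrightarrow> x \<in> A \<and> y \<in> A \<and> lcoset m x N = lcoset m y N"
    and "x \<in> A \<Longrightarrow> y \<in> A \<Longrightarrow> lcoset m x N = lcoset m y N \<longleftrightarrow> x \<in> lcoset m y N"
proof -
  have NA: "N \<subseteq> A" and NL: "is_loop N m" using N by (auto simp: normal_subloop_def subloop_def)
  have LR: "lcoset m a N = rcoset m N a" if "a \<in> A" for a
    using N that unfolding normal_subloop_def by blast
  have LL: "lcoset m a (lcoset m b N) = lcoset m (m a b) N" if "a \<in> A" "b \<in> A" for a b
    using N that unfolding normal_subloop_def by blast
  obtain e where e: "e \<in> A" "\<And>x. x \<in> A \<Longrightarrow> m e x = x \<and> m x e = x"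
    using is_loopD(2)[OF A] by blast
  obtain e' where e': "e' \<in> N" "\<And>x. x \<in> N \<Longrightarrow> m e' x = x \<and> m x e' = x"
    using is_loopD(2)[OF NL] by blast
  have "e = e'"
  proof -
    have "e' \<in> A" using e'(1) NA by blast
    then have "\<exists>!x. x \<in> A \<and> m e' x = e'" using is_loopD(3)[OF A] by simp
    moreover have "m e' e = e'" "m e' e' = e'" using e(2)[OF \<open>e' \<in> A\<close>] e' by simp_all
    ultimately show ?thesis using e(1) \<open>e' \<in> A\<close> by auto
  qed
  then have eN: "e \<in> N" using e' by simp
  have nN: "lcoset m n N = N" if "n \<in> N" for n
  proof -
    have "\<forall>x \<in> N. m n x \<in> N" "\<forall>b \<in> N. \<exists>x. x \<in> N \<and> m n x = b"
      using is_loopD(1)[OF NL that] ex1_implies_ex[OF is_loopD(3)[OF NL that]] by simp_all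
    then show ?thesis unfolding lcoset_def image_def by fast
  qed
  have self: "x \<in> lcoset m x N" if "x \<in> A" for x
    using imageI[OF eN, of "m x"] e(2)[OF that] unfolding lcoset_def by simp
  have key: "lcoset m x N = lcoset m y N \<longleftrightarrow> x \<in> lcoset m y N" if "x \<in> A" "y \<in> A" for x y
  proof
    assume "x \<in> lcoset m y N"
    then obtain n where n: "n \<in> N" "x = m y n" by (auto simp: lcoset_def)
    have "lcoset m x N = lcoset m y (lcoset m n N)"
      using LL[of y n] n NA that by auto
    then show "lcoset m x N = lcoset m y N" using nN n by simp
  next
    assume "lcoset m x N = lcoset m y N"
    then show "x \<in> lcoset m y N" using self[OF that(1)] by simp
  qed
  have "rdiv A m x y \<in> N \<longleftrightarrow> x \<in> rcoset m N y" if "x \<in> A" "y \<in> A" for x y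
  proof -
    have ex1: "\<exists>!z. z \<in> A \<and> m z y = x" using is_loopD(4)[OF A] that by simp
    then have u: "rdiv A m x y \<in> A \<and> m (rdiv A m x y) y = x"
      unfolding rdiv_def by (rule theI')
    with ex1 have uniq: "z = rdiv A m x y" if "z \<in> A" "m z y = x" for z
      using that by blast
    show ?thesis
    proof
      assume "rdiv A m x y \<in> N"
      then show "x \<in> rcoset m N y" using u unfolding rcoset_def by (auto intro: rev_image_eqI)
    next
      assume "x \<in> rcoset m N y"
      then obtain z where "z \<in> N" "x = m z y" unfolding rcoset_def by blast
      then show "rdiv A m x y \<in> N" using uniq[of z] NA by auto
    qed
  qed
  then show "(x, y) \<in> loop_cong A m N \<longleftrightarrow> x \<in> A \<and> y \<in> A \<and> lcoset m x N = lcoset m y N"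
    using key LR unfolding loop_cong_def by blast
  show "x \<in> A \<Longrightarrow> y \<in> A \<Longrightarrow> lcoset m x N = lcoset m y N \<longleftrightarrow> x \<in> lcoset m y N"
    by (rule key)
qed

text \<open>For normal \<open>N\<close>, the quotient by \<open>loop_cong A m N\<close> is the set of cosets \<open>aN\<close> with
  \<open>(aN) \<cdot> (bN) = (ab)N\<close>.\<close>

lemma loop_quotient:
  assumes A: "is_loop A m" and N: "normal_subloop A m N"
  shows "A // loop_cong A m N = (\<lambda>a. lcoset m a N) ` A"
    and "a \<in> A \<Longrightarrow> b \<in> A \<Longrightarrow>
      quotient_op (loop_cong A m N) m (lcoset m a N) (lcoset m b N) = lcoset m (m a b) N"
    and "congruence A {binop m} (loop_cong A m N)"
proof -
  let ?R = "loop_cong A m N"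
  note iff = loop_cong_iff_lcoset[OF A N]
  have cl: "m a b \<in> A" if "a \<in> A" "b \<in> A" for a b
    using is_loopD(1)[OF A] that by simp
  have NA: "N \<subseteq> A" using N unfolding normal_subloop_def subloop_def by blast
  have LR: "lcoset m a N = rcoset m N a" if "a \<in> A" for a
    using N that unfolding normal_subloop_def by blast
  have LL: "lcoset m a (lcoset m b N) = lcoset m (m a b) N" if "a \<in> A" "b \<in> A" for a b
    using N that unfolding normal_subloop_def by blast
  have RR: "rcoset m (rcoset m N a) b = rcoset m N (m a b)" if "a \<in> A" "b \<in> A" for a b
    using N that unfolding normal_subloop_def by blast
  have cls: "?R `` {a} = lcoset m a N" if "a \<in> A" for a
  proof -
    have "lcoset m a N \<subseteq> A" using NA cl that by (auto simp: lcoset_def)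
    moreover have "(a, x) \<in> ?R \<longleftrightarrow> x \<in> A \<and> x \<in> lcoset m a N" for x
    proof (cases "x \<in> A")
      case True
      then show ?thesis using iff(1)[of a x] iff(2)[OF True that] that by blast
    next
      case False
      then show ?thesis by (simp add: loop_cong_def)
    qed
    ultimately show ?thesis by blast
  qed
  then show "A // ?R = (\<lambda>a. lcoset m a N) ` A"
    by (auto simp: quotient_def)
  have mul: "lcoset m (m x y) N = lcoset m (m x' y') N"
    if "(x, x') \<in> ?R" "(y, y') \<in> ?R" for x x' y y'
  proof -
    have in_A: "x \<in> A" "x' \<in> A" "y \<in> A" "y' \<in> A"
      and eq: "lcoset m x N = lcoset m x' N" "lcoset m y N = lcoset m y' N"
      using that by (simp_all add: iff(1))
    have "lcoset m (m x y) N = lcoset m x (lcoset m y' N)"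
      using LL[of x y] in_A eq by metis
    also have "\<dots> = rcoset m (rcoset m N x) y'"
      using LL[of x y'] LR[of "m x y'"] RR[of x y'] in_A cl by metis
    also have "\<dots> = rcoset m (rcoset m N x') y'"
      using LR[of x] LR[of x'] in_A eq by metis
    also have "\<dots> = lcoset m (m x' y') N"
      using LR[of "m x' y'"] RR[of x' y'] in_A cl by metis
    finally show ?thesis .
  qed
  have eqv: "equiv A ?R"
  proof (rule equivI)
    show "?R \<subseteq> A \<times> A" by (auto simp: loop_cong_def)
    show "refl_on A ?R" unfolding refl_on_def by (simp add: iff(1))
    show "sym ?R" unfolding sym_def by (simp add: iff(1))
    show "trans ?R" unfolding trans_def by (simp add: iff(1))
  qed
  have "(m (xs ! 0) (xs ! 1), m (ys ! 0) (ys ! 1)) \<in> ?R"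
    if "length xs = 2" "list_all2 (\<lambda>x y. (x, y) \<in> ?R) xs ys" for xs ys
  proof -
    have r: "(xs ! 0, ys ! 0) \<in> ?R" "(xs ! 1, ys ! 1) \<in> ?R"
      using that by (auto simp: list_all2_conv_all_nth)
    then show ?thesis using mul[OF r] iff(1) cl by simp
  qed
  then show "congruence A {binop m} ?R"
    using eqv by (auto simp: congruence_def binop_def)
  assume ab: "a \<in> A" "b \<in> A"
  have "?R `` {m x y} = lcoset m (m a b) N" if "x \<in> lcoset m a N" "y \<in> lcoset m b N" for x y
  proof -
    have "(a, x) \<in> ?R" "(b, y) \<in> ?R" using that cls ab by blast+
    then have "(m a b, m x y) \<in> ?R" using mul[of a x b y] iff(1)[of "m a b" "m x y"] cl iff(1)[of a x] iff(1)[of b y] by blast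
    then have "?R `` {m x y} = ?R `` {m a b}" using equiv_class_eq[OF eqv] by blast
    then show ?thesis using cls[of "m a b"] cl ab by simp
  qed
  moreover have "a \<in> lcoset m a N" "b \<in> lcoset m b N"
    using ab iff(2)[of a a] iff(2)[of b b] by blast+
  ultimately show "quotient_op ?R m (lcoset m a N) (lcoset m b N) = lcoset m (m a b) N"
    unfolding quotient_op_def by blast
qed

end

theory Submission
  imports Defs "HOL-Number_Theory.Residues"
begin

text \<open>
  The loop \<open>A\<close> is refined along a chain of congruences descending from \<open>\<theta>\<^sub>0 = loop_cong A m N\<close>
  to equality. Nilpotence lets the chain be chosen so that each step \<open>\<theta> > \<eta>\<close> is central of prime
  order \<open>p\<close> (\<open>exists_central_step\<close>): the kernel of \<open>A/\<eta> \<rightarrow> A/\<theta>\<close> is a central subloop of order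
  \<open>p\<close>. At each step the current multiplication \<open>s\<close>, a binary term operation of \<open>A\<close> for which
  \<open>A/\<theta>\<close> is already supernilpotent, is replaced by another term operation that agrees with it
  modulo \<open>\<theta>\<close> and makes \<open>A/\<eta>\<close> supernilpotent.

  The replacement uses the power map \<open>E x = (\<dots>(x \<cdot> x) \<cdot> \<dots>) \<cdot> x\<close> with \<open>n\<close> factors, where \<open>n\<close> is
  \<open>1\<close> modulo \<open>p\<close> and \<open>0\<close> modulo all other relevant primes. In a supernilpotent loop, a sequence
  that starts with \<open>1\<close> at index \<open>0\<close> and is given by a polynomial symmetric in its labelled
  arguments obeys a formula of Hall-Petrescu type: its \<open>i\<close>-th term is obtained from \<open>1\<close> by
  multiplying, on the right, with constants \<open>\<kappa>\<^sub>j\<close>, each \<open>i choose j\<close> times, and \<open>\<kappa>\<^sub>j\<close> is trivial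
  once \<open>j\<close> exceeds the class. If \<open>n choose j\<close> is divisible by a period of all translations for
  \<open>2 \<le> j\<close> up to the class, then only \<open>\<kappa>\<^sub>1\<close> contributes to the \<open>n\<close>-th term
  (\<open>supernilpotent_sequence\<close>). Applied to the sequence \<open>i \<mapsto> x\<^sup>i \<cdot> y\<^sup>i\<close> this says that \<open>E\<close> is an
  endomorphism of \<open>A/\<theta>\<close>, and similarly it is idempotent: it is the projection to the \<open>p\<close>-part
  (\<open>right_power_hom_idem\<close>).

  Hence the defect \<open>E(x \<cdot> y) \ (E x \<cdot> E y)\<close> is trivial modulo \<open>\<theta>\<close>, that is, central of order
  dividing \<open>p\<close> modulo \<open>\<eta>\<close>. Because \<open>n\<close> is \<open>1\<close> modulo \<open>p\<close>, the map \<open>E\<close> preserves such central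
  factors, so for the new product \<open>x * y = (x \<cdot> y) \<cdot> (E(x \<cdot> y) \ (E x \<cdot> E y))\<close> the map \<open>E\<close>
  becomes a homomorphism from \<open>(A, *)/\<eta>\<close> to \<open>(A, \<cdot>)/\<eta>\<close>. Its kernel meets that of \<open>A/\<eta> \<rightarrow> A/\<theta>\<close>
  trivially, so \<open>(A, *)/\<eta>\<close> is a subdirect product of the supernilpotent loop \<open>A/\<theta>\<close> and the image
  of \<open>E\<close>. That image lies in the subloop of those \<open>x\<close> with \<open>E x \<equiv> x\<close> modulo \<open>\<theta>\<close>, which is
  nilpotent of \<open>p\<close>-power order modulo \<open>\<eta>\<close>.

  Nilpotent loops of \<open>p\<close>-power order are supernilpotent because integer functions on them,
  composed with a polynomial operation, depend on the choices made in each block of variables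
  through a polynomial over the field with \<open>p\<close> elements whose degree is bounded independently of
  the operation (\<open>bounded_degree\<close>). This passes from a quotient to an extension by a central
  subloop of order \<open>p\<close>: the central coordinate of a product is the sum of the coordinates of its
  factors and a function of the factors in the quotient (\<open>bounded_degree_same_prime\<close>). A
  polynomial of degree less than the number of blocks has vanishing alternating sum over the
  cube, and for indicator functions this yields the term condition.

  Once \<open>\<theta>\<close> is equality, \<open>r x y\<close> is the left quotient of \<open>m x y\<close> by \<open>s x y\<close>, which is trivial
  modulo \<open>\<theta>\<^sub>0\<close> and so lies in \<open>N\<close>.
\<close>

section \<open>Binary term functions and congruences\<close>

lemma funpow_fact_card:
  assumes "finite A" "inj_on f A" "f ` A \<subseteq> A" "x \<in> A"
  shows "(f ^^ fact (card A)) x = x"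
proof -
  have mem: "(f ^^ i) y \<in> A" if "y \<in> A" for i y
    using that assms(3) by (induction i) auto
  have inj: "y = z" if "(f ^^ i) y = (f ^^ i) z" "y \<in> A" "z \<in> A" for i y z
    using that
  proof (induction i)
    case (Suc i)
    then show ?case using assms(2) mem by (auto simp: inj_on_def)
  qed auto
  have "\<not> inj_on (\<lambda>i. (f ^^ i) x) {..card A}"
  proof
    assume "inj_on (\<lambda>i. (f ^^ i) x) {..card A}"
    then have "card {..card A} \<le> card A"
      using card_inj_on_le[of "\<lambda>i. (f ^^ i) x" "{..card A}" A] mem assms by auto
    then show False by simp
  qed
  then obtain i j where ij: "i < j" "j \<le> card A" "(f ^^ i) x = (f ^^ j) x"
    by (auto simp: inj_on_def) (metis linorder_neqE_nat)
  then have "(f ^^ i) x = (f ^^ i) ((f ^^ (j - i)) x)"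
    by (metis add_diff_inverse_nat comp_apply funpow_add less_imp_le not_less)
  then have fix1: "(f ^^ (j - i)) x = x" using inj mem assms(4) by metis
  have "((f ^^ (j - i)) ^^ l) x = x" for l by (induction l) (auto simp: fix1)
  moreover have "(j - i) dvd fact (card A)" using ij by (intro dvd_fact) auto
  ultimately show ?thesis by (metis dvd_def funpow_mult mult.commute)
qed

text \<open>The binary term functions of a groupoid, as functions on the whole type: this makes them
  closed under composition without reference to a universe or to lists of arguments.\<close>

inductive_set derived :: "('a \<Rightarrow> 'a \<Rightarrow> 'a) \<Rightarrow> ('a \<Rightarrow> 'a \<Rightarrow> 'a) set"
  for m :: "'a \<Rightarrow> 'a \<Rightarrow> 'a" where
    left: "(\<lambda>x y. x) \<in> derived m"
  | right: "(\<lambda>x y. y) \<in> derived m"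
  | comp: "f \<in> derived m \<Longrightarrow> g \<in> derived m \<Longrightarrow> (\<lambda>x y. m (f x y) (g x y)) \<in> derived m"

text \<open>A family closed under the pointwise operation \<open>m\<close> is closed under every term function of \<open>m\<close>.
  All later transfers from \<open>m\<close> to its term functions (congruences, cubes, term operations) are
  instances.\<close>

lemma derived_closed:
  assumes "t \<in> derived m"
    and "\<And>f g. f \<in> X \<Longrightarrow> g \<in> X \<Longrightarrow> (\<lambda>i. m (f i) (g i)) \<in> X"
    and "f \<in> X" "g \<in> X"
  shows "(\<lambda>i. t (f i) (g i)) \<in> X"
  using assms(1)
proof induction
  case (comp h k)
  from assms(2)[OF comp.IH] show ?case .
qed (use assms(3,4) in simp_all)

lemma derived_self: "m \<in> derived m"
  using derived.comp[OF derived.left derived.right, of m] by simp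

lemma derived_derived:
  assumes "t \<in> derived s" "s \<in> derived m" "f \<in> derived m" "g \<in> derived m"
  shows "(\<lambda>x y. t (f x y) (g x y)) \<in> derived m"
proof -
  let ?X = "{h. (\<lambda>x y. h (x, y)) \<in> derived m}"
  have m: "(\<lambda>i. m (f i) (g i)) \<in> ?X" if "f \<in> ?X" "g \<in> ?X" for f g :: "'a \<times> 'a \<Rightarrow> 'a"
    using that by (auto intro: derived.comp)
  have "(\<lambda>i. s (f i) (g i)) \<in> ?X" if "f \<in> ?X" "g \<in> ?X" for f g
    by (rule derived_closed[OF assms(2) m that])
  then have "(\<lambda>i. t ((\<lambda>(x,y). f x y) i) ((\<lambda>(x,y). g x y) i)) \<in> ?X"
    by (rule derived_closed[OF assms(1)]) (use assms(3,4) in simp_all)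
  then show ?thesis by simp
qed

lemma derived_trans: "t \<in> derived s \<Longrightarrow> s \<in> derived m \<Longrightarrow> t \<in> derived m"
  using derived_derived[OF _ _ derived.left derived.right, of t s m] by simp

lemma derived_iterate_right:
  "f \<in> derived m \<Longrightarrow> g \<in> derived m \<Longrightarrow> (\<lambda>x y. ((\<lambda>z. m z (f x y)) ^^ i) (g x y)) \<in> derived m"
  by (induction i) (auto intro: derived.comp)

lemma derived_iterate_left:
  "f \<in> derived m \<Longrightarrow> g \<in> derived m \<Longrightarrow> (\<lambda>x y. (m (f x y) ^^ i) (g x y)) \<in> derived m"
  by (induction i) (auto intro: derived.comp)

definition compat :: "('a \<Rightarrow> 'a \<Rightarrow> 'a) \<Rightarrow> 'a rel \<Rightarrow> bool" where
  "compat s \<theta> \<longleftrightarrow> (\<forall>x x' y y'. (x, x') \<in> \<theta> \<longrightarrow> (y, y') \<in> \<theta> \<longrightarrow> (s x y, s x' y') \<in> \<theta>)"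

lemma congruence_binop_iff: "congruence A {binop s} \<theta> \<longleftrightarrow> equiv A \<theta> \<and> compat s \<theta>"
proof -
  have "(\<forall>xs ys. length xs = 2 \<longrightarrow> list_all2 (\<lambda>x y. (x, y) \<in> \<theta>) xs ys \<longrightarrow>
      (s (xs ! 0) (xs ! 1), s (ys ! 0) (ys ! 1)) \<in> \<theta>) \<longleftrightarrow> compat s \<theta>" (is "?L = ?R")
  proof
    assume ?L
    show ?R unfolding compat_def
    proof (intro allI impI)
      fix x x' y y' assume "(x, x') \<in> \<theta>" "(y, y') \<in> \<theta>"
      then show "(s x y, s x' y') \<in> \<theta>"
        using \<open>?L\<close>[rule_format, of "[x, y]" "[x', y']"] by simp
    qed
  next
    assume ?R
    then show ?L by (auto simp: compat_def list_all2_conv_all_nth)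
  qed
  then show ?thesis by (auto simp: congruence_def binop_def)
qed

lemma compat_derived:
  assumes "compat m \<theta>" "t \<in> derived m"
  shows "compat t \<theta>"
  unfolding compat_def
proof (intro allI impI)
  fix x x' y y' assume *: "(x, x') \<in> \<theta>" "(y, y') \<in> \<theta>"
  let ?X = "{h. (h True, h False) \<in> \<theta>}"
  have "(\<lambda>i. t (if i then x else x') (if i then y else y')) \<in> ?X"
    by (rule derived_closed[OF assms(2)]) (use assms(1) * in \<open>auto simp: compat_def\<close>)
  then show "(t x y, t x' y') \<in> \<theta>" by simp
qed

section \<open>The term condition on cubes\<close>

text \<open>A polynomial operation evaluated at the corners of a cube, as a function of the set \<open>S\<close> of
  coordinates at which the second endpoint is chosen. Blocks of variables and their lengths
  disappear: an edge in direction \<open>i\<close> may be used with as many endpoint pairs as needed.\<close>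

inductive_set cubes :: "'a set \<Rightarrow> ('a \<Rightarrow> 'a \<Rightarrow> 'a) \<Rightarrow> (nat \<Rightarrow> 'a rel) \<Rightarrow> (nat set \<Rightarrow> 'a) set"
  for A :: "'a set" and s :: "'a \<Rightarrow> 'a \<Rightarrow> 'a" and R :: "nat \<Rightarrow> 'a rel" where
    const: "a \<in> A \<Longrightarrow> (\<lambda>S. a) \<in> cubes A s R"
  | edge: "(a, b) \<in> R i \<Longrightarrow> (\<lambda>S. if i \<in> S then b else a) \<in> cubes A s R"
  | mult: "F \<in> cubes A s R \<Longrightarrow> G \<in> cubes A s R \<Longrightarrow> (\<lambda>S. s (F S) (G S)) \<in> cubes A s R"

lemma cubes_derived:
  assumes "t \<in> derived s" "F \<in> cubes A s R" "G \<in> cubes A s R"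
  shows "(\<lambda>S. t (F S) (G S)) \<in> cubes A s R"
  by (rule derived_closed[OF assms(1) _ assms(2,3)]) (rule cubes.mult)

text \<open>Restricting to a face of the cube, or identifying directions, again gives a cube.\<close>

lemma cubes_reindex:
  assumes "F \<in> cubes A s (\<lambda>_. A \<times> A)"
    and "\<And>i. (\<exists>b. \<forall>S. i \<in> \<phi> S \<longleftrightarrow> b) \<or> (\<exists>j. \<forall>S. i \<in> \<phi> S \<longleftrightarrow> j \<in> S)"
  shows "(\<lambda>S. F (\<phi> S)) \<in> cubes A s (\<lambda>_. A \<times> A)"
  using assms(1)
proof induction
  case (edge a b i)
  from assms(2)[of i] show ?case
  proof
    assume "\<exists>c. \<forall>S. i \<in> \<phi> S \<longleftrightarrow> c"
    then obtain c where "\<And>S. i \<in> \<phi> S \<longleftrightarrow> c" by blast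
    then show ?thesis using edge by (cases c) (auto intro: cubes.const)
  next
    assume "\<exists>j. \<forall>S. i \<in> \<phi> S \<longleftrightarrow> j \<in> S"
    then obtain j where "\<And>S. i \<in> \<phi> S \<longleftrightarrow> j \<in> S" by blast
    then show ?thesis using edge by (auto intro: cubes.edge)
  qed
qed (auto intro: cubes.const cubes.mult)

lemma cubes_in:
  assumes "F \<in> cubes A s R" "\<And>x y. x \<in> A \<Longrightarrow> y \<in> A \<Longrightarrow> s x y \<in> A" "\<And>i. R i \<subseteq> A \<times> A"
  shows "F S \<in> A"
  using assms(1) by induction (use assms(2,3) in \<open>auto split: if_splits\<close>)

text \<open>The condition of \<open>centralizes\<close> for \<open>k + 1\<close> blocks, with direction \<open>k\<close> as the distinguished one
  and \<open>R i\<close> as the congruence of block \<open>i\<close>.\<close>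

definition term_cond :: "'a set \<Rightarrow> ('a \<Rightarrow> 'a \<Rightarrow> 'a) \<Rightarrow> (nat \<Rightarrow> 'a rel) \<Rightarrow> nat \<Rightarrow> 'a rel \<Rightarrow> bool" where
  "term_cond A s R k \<delta> \<longleftrightarrow> (\<forall>F \<in> cubes A s R.
     (\<forall>S. S \<subset> {..<k} \<longrightarrow> (F S, F (insert k S)) \<in> \<delta>) \<longrightarrow> (F {..<k}, F (insert k {..<k})) \<in> \<delta>)"

lemma term_condD:
  assumes "term_cond A s R k \<delta>" "F \<in> cubes A s R"
    and "\<And>S. S \<subset> {..<k} \<Longrightarrow> (F S, F (insert k S)) \<in> \<delta>"
  shows "(F {..<k}, F (insert k {..<k})) \<in> \<delta>"
  using assms unfolding term_cond_def by simp

text \<open>Identify directions \<open>k\<close> and \<open>k + 1\<close> in the cube: direction \<open>k\<close> is frozen at its second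
  endpoint, and direction \<open>k + 1\<close> takes over its distinguished role.\<close>

lemma term_cond_Suc:
  assumes "term_cond A s (\<lambda>_. A \<times> A) k \<delta>"
  shows "term_cond A s (\<lambda>_. A \<times> A) (Suc k) \<delta>"
  unfolding term_cond_def
proof (intro ballI impI)
  fix F assume F: "F \<in> cubes A s (\<lambda>_. A \<times> A)"
    and pr: "\<forall>S. S \<subset> {..<Suc k} \<longrightarrow> (F S, F (insert (Suc k) S)) \<in> \<delta>"
  define \<phi> where "\<phi> S = insert k (S \<inter> {..<k}) \<union> (if k \<in> S then {Suc k} else {})" for S
  have G: "(\<lambda>S. F (\<phi> S)) \<in> cubes A s (\<lambda>_. A \<times> A)"
  proof (rule cubes_reindex[OF F])
    fix i
    show "(\<exists>b. \<forall>S. i \<in> \<phi> S \<longleftrightarrow> b) \<or> (\<exists>j. \<forall>S. i \<in> \<phi> S \<longleftrightarrow> j \<in> S)"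
      by (cases "i < k"; cases "i = Suc k") (auto simp: \<phi>_def)
  qed
  have "(F (\<phi> S), F (\<phi> (insert k S))) \<in> \<delta>" if "S \<subset> {..<k}" for S
  proof -
    have "S \<inter> {..<k} = S" "k \<notin> S" using that by auto
    then have "\<phi> S = insert k S" "\<phi> (insert k S) = insert (Suc k) (insert k S)"
      by (auto simp: \<phi>_def)
    moreover have "insert k S \<subset> {..<Suc k}" using that by force
    ultimately show ?thesis using pr by simp
  qed
  then have "(F (\<phi> {..<k}), F (\<phi> (insert k {..<k}))) \<in> \<delta>"
    by (rule term_condD[OF assms G])
  moreover have "\<phi> {..<k} = {..<Suc k}" "\<phi> (insert k {..<k}) = insert (Suc k) {..<Suc k}"
    by (auto simp: \<phi>_def)
  ultimately show "(F {..<Suc k}, F (insert (Suc k) {..<Suc k})) \<in> \<delta>" by simp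
qed

lemma term_cond_mono:
  assumes "term_cond A s (\<lambda>_. A \<times> A) k \<delta>" "k \<le> k'"
  shows "term_cond A s (\<lambda>_. A \<times> A) k' \<delta>"
  using assms(2,1) by (induction rule: dec_induct) (auto intro: term_cond_Suc)

lemma poly_ops_cube:
  assumes "f \<in> poly_ops A {binop s} n" "\<And>S. C S \<in> tuples A n"
    and "\<And>i. i < n \<Longrightarrow> (\<lambda>S. C S ! i) \<in> cubes A s R"
  shows "(\<lambda>S. f (C S)) \<in> cubes A s R"
  using assms(1) unfolding poly_ops_def
proof induction
  case (proj i)
  then show ?case using assms(2,3) by simp
next
  case (comp k f gs)
  show ?case
  proof (cases "(k, f) = binop s")
    case True
    then obtain g h where gs: "gs = [g, h]" using comp(2)
      by (auto simp: binop_def numeral_2_eq_2 length_Suc_conv)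
    show ?thesis using comp(3) True assms(2) cubes.mult[of "\<lambda>S. g (C S)" A s R "\<lambda>S. h (C S)"]
      by (simp add: gs binop_def)
  next
    case False
    then show ?thesis using comp(1,2) assms(2) by (auto intro: cubes.const)
  qed
qed

lemma poly_ops_binop:
  assumes "f \<in> poly_ops A {binop s} n" "g \<in> poly_ops A {binop s} n"
  shows "restrict (\<lambda>xs. s (f xs) (g xs)) (tuples A n) \<in> poly_ops A {binop s} n"
  using term_ops.comp[of 2 "\<lambda>xs. s (xs ! 0) (xs ! 1)" "{binop s} \<union> (\<lambda>a. (0, \<lambda>_. a)) ` A" "[f, g]" A n]
    assms unfolding poly_ops_def by (simp add: binop_def)

lemma poly_ops_const:
  assumes "a \<in> A"
  shows "restrict (\<lambda>xs. a) (tuples A n) \<in> poly_ops A {binop s} n"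
  using term_ops.comp[of 0 "\<lambda>xs. a" "{binop s} \<union> (\<lambda>a. (0, \<lambda>_. a)) ` A" "[]" A n]
    assms unfolding poly_ops_def by simp

lemma nth_concat_map_upt:
  assumes "i < n" "j < length (g i)"
  shows "concat (map g [0..<n]) ! (length (concat (map g [0..<i])) + j) = g i ! j"
    and "length (concat (map g [0..<i])) + j < length (concat (map g [0..<n]))"
proof -
  have "[0..<n] = [0..<i] @ i # [Suc i..<n]"
    using assms(1) by (metis less_imp_le_nat upt_add_eq_append upt_conv_Cons le_add_diff_inverse zero_le)
  then have e: "concat (map g [0..<n]) = concat (map g [0..<i]) @ g i @ concat (map g [Suc i..<n])"
    by simp
  show "concat (map g [0..<n]) ! (length (concat (map g [0..<i])) + j) = g i ! j"
    unfolding e using assms(2) by (simp add: nth_append)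
  show "length (concat (map g [0..<i])) + j < length (concat (map g [0..<n]))"
    unfolding e using assms(2) by simp
qed

lemma concat_upt_position:
  assumes "l < length (concat (map g [0..<n]))"
  shows "\<exists>i<n. \<exists>j<length (g i). l = length (concat (map g [0..<i])) + j"
  using assms
proof (induction n)
  case (Suc n)
  show ?case
  proof (cases "l < length (concat (map g [0..<n]))")
    case True
    then show ?thesis using Suc.IH less_SucI by blast
  next
    case False
    then have "l - length (concat (map g [0..<n])) < length (g n)"
      "l = length (concat (map g [0..<n])) + (l - length (concat (map g [0..<n])))"
      using Suc.prems by auto
    then show ?thesis by blast
  qed
qed simp

lemma corner_nth:
  assumes "length bs = length as" "\<And>i. i < length as \<Longrightarrow> length (bs ! i) = length (as ! i)"
    and "i < length as" "j < length (as ! i)"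
  shows "corner as bs S ! (length (concat (map (nth as) [0..<i])) + j) =
    (if i \<in> S then bs ! i ! j else as ! i ! j)"
proof -
  let ?g = "\<lambda>i. if i \<in> S then bs ! i else as ! i"
  have "length (concat (map ?g [0..<i])) = length (concat (map (nth as) [0..<i]))"
    unfolding length_concat map_map
    by (rule arg_cong[where f = sum_list], rule map_cong) (use assms(2,3) in auto)
  moreover have "j < length (?g i)" using assms by auto
  ultimately show ?thesis
    using nth_concat_map_upt(1)[OF assms(3), of j ?g] unfolding corner_def by auto
qed

lemma term_cond_imp_centralizes:
  assumes "term_cond A s R (length \<alpha>s - 1) \<delta>"
    and "\<forall>\<alpha>\<in>set \<alpha>s. \<alpha> \<subseteq> A \<times> A" "\<And>i. i < length \<alpha>s \<Longrightarrow> \<alpha>s ! i \<subseteq> R i"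
  shows "centralizes A {binop s} \<alpha>s \<delta>"
  unfolding centralizes_def Let_def
proof (intro allI ballI impI)
  fix as bs f
  assume f: "f \<in> poly_ops A {binop s} (length (concat as))"
    and len: "length as = length \<alpha>s" "length bs = length \<alpha>s"
    and rel: "\<forall>i<length \<alpha>s. list_all2 (\<lambda>x y. (x, y) \<in> \<alpha>s ! i) (as ! i) (bs ! i)"
    and prem: "\<forall>S\<subset>{..<length \<alpha>s - 1}.
      (f (corner as bs S), f (corner as bs (insert (length \<alpha>s - 1) S))) \<in> \<delta>"
  have "(\<lambda>S. f (corner as bs S)) \<in> cubes A s R"
  proof (rule poly_ops_cube[OF f])
    show "corner as bs S \<in> tuples A (length (concat as))" for S
      using corner_in_tuples[OF len assms(2) rel] .
    fix l assume "l < length (concat as)"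
    then have "l < length (concat (map (nth as) [0..<length as]))" by (simp add: map_nth)
    from concat_upt_position[OF this] obtain i j where
      ij: "i < length as" "j < length (as ! i)" "l = length (concat (map (nth as) [0..<i])) + j"
      by blast
    have "(as ! i ! j, bs ! i ! j) \<in> R i"
      using rel ij len assms(3)[of i] by (auto simp: list_all2_conv_all_nth)
    moreover have "corner as bs S ! l = (if i \<in> S then bs ! i ! j else as ! i ! j)" for S
      unfolding ij(3) by (rule corner_nth) (use rel len ij in \<open>auto simp: list_all2_conv_all_nth\<close>)
    ultimately show "(\<lambda>S. corner as bs S ! l) \<in> cubes A s R" by (simp add: cubes.edge)
  qed
  then show "(f (corner as bs {..<length \<alpha>s - 1}),
      f (corner as bs (insert (length \<alpha>s - 1) {..<length \<alpha>s - 1}))) \<in> \<delta>"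
    by (rule term_condD[OF assms(1)]) (use prem in blast)
qed

text \<open>Let block \<open>i\<close> list all pairs of the finite relation \<open>\<alpha>\<^sub>i\<close>. Then every edge in direction \<open>i\<close> is
  a coordinate of this one universal corner, so each cube is a polynomial operation evaluated at
  it, without any merging of blocks for the subterms.\<close>

lemma centralizes_imp_term_cond:
  assumes fin: "finite A" and ne: "\<alpha>s \<noteq> []"
    and sub: "\<forall>\<alpha>\<in>set \<alpha>s. \<alpha> \<subseteq> A \<times> A"
    and cent: "centralizes A {binop s} \<alpha>s \<delta>"
    and R: "\<And>i. R i \<subseteq> A \<times> A" "\<And>i. i < length \<alpha>s \<Longrightarrow> R i \<subseteq> \<alpha>s ! i"
  shows "term_cond A s R (length \<alpha>s - 1) \<delta>"
  unfolding term_cond_def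
proof (intro ballI impI)
  let ?k = "length \<alpha>s - 1"
  fix F assume F: "F \<in> cubes A s R"
    and prem: "\<forall>S. S \<subset> {..<?k} \<longrightarrow> (F S, F (insert ?k S)) \<in> \<delta>"
  have "\<exists>ps. set ps = \<alpha>s ! i" if "i < length \<alpha>s" for i
    using finite_list[of "\<alpha>s ! i"] finite_subset[of "\<alpha>s ! i" "A \<times> A"] sub fin that by auto
  then obtain ps where ps: "\<And>i. i < length \<alpha>s \<Longrightarrow> set (ps i) = \<alpha>s ! i" by metis
  define as bs where "as = map (\<lambda>i. map fst (ps i)) [0..<length \<alpha>s]"
    and "bs = map (\<lambda>i. map snd (ps i)) [0..<length \<alpha>s]"
  have len: "length as = length \<alpha>s" "length bs = length \<alpha>s" by (auto simp: as_def bs_def)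
  have rel: "\<forall>i<length \<alpha>s. list_all2 (\<lambda>x y. (x, y) \<in> \<alpha>s ! i) (as ! i) (bs ! i)"
    using ps by (auto simp: as_def bs_def list_all2_conv_all_nth simp flip: ps)
  let ?n = "length (concat as)"
  have tup: "corner as bs S \<in> tuples A ?n" for S
    using corner_in_tuples[OF len sub rel] .
  have "\<exists>f \<in> poly_ops A {binop s} ?n. \<forall>S\<subseteq>{..<length \<alpha>s}. F S = f (corner as bs S)"
    using F
  proof induction
    case (const a)
    show ?case by (rule bexI[OF _ poly_ops_const[OF const]]) (use tup in simp)
  next
    case (edge a b i)
    show ?case
    proof (cases "i < length \<alpha>s")
      case False
      have "a \<in> A" using edge R(1) by blast
      show ?thesis
        by (rule bexI[OF _ poly_ops_const[OF \<open>a \<in> A\<close>]]) (use tup False in auto)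
    next
      case True
      then have "(a, b) \<in> set (ps i)" using edge R(2) ps by blast
      then obtain j where j: "j < length (ps i)" "ps i ! j = (a, b)"
        by (auto simp: in_set_conv_nth)
      let ?l = "length (concat (map (nth as) [0..<i])) + j"
      have "?l < length (concat (map (nth as) [0..<length as]))"
        by (rule nth_concat_map_upt(2)) (use True j len in \<open>auto simp: as_def\<close>)
      then have l: "?l < ?n" by (simp add: map_nth)
      have c: "corner as bs S ! ?l = (if i \<in> S then bs ! i ! j else as ! i ! j)" for S
        by (rule corner_nth) (use True j len in \<open>auto simp: as_def bs_def\<close>)
      have e: "as ! i ! j = a" "bs ! i ! j = b" using True j by (auto simp: as_def bs_def)
      have "restrict (\<lambda>xs. xs ! ?l) (tuples A ?n) \<in> poly_ops A {binop s} ?n"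
        unfolding poly_ops_def by (rule term_ops.proj[OF l])
      then show ?thesis
        by (rule bexI[rotated]) (use c e tup in auto)
    qed
  next
    case (mult F G)
    then obtain f g where f: "f \<in> poly_ops A {binop s} ?n" "g \<in> poly_ops A {binop s} ?n"
      "\<forall>S\<subseteq>{..<length \<alpha>s}. F S = f (corner as bs S)"
      "\<forall>S\<subseteq>{..<length \<alpha>s}. G S = g (corner as bs S)" by blast
    show ?case by (rule bexI[OF _ poly_ops_binop[OF f(1,2)]]) (use tup f(3,4) in simp)
  qed
  then obtain f where f: "f \<in> poly_ops A {binop s} ?n"
    "\<And>S. S \<subseteq> {..<length \<alpha>s} \<Longrightarrow> F S = f (corner as bs S)" by blast
  have k: "insert ?k {..<?k} = {..<length \<alpha>s}" using ne by (cases \<alpha>s) auto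
  have "(f (corner as bs S), f (corner as bs (insert ?k S))) \<in> \<delta>" if "S \<subset> {..<?k}" for S
  proof -
    have "S \<subseteq> {..<length \<alpha>s}" "insert ?k S \<subseteq> {..<length \<alpha>s}" using that k by auto
    then show ?thesis using prem that f(2) by metis
  qed
  then have "(f (corner as bs {..<?k}), f (corner as bs (insert ?k {..<?k}))) \<in> \<delta>"
    using cent f(1) len rel unfolding centralizes_def Let_def by blast
  moreover have "{..<?k} \<subseteq> {..<length \<alpha>s}" by auto
  ultimately show "(F {..<?k}, F (insert ?k {..<?k})) \<in> \<delta>"
    using f(2) k by simp
qed

lemma algebra_on_binop: "algebra_on A {binop s} \<longleftrightarrow> (\<forall>x\<in>A. \<forall>y\<in>A. s x y \<in> A)"
proof -
  have "s x y \<in> A" if "\<forall>xs\<in>tuples A 2. s (xs ! 0) (xs ! 1) \<in> A" "x \<in> A" "y \<in> A" for x y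
    using that(1)[rule_format, of "[x, y]"] that(2,3) by (simp add: tuples_def)
  moreover have "xs ! 0 \<in> A \<and> xs ! 1 \<in> A" if "xs \<in> tuples A 2" for xs
    using that by (auto simp: tuples_def subset_iff)
  ultimately show ?thesis by (auto simp: algebra_on_def binop_def)
qed

lemma supernilpotent_if_term_cond:
  assumes cl: "\<And>x y. x \<in> A \<Longrightarrow> y \<in> A \<Longrightarrow> s x y \<in> A"
    and "1 \<le> k" and tc: "term_cond A s (\<lambda>_. A \<times> A) k (Id_on A)"
  shows "supernilpotent A {binop s}"
proof -
  let ?\<alpha>s = "replicate (k + 1) (A \<times> A)"
  have alg: "algebra_on A {binop s}" using cl by (simp add: algebra_on_binop)
  have sub: "\<forall>\<alpha>\<in>set ?\<alpha>s. \<alpha> \<subseteq> A \<times> A" by auto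
  have "centralizes A {binop s} ?\<alpha>s (Id_on A)"
    by (rule term_cond_imp_centralizes[where R = "\<lambda>_. A \<times> A"])
      (use tc in \<open>auto simp del: replicate_Suc\<close>)
  moreover have cong: "congruence A {binop s} (Id_on A)"
    unfolding congruence_binop_iff using cl
    by (auto simp: compat_def equiv_def refl_on_def sym_def trans_def)
  ultimately have "commutator A {binop s} ?\<alpha>s \<subseteq> Id_on A"
    using commutator_least(3)[OF alg sub] by blast
  moreover have "Id_on A \<subseteq> commutator A {binop s} ?\<alpha>s"
    using commutator_least(1)[OF alg sub]
    unfolding congruence_def equiv_def refl_on_def by auto
  ultimately show ?thesis unfolding supernilpotent_def using \<open>1 \<le> k\<close> by blast
qed

text \<open>Cubes of the quotient are the images of cubes of \<open>A\<close>, so the term condition of the quotient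
  modulo equality is that of \<open>A\<close> modulo \<open>\<theta>\<close>.\<close>

lemma term_cond_of_supernilpotent_quotient:
  assumes fin: "finite A" and cl: "\<And>x y. x \<in> A \<Longrightarrow> y \<in> A \<Longrightarrow> m x y \<in> A"
    and cong: "congruence A {binop m} \<theta>"
    and sn: "supernilpotent (A // \<theta>) {binop (quotient_op \<theta> m)}"
  shows "\<exists>k\<ge>1. term_cond A m (\<lambda>_. A \<times> A) k \<theta>"
proof -
  let ?Q = "A // \<theta>" and ?q = "quotient_op \<theta> m"
  have eqv: "equiv A \<theta>" and comp: "compat m \<theta>" using cong by (auto simp: congruence_binop_iff)
  have q: "?q (\<theta> `` {x}) (\<theta> `` {y}) = \<theta> `` {m x y}" if "x \<in> A" "y \<in> A" for x y
  proof -
    have "\<theta> `` {m x' y'} = \<theta> `` {m x y}" if "x' \<in> \<theta> `` {x}" "y' \<in> \<theta> `` {y}" for x' y'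
      using that comp equiv_class_eq[OF eqv, of "m x y" "m x' y'"] by (auto simp: compat_def)
    moreover have "x \<in> \<theta> `` {x}" "y \<in> \<theta> `` {y}"
      using that equiv_class_self[OF eqv] by blast+
    ultimately show ?thesis unfolding quotient_op_def by blast
  qed
  have qcl: "?q X Y \<in> ?Q" if "X \<in> ?Q" "Y \<in> ?Q" for X Y
    using that cl q by (auto elim!: quotientE intro!: quotientI)
  obtain k where k: "1 \<le> k"
    "commutator ?Q {binop ?q} (replicate (k + 1) (?Q \<times> ?Q)) = Id_on ?Q"
    using sn unfolding supernilpotent_def by blast
  have "centralizes ?Q {binop ?q} (replicate (k + 1) (?Q \<times> ?Q)) (Id_on ?Q)"
    unfolding k(2)[symmetric]
    by (rule commutator_least(2)) (use qcl in \<open>auto simp: algebra_on_binop\<close>)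
  moreover have "finite ?Q" using fin eqv by (simp add: finite_quotient equiv_type)
  ultimately have "term_cond ?Q ?q (\<lambda>_. ?Q \<times> ?Q) (length (replicate (k + 1) (?Q \<times> ?Q)) - 1) (Id_on ?Q)"
    by (intro centralizes_imp_term_cond) (auto simp del: replicate_Suc)
  then have tc: "term_cond ?Q ?q (\<lambda>_. ?Q \<times> ?Q) k (Id_on ?Q)" by simp
  have "term_cond A m (\<lambda>_. A \<times> A) k \<theta>"
    unfolding term_cond_def
  proof (intro ballI impI)
    fix F assume F: "F \<in> cubes A m (\<lambda>_. A \<times> A)"
      and prem: "\<forall>S. S \<subset> {..<k} \<longrightarrow> (F S, F (insert k S)) \<in> \<theta>"
    have FA: "F S \<in> A" for S using cubes_in[OF F cl] by auto
    have "(\<lambda>S. \<theta> `` {F S}) \<in> cubes ?Q ?q (\<lambda>_. ?Q \<times> ?Q)"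
      using F
    proof induction
      case (const a)
      then show ?case by (auto intro: cubes.const quotientI)
    next
      case (edge a b i)
      then have "(\<lambda>S. if i \<in> S then \<theta> `` {b} else \<theta> `` {a}) \<in> cubes ?Q ?q (\<lambda>_. ?Q \<times> ?Q)"
        by (intro cubes.edge) (auto intro: quotientI)
      then show ?case by (simp add: if_distrib[of "\<lambda>x. \<theta> `` {x}"])
    next
      case (mult F G)
      have "F S \<in> A" "G S \<in> A" for S using cubes_in[OF _ cl] mult.hyps by auto
      then show ?case using cubes.mult[OF mult.IH] by (simp add: q)
    qed
    then have "(\<theta> `` {F {..<k}}, \<theta> `` {F (insert k {..<k})}) \<in> Id_on ?Q"
      by (rule term_condD[OF tc]) (use prem FA eqv in \<open>auto simp: quotientI equiv_class_eq_iff\<close>)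
    then show "(F {..<k}, F (insert k {..<k})) \<in> \<theta>"
      using FA eq_equiv_class_iff[OF eqv] by (simp add: Id_on_iff)
  qed
  then show ?thesis using k(1) by blast
qed

section \<open>Finite loops\<close>

lemma funpow_funpow: "(f ^^ i) ((f ^^ j) x) = (f ^^ (i + j)) x"
  by (simp add: funpow_add)

locale finite_loop =
  fixes A :: "'a set" and s :: "'a \<Rightarrow> 'a \<Rightarrow> 'a" and u :: 'a
  assumes fin: "finite A" and unit_in: "u \<in> A"
    and closed: "x \<in> A \<Longrightarrow> y \<in> A \<Longrightarrow> s x y \<in> A"
    and left_unit: "x \<in> A \<Longrightarrow> s u x = x" and right_unit: "x \<in> A \<Longrightarrow> s x u = x"
    and left_cancel: "\<lbrakk>a \<in> A; x \<in> A; y \<in> A; s a x = s a y\<rbrakk> \<Longrightarrow> x = y"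
    and right_cancel: "\<lbrakk>a \<in> A; x \<in> A; y \<in> A; s x a = s y a\<rbrakk> \<Longrightarrow> x = y"
begin

lemma right_iterate_in: "x \<in> A \<Longrightarrow> y \<in> A \<Longrightarrow> ((\<lambda>z. s z x) ^^ i) y \<in> A"
  by (induction i) (auto intro: closed)

lemma left_iterate_in: "x \<in> A \<Longrightarrow> y \<in> A \<Longrightarrow> (s x ^^ i) y \<in> A"
  by (induction i) (auto intro: closed)

lemma right_iterate_period: "x \<in> A \<Longrightarrow> y \<in> A \<Longrightarrow> ((\<lambda>z. s z x) ^^ fact (card A)) y = y"
  by (rule funpow_fact_card[OF fin]) (auto simp: inj_on_def closed intro: right_cancel)

lemma left_iterate_period: "x \<in> A \<Longrightarrow> y \<in> A \<Longrightarrow> (s x ^^ fact (card A)) y = y"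
  by (rule funpow_fact_card[OF fin]) (auto simp: inj_on_def closed intro: left_cancel)

text \<open>Translations permute the finite set \<open>A\<close>, so their inverses are iterates. In this form the
  divisions are visibly term functions of the multiplication.\<close>

definition ldiv :: "'a \<Rightarrow> 'a \<Rightarrow> 'a" where "ldiv x y = (s x ^^ (fact (card A) - 1)) y"
definition rdivide :: "'a \<Rightarrow> 'a \<Rightarrow> 'a" where "rdivide y x = ((\<lambda>z. s z x) ^^ (fact (card A) - 1)) y"

lemma fact_Suc_pred: "fact (card A) = Suc (fact (card A) - 1)"
  by (simp add: fact_gt_zero)

lemma ldiv_in: "x \<in> A \<Longrightarrow> y \<in> A \<Longrightarrow> ldiv x y \<in> A"
  by (simp add: ldiv_def left_iterate_in)

lemma rdivide_in: "x \<in> A \<Longrightarrow> y \<in> A \<Longrightarrow> rdivide y x \<in> A"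
  by (simp add: rdivide_def right_iterate_in)

lemma mult_ldiv: "x \<in> A \<Longrightarrow> y \<in> A \<Longrightarrow> s x (ldiv x y) = y"
  using left_iterate_period[of x y] fact_Suc_pred unfolding ldiv_def
  by (metis comp_apply funpow.simps(2))

lemma rdivide_mult: "x \<in> A \<Longrightarrow> y \<in> A \<Longrightarrow> s (rdivide y x) x = y"
  using right_iterate_period[of x y] fact_Suc_pred unfolding rdivide_def
  by (metis comp_apply funpow.simps(2))

lemma ldiv_mult: "x \<in> A \<Longrightarrow> y \<in> A \<Longrightarrow> ldiv x (s x y) = y"
  by (rule left_cancel[of x]) (simp_all add: mult_ldiv closed ldiv_in)

lemma rdivide_cancel: "x \<in> A \<Longrightarrow> y \<in> A \<Longrightarrow> rdivide (s y x) x = y"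
  by (rule right_cancel[of x]) (simp_all add: rdivide_mult closed rdivide_in)

lemma ldiv_self: "x \<in> A \<Longrightarrow> ldiv x x = u"
  using ldiv_mult[of x u] by (simp add: right_unit unit_in)

lemma rdivide_self: "x \<in> A \<Longrightarrow> rdivide x x = u"
  using rdivide_cancel[of x u] by (simp add: left_unit unit_in)

lemma ldiv_derived: "ldiv \<in> derived s"
  using derived_iterate_left[OF derived.left derived.right, where m = s] unfolding ldiv_def[abs_def] .

lemma rdivide_derived: "rdivide \<in> derived s"
  using derived_iterate_right[OF derived.right derived.left, where m = s] unfolding rdivide_def[abs_def] .

end

lemma finite_loop_of_is_loop:
  assumes "finite A" "is_loop A m"
  obtains u where "finite_loop A m u"
proof -
  obtain u where u: "u \<in> A" "\<forall>x\<in>A. m u x = x \<and> m x u = x" using is_loopD(2)[OF assms(2)] by blast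
  have "finite_loop A m u"
  proof
    show "x = y" if "a \<in> A" "x \<in> A" "y \<in> A" "m a x = m a y" for a x y
      using is_loopD(3)[OF assms(2) that(1), of "m a x"] is_loopD(1)[OF assms(2)] that by metis
    show "x = y" if "a \<in> A" "x \<in> A" "y \<in> A" "m x a = m y a" for a x y
      using is_loopD(4)[OF assms(2) that(1), of "m x a"] is_loopD(1)[OF assms(2)] that by metis
  qed (use u assms is_loopD(1) in auto)
  then show thesis using that by blast
qed

lemma (in finite_loop) is_loop: "is_loop A s"
  unfolding is_loop_def
proof (intro conjI ballI)
  show "\<exists>e\<in>A. \<forall>x\<in>A. s e x = x \<and> s x e = x" using unit_in left_unit right_unit by blast
  fix a b assume "a \<in> A" "b \<in> A"
  then show "\<exists>!x. x \<in> A \<and> s a x = b" "\<exists>!y. y \<in> A \<and> s y a = b"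
    using left_cancel right_cancel mult_ldiv rdivide_mult ldiv_in rdivide_in by metis+
qed (rule closed)

lemma compatD: "compat s \<theta> \<Longrightarrow> (x, x') \<in> \<theta> \<Longrightarrow> (y, y') \<in> \<theta> \<Longrightarrow> (s x y, s x' y') \<in> \<theta>"
  unfolding compat_def by blast

lemma congrD:
  assumes "congruence A {binop s} \<theta>"
  shows congr_in: "(x, y) \<in> \<theta> \<Longrightarrow> x \<in> A \<and> y \<in> A"
    and congr_refl: "x \<in> A \<Longrightarrow> (x, x) \<in> \<theta>"
    and congr_sym: "(x, y) \<in> \<theta> \<Longrightarrow> (y, x) \<in> \<theta>"
    and congr_trans: "(x, y) \<in> \<theta> \<Longrightarrow> (y, z) \<in> \<theta> \<Longrightarrow> (x, z) \<in> \<theta>"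
    and congr_mult: "(x, x') \<in> \<theta> \<Longrightarrow> (y, y') \<in> \<theta> \<Longrightarrow> (s x y, s x' y') \<in> \<theta>"
proof -
  have e: "equiv A \<theta>" and c: "compat s \<theta>" using assms by (auto simp: congruence_binop_iff)
  show "(x, y) \<in> \<theta> \<Longrightarrow> x \<in> A \<and> y \<in> A" using equiv_type[OF e] by blast
  show "x \<in> A \<Longrightarrow> (x, x) \<in> \<theta>" using e by (simp add: equiv_def refl_on_def)
  show "(x, y) \<in> \<theta> \<Longrightarrow> (y, x) \<in> \<theta>" using e by (auto simp: equiv_def elim: symE)
  show "(x, y) \<in> \<theta> \<Longrightarrow> (y, z) \<in> \<theta> \<Longrightarrow> (x, z) \<in> \<theta>" using e by (auto simp: equiv_def elim: transE)
  show "(x, x') \<in> \<theta> \<Longrightarrow> (y, y') \<in> \<theta> \<Longrightarrow> (s x y, s x' y') \<in> \<theta>" using c by (rule compatD)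
qed

lemma congr_derived: "congruence A {binop s} \<theta> \<Longrightarrow> t \<in> derived s \<Longrightarrow> congruence A {binop t} \<theta>"
  unfolding congruence_binop_iff using compat_derived by blast

lemma congrI:
  assumes "\<theta> \<subseteq> A \<times> A" "\<And>x. x \<in> A \<Longrightarrow> (x, x) \<in> \<theta>" "\<And>x y. (x, y) \<in> \<theta> \<Longrightarrow> (y, x) \<in> \<theta>"
    "\<And>x y z. (x, y) \<in> \<theta> \<Longrightarrow> (y, z) \<in> \<theta> \<Longrightarrow> (x, z) \<in> \<theta>"
    "\<And>x x' y y'. (x, x') \<in> \<theta> \<Longrightarrow> (y, y') \<in> \<theta> \<Longrightarrow> (s x y, s x' y') \<in> \<theta>"
  shows "congruence A {binop s} \<theta>"
  unfolding congruence_binop_iff compat_def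
  by (intro conjI equivI symI transI refl_onI allI impI) (fact assms)+

context finite_loop
begin

lemma congr_left_cancel:
  assumes "congruence A {binop s} \<theta>" "(s a x, s a y) \<in> \<theta>" "a \<in> A" "x \<in> A" "y \<in> A"
  shows "(x, y) \<in> \<theta>"
proof -
  have "(ldiv a (s a x), ldiv a (s a y)) \<in> \<theta>"
    by (rule congr_mult[OF congr_derived[OF assms(1) ldiv_derived]])
      (use assms congr_refl[OF assms(1)] in auto)
  then show ?thesis using assms by (simp add: ldiv_mult)
qed

text \<open>Congruences of a loop permute: if \<open>x\<close> is \<open>\<beta>\<close>-related to \<open>z\<close> and \<open>z\<close> is \<open>\<alpha>\<close>-related to \<open>y\<close>,
  then the Mal'cev term \<open>(x / z) y\<close> is \<open>\<alpha>\<close>-related to \<open>x\<close> and \<open>\<beta>\<close>-related to \<open>y\<close>.\<close>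

lemma congr_comp:
  assumes \<alpha>: "congruence A {binop s} \<alpha>" and \<beta>: "congruence A {binop s} \<beta>"
  shows "congruence A {binop s} (\<alpha> O \<beta>)"
proof (rule congrI)
  have swap: "(x, y) \<in> \<alpha>' O \<beta>'" if "(x, z) \<in> \<beta>'" "(z, y) \<in> \<alpha>'" "congruence A {binop s} \<alpha>'" "congruence A {binop s} \<beta>'"
    for x y z \<alpha>' \<beta>'
  proof -
    note a = congrD[OF that(3)] and b = congrD[OF that(4)]
    have xyz: "x \<in> A" "y \<in> A" "z \<in> A" using that a(1) b(1) by auto
    let ?w = "s (rdivide x z) y"
    have "(s (rdivide x z) z, ?w) \<in> \<alpha>'"
      by (rule a(5)[OF a(2)[OF rdivide_in[OF xyz(3,1)]] that(2)])
    moreover have "(rdivide x z, rdivide z z) \<in> \<beta>'"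
      by (rule congr_mult[OF congr_derived[OF that(4) rdivide_derived]]) (use that(1) b(2)[OF xyz(3)] in auto)
    then have "(?w, s u y) \<in> \<beta>'" using b(5)[OF _ b(2)[OF xyz(2)]] xyz by (simp add: rdivide_self)
    ultimately show ?thesis using xyz by (simp add: rdivide_mult left_unit relcompI)
  qed
  note a = congrD[OF \<alpha>] and b = congrD[OF \<beta>]
  show "\<alpha> O \<beta> \<subseteq> A \<times> A" using a(1) b(1) by blast
  show "(x, x) \<in> \<alpha> O \<beta>" if "x \<in> A" for x using a(2) b(2) that by blast
  show "(y, x) \<in> \<alpha> O \<beta>" if "(x, y) \<in> \<alpha> O \<beta>" for x y
    using that swap[OF _ _ \<alpha> \<beta>] a(3) b(3) by blast
  show "(x, z) \<in> \<alpha> O \<beta>" if "(x, y) \<in> \<alpha> O \<beta>" "(y, z) \<in> \<alpha> O \<beta>" for x y z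
  proof -
    obtain v w where "(x, v) \<in> \<alpha>" "(v, y) \<in> \<beta>" "(y, w) \<in> \<alpha>" "(w, z) \<in> \<beta>" using \<open>(x, y) \<in> _\<close> \<open>(y, z) \<in> _\<close> by blast
    then show ?thesis using swap[OF _ _ \<alpha> \<beta>, of v y w] a(4) b(4) by blast
  qed
  show "(s x y, s x' y') \<in> \<alpha> O \<beta>" if "(x, x') \<in> \<alpha> O \<beta>" "(y, y') \<in> \<alpha> O \<beta>" for x x' y y'
    using that a(5) b(5) by blast
qed

end

lemma congr_Int: "congruence A {binop s} \<alpha> \<Longrightarrow> congruence A {binop s} \<beta> \<Longrightarrow> congruence A {binop s} (\<alpha> \<inter> \<beta>)"
  by (rule congrI) (auto dest: congrD(1) intro: congrD(2,3) congrD(4,5))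

section \<open>Central steps of prime order\<close>

text \<open>Modulo \<open>\<beta>\<close>, such a map is the translation by a central element.\<close>

definition central_map :: "'a set \<Rightarrow> ('a \<Rightarrow> 'a \<Rightarrow> 'a) \<Rightarrow> 'a rel \<Rightarrow> ('a \<Rightarrow> 'a) \<Rightarrow> bool" where
  "central_map A s \<beta> \<rho> \<longleftrightarrow> (\<forall>x\<in>A. \<rho> x \<in> A) \<and> (\<forall>x y. (x, y) \<in> \<beta> \<longrightarrow> (\<rho> x, \<rho> y) \<in> \<beta>) \<and>
     (\<forall>x\<in>A. \<forall>y\<in>A. (\<rho> (s x y), s (\<rho> x) y) \<in> \<beta> \<and> (\<rho> (s x y), s x (\<rho> y)) \<in> \<beta>)"

text \<open>This says that \<open>\<rho>\<close> is the translation by a generator of the kernel of \<open>A/\<beta> \<rightarrow> A/\<alpha>\<close>, a central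
  subloop of order \<open>p\<close>. Phrasing it through \<open>\<rho>\<close> avoids mentioning the generator, and makes the
  notion meaningful for other multiplications with the same congruences.\<close>

definition central_step ::
  "'a set \<Rightarrow> ('a \<Rightarrow> 'a \<Rightarrow> 'a) \<Rightarrow> 'a rel \<Rightarrow> 'a rel \<Rightarrow> nat \<Rightarrow> ('a \<Rightarrow> 'a) \<Rightarrow> bool" where
  "central_step A s \<alpha> \<beta> p \<rho> \<longleftrightarrow> \<beta> \<subseteq> \<alpha> \<and> prime p \<and> central_map A s \<beta> \<rho> \<and>
     (\<forall>x\<in>A. \<forall>i. ((\<rho> ^^ i) x, x) \<in> \<alpha>) \<and>
     (\<forall>x y. (x, y) \<in> \<alpha> \<longrightarrow> (\<exists>i. (x, (\<rho> ^^ i) y) \<in> \<beta>)) \<and>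
     (\<forall>x\<in>A. \<forall>i. ((\<rho> ^^ i) x, x) \<in> \<beta> \<longleftrightarrow> p dvd i)"

lemma central_mapD:
  assumes "central_map A s \<beta> \<rho>"
  shows "x \<in> A \<Longrightarrow> \<rho> x \<in> A" "(x, y) \<in> \<beta> \<Longrightarrow> (\<rho> x, \<rho> y) \<in> \<beta>"
    "x \<in> A \<Longrightarrow> y \<in> A \<Longrightarrow> (\<rho> (s x y), s (\<rho> x) y) \<in> \<beta>"
    "x \<in> A \<Longrightarrow> y \<in> A \<Longrightarrow> (\<rho> (s x y), s x (\<rho> y)) \<in> \<beta>"
  using assms unfolding central_map_def by simp_all

lemma (in finite_loop) central_map_iterate:
  assumes \<beta>: "congruence A {binop s} \<beta>" and \<rho>: "central_map A s \<beta> \<rho>"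
  shows "central_map A s \<beta> (\<rho> ^^ i)"
proof (induction i)
  case 0
  show ?case using congrD(2)[OF \<beta>] closed by (simp add: central_map_def)
next
  case (Suc i)
  note d = central_mapD[OF \<rho>] and e = central_mapD[OF Suc.IH]
  show ?case unfolding central_map_def funpow.simps comp_apply
  proof (intro conjI ballI allI impI)
    fix x y assume xy: "x \<in> A" "y \<in> A"
    show "(\<rho> ((\<rho> ^^ i) (s x y)), s (\<rho> ((\<rho> ^^ i) x)) y) \<in> \<beta>"
      using congrD(4)[OF \<beta> d(2)[OF e(3)[OF xy]] d(3)[OF e(1)[OF xy(1)] xy(2)]] .
    show "(\<rho> ((\<rho> ^^ i) (s x y)), s x (\<rho> ((\<rho> ^^ i) y))) \<in> \<beta>"
      using congrD(4)[OF \<beta> d(2)[OF e(4)[OF xy]] d(4)[OF xy(1) e(1)[OF xy(2)]]] .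
  qed (simp_all add: d(1,2) e(1,2))
qed

lemma central_stepD:
  assumes "central_step A s \<alpha> \<beta> p \<rho>"
  shows "\<beta> \<subseteq> \<alpha>" "prime p" "central_map A s \<beta> \<rho>" "x \<in> A \<Longrightarrow> ((\<rho> ^^ i) x, x) \<in> \<alpha>"
    "(x, y) \<in> \<alpha> \<Longrightarrow> \<exists>i. (x, (\<rho> ^^ i) y) \<in> \<beta>"
    "x \<in> A \<Longrightarrow> ((\<rho> ^^ i) x, x) \<in> \<beta> \<longleftrightarrow> p dvd i"
  using assms unfolding central_step_def by simp_all

context finite_loop
begin

text \<open>The term condition for \<open>[\<alpha>, A \<times> A]\<close> applied to a quotient of two products that agree as soon
  as \<open>c\<close> is replaced by the unit, or \<open>x\<close> and \<open>y\<close> are.\<close>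

lemma central_of_commutator:
  assumes \<alpha>: "congruence A {binop s} \<alpha>" and \<beta>: "congruence A {binop s} \<beta>"
    and comm: "commutator A {binop s} [\<alpha>, A \<times> A] \<subseteq> \<beta>"
    and c: "(u, c) \<in> \<alpha>" and x: "x \<in> A" and y: "y \<in> A"
  shows "(s (s x y) c, s (s x c) y) \<in> \<beta>" and "(s (s x y) c, s x (s y c)) \<in> \<beta>"
proof -
  let ?\<delta> = "commutator A {binop s} [\<alpha>, A \<times> A]"
  let ?R = "\<lambda>i :: nat. if i = 0 then \<alpha> else if i = 1 then A \<times> A else {}"
  have sub: "\<forall>\<alpha>'\<in>set [\<alpha>, A \<times> A]. \<alpha>' \<subseteq> A \<times> A" using congrD(1)[OF \<alpha>] by auto
  have alg: "algebra_on A {binop s}" by (simp add: algebra_on_binop closed)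
  have "term_cond A s ?R (length [\<alpha>, A \<times> A] - 1) ?\<delta>"
    by (rule centralizes_imp_term_cond[OF fin _ sub commutator_least(2)[OF alg sub]])
      (use congrD(1)[OF \<alpha>] in \<open>auto simp: less_Suc_eq\<close>)
  then have tc: "term_cond A s ?R 1 ?\<delta>" by simp
  have refl: "(z, z) \<in> ?\<delta>" if "z \<in> A" for z
    using congrD(2)[OF commutator_least(1)[OF alg sub] that] .
  have cA: "c \<in> A" using congrD(1)[OF \<alpha> c] by blast
  have edges: "(\<lambda>S. if 0 \<in> S then c else u) \<in> cubes A s ?R"
    "(\<lambda>S. if 1 \<in> S then x else u) \<in> cubes A s ?R"
    "(\<lambda>S. if 1 \<in> S then y else u) \<in> cubes A s ?R"
    using c x y unit_in by (auto intro!: cubes.edge)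
  define C X Y where "C = (\<lambda>S :: nat set. if 0 \<in> S then c else u)"
    and "X = (\<lambda>S :: nat set. if 1 \<in> S then x else u)" and "Y = (\<lambda>S :: nat set. if 1 \<in> S then y else u)"
  note e = edges[folded C_def X_def Y_def]
  have val: "C {} = u" "X {} = u" "Y {} = u" "C {0} = c" "X {0} = u" "Y {0} = u"
    "C {1} = u" "X {1} = x" "Y {1} = y" "C {1, 0} = c" "X {1, 0} = x" "Y {1, 0} = y"
    by (auto simp: C_def X_def Y_def)
  have sets: "{..<1::nat} = {0}" by auto
  have ps: "S = {}" if "S \<subset> {0::nat}" for S using that by auto
  have eq: "(F, G) \<in> \<beta>" if "F \<in> A" "G \<in> A" "(u, rdivide F G) \<in> ?\<delta>" for F G
  proof -
    have "(s u G, s (rdivide F G) G) \<in> \<beta>"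
      by (rule congrD(5)[OF \<beta>]) (use that comm congrD(2)[OF \<beta>] in auto)
    then show ?thesis using that congrD(3)[OF \<beta>] by (simp add: left_unit rdivide_mult)
  qed
  let ?F = "\<lambda>S. rdivide (s (s (X S) (Y S)) (C S)) (s (s (X S) (C S)) (Y S))"
  have "(?F {..<1}, ?F (insert 1 {..<1})) \<in> ?\<delta>"
  proof (rule term_condD[OF tc])
    show "?F \<in> cubes A s ?R"
      by (intro cubes_derived[OF rdivide_derived] cubes.mult e)
    fix S assume "S \<subset> {..<1::nat}"
    then have "S = {}" using sets ps by simp
    then show "(?F S, ?F (insert 1 S)) \<in> ?\<delta>"
      unfolding \<open>S = {}\<close> val using x y unit_in closed refl
      by (simp add: left_unit right_unit rdivide_self)
  qed
  then have "(u, rdivide (s (s x y) c) (s (s x c) y)) \<in> ?\<delta>"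
    unfolding sets val using x y cA unit_in closed by (simp add: left_unit right_unit rdivide_self)
  then show "(s (s x y) c, s (s x c) y) \<in> \<beta>"
    by (intro eq closed x y cA)
  let ?F = "\<lambda>S. rdivide (s (s (X S) (Y S)) (C S)) (s (X S) (s (Y S) (C S)))"
  have "(?F {..<1}, ?F (insert 1 {..<1})) \<in> ?\<delta>"
  proof (rule term_condD[OF tc])
    show "?F \<in> cubes A s ?R"
      by (intro cubes_derived[OF rdivide_derived] cubes.mult e)
    fix S assume "S \<subset> {..<1::nat}"
    then have "S = {}" using sets ps by simp
    then show "(?F S, ?F (insert 1 S)) \<in> ?\<delta>"
      unfolding \<open>S = {}\<close> val using x y unit_in closed refl
      by (simp add: left_unit right_unit rdivide_self)
  qed
  then have "(u, rdivide (s (s x y) c) (s x (s y c))) \<in> ?\<delta>"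
    unfolding sets val using x y cA unit_in closed by (simp add: left_unit right_unit rdivide_self)
  then show "(s (s x y) c, s x (s y c)) \<in> \<beta>"
    by (intro eq closed x y cA)
qed

text \<open>Take \<open>\<eta>\<close> maximal among the congruences between \<open>\<eta>0\<close> and \<open>\<theta>\<close> other than \<open>\<theta>\<close>. If \<open>\<alpha>\<^sub>i\<close> is the
  last member of the central series whose join with \<open>\<eta>\<close> contains \<open>\<theta>\<close>, then an element of the
  kernel outside \<open>\<eta>\<close> can be chosen in the \<open>\<alpha>\<^sub>i\<close>-class of the unit, so that its translation is
  central modulo \<open>\<eta>\<close>. By maximality it generates the kernel, and so does each of its nontrivial
  powers; hence the kernel is cyclic of prime order.\<close>

lemma exists_central_step:
  assumes nil: "nilpotent A {binop s}"
    and \<eta>0: "congruence A {binop s} \<eta>0" and \<theta>: "congruence A {binop s} \<theta>" and lt: "\<eta>0 \<subset> \<theta>"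
  shows "\<exists>\<eta> p \<rho>. congruence A {binop s} \<eta> \<and> \<eta>0 \<subseteq> \<eta> \<and> \<eta> \<subset> \<theta> \<and> central_step A s \<theta> \<eta> p \<rho>"
proof -
  let ?C = "{\<eta>. congruence A {binop s} \<eta> \<and> \<eta>0 \<subseteq> \<eta> \<and> \<eta> \<subset> \<theta>}"
  have "\<theta> \<subseteq> A \<times> A" using congrD(1)[OF \<theta>] by auto
  then have "?C \<subseteq> Pow (A \<times> A)" by auto
  then have "finite ?C" by (rule finite_subset) (simp add: fin)
  moreover have "?C \<noteq> {}" using \<eta>0 lt by blast
  ultimately obtain \<eta> where \<eta>C: "\<eta> \<in> ?C" and max': "\<forall>\<zeta>\<in>?C. \<eta> \<subseteq> \<zeta> \<longrightarrow> \<eta> = \<zeta>"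
    using finite_has_maximal[of ?C] by (auto simp only: Bex_def)
  have max: "\<eta> = \<zeta>" if "\<zeta> \<in> ?C" "\<eta> \<subseteq> \<zeta>" for \<zeta>
    using max' that by (simp only: Ball_def)
  have \<eta>: "congruence A {binop s} \<eta>" and sub: "\<eta> \<subset> \<theta>" "\<eta>0 \<subseteq> \<eta>" using \<eta>C by auto
  have dich: "\<zeta> = \<eta> \<or> \<zeta> = \<theta>" if "congruence A {binop s} \<zeta>" "\<eta> \<subseteq> \<zeta>" "\<zeta> \<subseteq> \<theta>" for \<zeta>
    using max[of \<zeta>] that sub by auto
  note h = congrD[OF \<eta>] and t = congrD[OF \<theta>]
  obtain k \<alpha> where chain: "(\<forall>i\<le>k. congruence A {binop s} (\<alpha> i)) \<and> \<alpha> 0 = A \<times> A \<and> \<alpha> k = Id_on A \<and>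
    (\<forall>i<k. \<alpha> (Suc i) \<subseteq> \<alpha> i \<and> commutator A {binop s} [\<alpha> i, A \<times> A] \<subseteq> \<alpha> (Suc i))"
    using nil unfolding nilpotent_def by (elim exE conjE) (rule that, intro conjI; assumption)
  have \<alpha>: "\<And>i. i \<le> k \<Longrightarrow> congruence A {binop s} (\<alpha> i)" "\<alpha> 0 = A \<times> A" "\<alpha> k = Id_on A"
    "\<And>i. i < k \<Longrightarrow> commutator A {binop s} [\<alpha> i, A \<times> A] \<subseteq> \<alpha> (Suc i)"
    using chain by simp_all
  have "\<exists>i<k. \<theta> \<subseteq> \<eta> O \<alpha> i \<and> \<not> \<theta> \<subseteq> \<eta> O \<alpha> (Suc i)"
  proof (rule ccontr)
    assume "\<not> ?thesis"
    then have "i \<le> k \<Longrightarrow> \<theta> \<subseteq> \<eta> O \<alpha> i" for i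
    proof (induction i)
      case 0
      show ?case unfolding \<alpha>(2)
        by (rule subrelI, rule relcompI[OF h(2)]) (use t(1) in blast)+
    qed auto
    then have "\<theta> \<subseteq> \<eta> O Id_on A" using \<alpha>(3) by (metis order_refl)
    then show False using sub h(1) by auto
  qed
  then obtain i where i: "i < k" "\<theta> \<subseteq> \<eta> O \<alpha> i" "\<not> \<theta> \<subseteq> \<eta> O \<alpha> (Suc i)" by blast
  have ai: "congruence A {binop s} (\<alpha> i)" "congruence A {binop s} (\<alpha> (Suc i))"
    using \<alpha>(1) i(1) by auto
  have "\<eta> \<subseteq> \<theta> \<inter> (\<eta> O \<alpha> (Suc i))"
    by (rule subrelI) (use sub(1) h(1) congrD(2)[OF ai(2)] in blast)
  then have meet: "\<theta> \<inter> (\<eta> O \<alpha> (Suc i)) = \<eta>"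
    using dich[OF congr_Int[OF \<theta> congr_comp[OF \<eta> ai(2)]]] i(3) by blast
  \<comment> \<open>Laws that hold modulo the next member of the series hold modulo \<open>\<eta>\<close>.\<close>
  have to_\<eta>: "(x, y) \<in> \<eta>" if "(x, y) \<in> \<alpha> (Suc i)" "(x, y) \<in> \<theta>" for x y
    using that meet h(2) t(1) by blast

  obtain a b where ab: "(a, b) \<in> \<theta>" "(a, b) \<notin> \<eta>" using sub by auto
  have abA: "a \<in> A" "b \<in> A" using t(1) ab by auto
  let ?c' = "ldiv b a"
  have c'A: "?c' \<in> A" using abA ldiv_in by simp
  have "(?c', u) \<in> \<theta>"
    by (rule congr_left_cancel[OF \<theta>, of b]) (use ab abA c'A unit_in in \<open>simp_all add: mult_ldiv right_unit\<close>)
  \<comment> \<open>Replace \<open>b \ a\<close> by an element of the same \<open>\<eta>\<close>-class that lies in the central member of the series.\<close>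
  then obtain c where c: "(?c', c) \<in> \<eta>" "(c, u) \<in> \<alpha> i" using i(2) by blast
  have cA: "c \<in> A" using h(1) c by blast
  have c\<theta>: "(c, u) \<in> \<theta>" using \<open>(?c', u) \<in> \<theta>\<close> c(1) sub(1) t(3,4) by blast
  have c\<eta>: "(c, u) \<notin> \<eta>"
  proof
    assume "(c, u) \<in> \<eta>"
    then have "(s b ?c', s b u) \<in> \<eta>" using c(1) h(2,4,5) abA by blast
    then show False using ab abA by (simp add: mult_ldiv right_unit)
  qed
  define \<rho> where "\<rho> x = s x c" for x
  have \<rho>A: "\<rho> x \<in> A" if "x \<in> A" for x using that cA closed by (simp add: \<rho>_def)
  have \<rho>\<theta>: "(\<rho> x, x) \<in> \<theta>" if "x \<in> A" for x
    using t(5)[OF t(2)[OF that] c\<theta>] that by (simp add: \<rho>_def right_unit)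
  have uc: "(u, c) \<in> \<alpha> i" using congrD(3)[OF ai(1) c(2)] .
  note central = central_of_commutator[OF ai \<alpha>(4)[OF i(1)] uc]
  have cm: "central_map A s \<eta> \<rho>"
    unfolding central_map_def
  proof (intro conjI ballI allI impI)
    fix x y assume xy: "x \<in> A" "y \<in> A"
    have 1: "(\<rho> (s x y), s x y) \<in> \<theta>" "(s (\<rho> x) y, s x y) \<in> \<theta>" "(s x (\<rho> y), s x y) \<in> \<theta>"
      using \<rho>\<theta> closed xy t(2,5) by auto
    show "(\<rho> (s x y), s (\<rho> x) y) \<in> \<eta>"
      by (rule to_\<eta>[OF central(1)[OF xy, folded \<rho>_def] t(4)[OF 1(1) t(3)[OF 1(2)]]])
    show "(\<rho> (s x y), s x (\<rho> y)) \<in> \<eta>"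
      by (rule to_\<eta>[OF central(2)[OF xy, folded \<rho>_def] t(4)[OF 1(1) t(3)[OF 1(3)]]])
  next
    fix x y assume "(x, y) \<in> \<eta>"
    then show "(\<rho> x, \<rho> y) \<in> \<eta>" unfolding \<rho>_def by (rule h(5)[OF _ h(2)[OF cA]])
  qed (rule \<rho>A)
  note cmi = central_mapD[OF central_map_iterate[OF \<eta> cm]]
  have per: "(\<rho> ^^ (fact (card A) * n)) x = x" if "x \<in> A" for n x
  proof (induction n)
    case (Suc n)
    have "(\<rho> ^^ fact (card A)) x = x" using right_iterate_period[OF cA that] by (simp add: \<rho>_def[abs_def])
    then show ?case using Suc by (simp add: funpow_add add.commute)
  qed simp
  have it\<theta>: "((\<rho> ^^ j) x, x) \<in> \<theta>" if "x \<in> A" for j x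
    by (induction j) (use that t(2) in simp, use cmi(1)[OF that] \<rho>\<theta> t(4) in \<open>simp, blast\<close>)
  \<comment> \<open>The congruence that belongs to the subgroup generated by the \<open>d\<close>-th power of \<open>c\<close>.\<close>
  define R where "R d = {(x, y). x \<in> A \<and> y \<in> A \<and> (\<exists>j. (x, (\<rho> ^^ (d * j)) y) \<in> \<eta>)}" for d
  have Rc: "congruence A {binop s} (R d)" for d
  proof (rule congrI)
    show "(x, x) \<in> R d" if "x \<in> A" for x
      unfolding R_def using that h(2) by (auto intro: exI[of _ 0])
    show "(y, x) \<in> R d" if xy: "(x, y) \<in> R d" for x y
    proof -
      obtain j where j: "x \<in> A" "y \<in> A" "(x, (\<rho> ^^ (d * j)) y) \<in> \<eta>" using xy R_def by auto
      obtain M where M: "(fact (card A) :: nat) = Suc M" using fact_Suc_pred by blast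
      let ?l = "j * M"
      have "d * ?l + d * j = fact (card A) * (d * j)"
        by (simp add: M algebra_simps)
      then have "(\<rho> ^^ (d * ?l)) ((\<rho> ^^ (d * j)) y) = y"
        using per[OF j(2), of "d * j"] by (simp only: funpow_funpow)
      then have "((\<rho> ^^ (d * ?l)) x, y) \<in> \<eta>" using cmi(2)[OF j(3), of "d * ?l"] by simp
      then show ?thesis using j h(3) unfolding R_def by blast
    qed
    show "(x, z) \<in> R d" if xyz: "(x, y) \<in> R d" "(y, z) \<in> R d" for x y z
    proof -
      obtain i j where ij: "x \<in> A" "z \<in> A" "(x, (\<rho> ^^ (d * i)) y) \<in> \<eta>" "(y, (\<rho> ^^ (d * j)) z) \<in> \<eta>"
        using xyz R_def by auto
      have "((\<rho> ^^ (d * i)) y, (\<rho> ^^ (d * (i + j))) z) \<in> \<eta>"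
        using cmi(2)[OF ij(4), of "d * i"] by (simp add: funpow_funpow distrib_left)
      then show ?thesis using ij h(4) unfolding R_def by blast
    qed
    show "(s x y, s x' y') \<in> R d" if xy: "(x, x') \<in> R d" "(y, y') \<in> R d" for x x' y y'
    proof -
      obtain i j where ij: "x \<in> A" "x' \<in> A" "y \<in> A" "y' \<in> A"
        "(x, (\<rho> ^^ (d * i)) x') \<in> \<eta>" "(y, (\<rho> ^^ (d * j)) y') \<in> \<eta>"
        using xy R_def by auto
      let ?i = "d * i" and ?j = "d * j"
      have 1: "(s x y, s ((\<rho> ^^ ?i) x') ((\<rho> ^^ ?j) y')) \<in> \<eta>" using h(5) ij by blast
      have 2: "((\<rho> ^^ ?i) (s x' ((\<rho> ^^ ?j) y')), s ((\<rho> ^^ ?i) x') ((\<rho> ^^ ?j) y')) \<in> \<eta>"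
        using cmi(3) cmi(1) ij by blast
      have 3: "((\<rho> ^^ ?i) ((\<rho> ^^ ?j) (s x' y')), (\<rho> ^^ ?i) (s x' ((\<rho> ^^ ?j) y'))) \<in> \<eta>"
        using cmi(2) cmi(4) ij by blast
      have "(s x y, (\<rho> ^^ (d * (i + j))) (s x' y')) \<in> \<eta>"
        using 1 2 3 h(3,4) unfolding distrib_left funpow_add comp_apply by blast
      then show ?thesis using ij closed unfolding R_def by blast
    qed
  qed (auto simp: R_def)
  have R\<theta>: "R d = \<theta>" if "((\<rho> ^^ d) u, u) \<notin> \<eta>" for d
  proof -
    have "\<eta> \<subseteq> R d" unfolding R_def using h(1) by (auto intro: exI[of _ 0])
    moreover have "R d \<subseteq> \<theta>"
    proof
      fix z assume "z \<in> R d"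
      then obtain x y j where "z = (x, y)" "x \<in> A" "y \<in> A" "(x, (\<rho> ^^ (d * j)) y) \<in> \<eta>"
        unfolding R_def by auto
      then show "z \<in> \<theta>" using it\<theta>[of y "d * j"] sub(1) t(4) by blast
    qed
    moreover have "((\<rho> ^^ d) u, u) \<in> R d"
      unfolding R_def using cmi(1) unit_in h(2) by (auto intro: exI[of _ 1])
    ultimately show ?thesis using dich[OF Rc, of d] that by blast
  qed
  have R1: "R 1 = \<theta>" using R\<theta>[of 1] c\<eta> cA by (simp add: \<rho>_def left_unit)

  define p where "p = (LEAST j. 0 < j \<and> ((\<rho> ^^ j) u, u) \<in> \<eta>)"
  have "0 < (fact (card A) :: nat) \<and> ((\<rho> ^^ fact (card A)) u, u) \<in> \<eta>"
    using per[OF unit_in, of 1] h(2)[OF unit_in] by simp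
  then have p: "0 < p" "((\<rho> ^^ p) u, u) \<in> \<eta>" and least: "\<And>j. 0 < j \<Longrightarrow> j < p \<Longrightarrow> ((\<rho> ^^ j) u, u) \<notin> \<eta>"
    unfolding p_def by (metis (mono_tags, lifting) LeastI not_less_Least)+
  have pmult: "((\<rho> ^^ (p * q)) u, u) \<in> \<eta>" for q
  proof (induction q)
    case (Suc q)
    have "((\<rho> ^^ p) ((\<rho> ^^ (p * q)) u), (\<rho> ^^ p) u) \<in> \<eta>" using cmi(2)[OF Suc] .
    then have "((\<rho> ^^ (p * Suc q)) u, (\<rho> ^^ p) u) \<in> \<eta>" by (simp only: funpow_funpow mult_Suc_right)
    then show ?case using p(2) by (rule h(4))
  qed (use h(2) unit_in in simp)
  have dvd_u: "((\<rho> ^^ j) u, u) \<in> \<eta> \<longleftrightarrow> p dvd j" for j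
  proof
    assume j: "((\<rho> ^^ j) u, u) \<in> \<eta>"
    have "(\<rho> ^^ (j mod p)) ((\<rho> ^^ (p * (j div p))) u) = (\<rho> ^^ j) u"
      by (simp only: funpow_funpow mod_mult_div_eq)
    then have "((\<rho> ^^ j) u, (\<rho> ^^ (j mod p)) u) \<in> \<eta>"
      using cmi(2)[OF pmult[of "j div p"], of "j mod p"] by simp
    then have "((\<rho> ^^ (j mod p)) u, u) \<in> \<eta>" using j h(3,4) by blast
    then show "p dvd j" using least[of "j mod p"] p(1) by (auto simp: dvd_eq_mod_eq_0)
  qed (auto intro: pmult)
  have dvd_x: "((\<rho> ^^ j) x, x) \<in> \<eta> \<longleftrightarrow> p dvd j" if "x \<in> A" for j x
  proof -
    have 1: "((\<rho> ^^ j) x, s x ((\<rho> ^^ j) u)) \<in> \<eta>"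
      using cmi(4)[OF that unit_in, of j] that by (simp add: right_unit)
    have "((\<rho> ^^ j) x, x) \<in> \<eta> \<longleftrightarrow> (s x ((\<rho> ^^ j) u), s x u) \<in> \<eta>"
      using 1 h(3,4) right_unit[OF that] by metis
    also have "\<dots> \<longleftrightarrow> ((\<rho> ^^ j) u, u) \<in> \<eta>"
      using congr_left_cancel[OF \<eta>, of x] that cmi(1) unit_in h(2,5) by blast
    finally show ?thesis using dvd_u by simp
  qed
  have "prime p"
  proof -
    have "p \<noteq> 1" using p(2) c\<eta> cA by (auto simp: \<rho>_def left_unit)
    moreover have "d = 1 \<or> d = p" if "d dvd p" for d
    proof (rule ccontr)
      assume d: "\<not> (d = 1 \<or> d = p)"
      then have "0 < d" "d < p" using that p(1) by (auto intro: dvd_pos_nat dest: dvd_imp_le)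
      then have "R d = \<theta>" using least R\<theta> by blast
      then have "(u, c) \<in> R d" using t(3)[OF c\<theta>] by simp
      then obtain j where "(u, (\<rho> ^^ (d * j)) (\<rho> u)) \<in> \<eta>"
        unfolding R_def using cA by (auto simp: \<rho>_def left_unit)
      then have "((\<rho> ^^ (d * j + 1)) u, u) \<in> \<eta>"
        using h(3) by (simp add: funpow_swap1)
      then have "p dvd d * j + 1" using dvd_u by blast
      then have "d dvd d * j + 1" using that dvd_trans by blast
      then have "d dvd 1" by (metis dvd_add_right_iff dvd_triv_left)
      then show False using d by simp
    qed
    ultimately show ?thesis using p(1) by (auto simp: prime_nat_iff)
  qed
  moreover have "\<exists>j. (x, (\<rho> ^^ j) y) \<in> \<eta>" if "(x, y) \<in> \<theta>" for x y
    using that R1 unfolding R_def by auto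
  ultimately have "central_step A s \<theta> \<eta> p \<rho>"
    unfolding central_step_def using sub cm it\<theta> dvd_x by auto
  then show ?thesis using \<eta> sub by blast
qed

end

section \<open>Power maps in supernilpotent quotients\<close>

context finite_loop
begin

text \<open>The right power with \<open>N + 1\<close> factors. Starting from \<open>x\<close> instead of the unit keeps it a term
  function; by \<open>right_power_eq\<close> it is the \<open>(N + 1)\<close>-fold translation of the unit.\<close>

definition right_power :: "nat \<Rightarrow> 'a \<Rightarrow> 'a" where "right_power N x = ((\<lambda>z. s z x) ^^ N) x"

lemma right_power_eq: "x \<in> A \<Longrightarrow> right_power N x = ((\<lambda>z. s z x) ^^ Suc N) u"
  by (simp add: right_power_def funpow_swap1[of "\<lambda>z. s z x"] left_unit)

lemma right_power_in: "x \<in> A \<Longrightarrow> right_power N x \<in> A"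
  by (simp add: right_power_def right_iterate_in)

lemma right_power_unit: "right_power N u = u"
  unfolding right_power_def by (induction N) (simp_all add: right_unit unit_in)

lemma right_power_derived: "f \<in> derived s \<Longrightarrow> (\<lambda>x y. right_power N (f x y)) \<in> derived s"
  unfolding right_power_def by (rule derived_iterate_right)

lemma right_iterate_cong:
  assumes "congruence A {binop s} \<theta>" "(x, x') \<in> \<theta>" "(z, z') \<in> \<theta>"
  shows "(((\<lambda>z. s z x) ^^ i) z, ((\<lambda>z. s z x') ^^ i) z') \<in> \<theta>"
  by (induction i) (use assms congrD(5)[OF assms(1)] in auto)

lemma right_power_cong:
  "congruence A {binop s} \<theta> \<Longrightarrow> (x, y) \<in> \<theta> \<Longrightarrow> (right_power N x, right_power N y) \<in> \<theta>"
  unfolding right_power_def by (rule right_iterate_cong)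

lemma right_iterate_unit_arg: "z \<in> A \<Longrightarrow> ((\<lambda>z. s z u) ^^ i) z = z"
  by (induction i) (auto simp: right_unit)

lemma right_iterate_period_dvd:
  assumes "x \<in> A" "z \<in> A" "fact (card A) dvd i"
  shows "((\<lambda>z. s z x) ^^ i) z = z"
proof -
  obtain q where i: "i = fact (card A) * q" using assms(3) by auto
  have "((\<lambda>z. s z x) ^^ (fact (card A) * q)) z = z"
  proof (induction q)
    case (Suc q)
    have "((\<lambda>z. s z x) ^^ (fact (card A) * Suc q)) z =
      ((\<lambda>z. s z x) ^^ fact (card A)) (((\<lambda>z. s z x) ^^ (fact (card A) * q)) z)"
      by (simp only: funpow_funpow mult_Suc_right)
    then show ?case by (simp add: Suc right_iterate_period assms(1,2))
  qed simp
  then show ?thesis by (simp add: i)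
qed

text \<open>Each of the \<open>N + 1\<close> occurrences of the argument contributes one central factor.\<close>

lemma right_power_central:
  assumes \<beta>: "congruence A {binop s} \<beta>" and \<sigma>: "central_map A s \<beta> \<sigma>" and x: "x \<in> A"
  shows "(right_power N (\<sigma> x), (\<sigma> ^^ Suc N) (right_power N x)) \<in> \<beta>"
proof (induction N)
  case 0
  show ?case using congrD(2)[OF \<beta>] central_mapD(1)[OF \<sigma>] x by (simp add: right_power_def)
next
  case (Suc N)
  note d = central_mapD[OF \<sigma>] and e = central_mapD[OF central_map_iterate[OF \<beta> \<sigma>]]
  let ?w = "right_power N x"
  have w: "?w \<in> A" using right_power_in x by simp
  have "(s (right_power N (\<sigma> x)) (\<sigma> x), s ((\<sigma> ^^ Suc N) ?w) (\<sigma> x)) \<in> \<beta>"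
    by (rule congrD(5)[OF \<beta> Suc.IH congrD(2)[OF \<beta> d(1)[OF x]]])
  moreover have "(\<sigma> (s ((\<sigma> ^^ Suc N) ?w) x), s ((\<sigma> ^^ Suc N) ?w) (\<sigma> x)) \<in> \<beta>"
    by (rule d(4)[OF e(1)[OF w] x])
  moreover have "(\<sigma> ((\<sigma> ^^ Suc N) (s ?w x)), \<sigma> (s ((\<sigma> ^^ Suc N) ?w) x)) \<in> \<beta>"
    by (rule d(2)[OF e(3)[OF w x]])
  ultimately have "(s (right_power N (\<sigma> x)) (\<sigma> x), \<sigma> ((\<sigma> ^^ Suc N) (s ?w x))) \<in> \<beta>"
    using congrD(3,4)[OF \<beta>] by meson
  then show ?case by (simp add: right_power_def)
qed

text \<open>The multiplicative analogue of Newton interpolation: \<open>newton \<gamma> j i\<close> is the product of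
  \<open>i choose l\<close> copies of constants \<open>\<kappa>\<^sub>l\<close> for \<open>1 \<le> l \<le> j\<close>, where \<open>\<kappa>\<^sub>l\<close> is the \<open>l\<close>-th
  "difference", chosen such that the interpolant agrees with \<open>\<gamma>\<close> up to index \<open>j\<close>, provided that
  \<open>\<gamma> 0\<close> is the unit.\<close>

primrec newton :: "(nat \<Rightarrow> 'a) \<Rightarrow> nat \<Rightarrow> nat \<Rightarrow> 'a" where
  "newton \<gamma> 0 = (\<lambda>i. u)"
| "newton \<gamma> (Suc j) = (\<lambda>i.
    ((\<lambda>z. s z (ldiv (newton \<gamma> j (Suc j)) (\<gamma> (Suc j)))) ^^ (i choose Suc j)) (newton \<gamma> j i))"

lemma newton_in:
  assumes "\<And>i. i \<le> n \<Longrightarrow> \<gamma> i \<in> A" "j \<le> n"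
  shows "newton \<gamma> j i \<in> A"
  using assms(2) by (induction j arbitrary: i) (simp_all add: unit_in right_iterate_in ldiv_in assms(1))

lemma newton_eq:
  assumes "\<And>i. i \<le> n \<Longrightarrow> \<gamma> i \<in> A" "\<gamma> 0 = u" "j \<le> n" "i \<le> j"
  shows "newton \<gamma> j i = \<gamma> i"
  using assms(3,4)
proof (induction j)
  case (Suc j)
  show ?case
  proof (cases "i = Suc j")
    case True
    then show ?thesis using Suc assms(1) newton_in[of n \<gamma> j] by (simp add: mult_ldiv)
  next
    case False
    then show ?thesis using Suc by (simp add: binomial_eq_0)
  qed
qed (simp add: assms(2))

text \<open>Multiplying the factors \<open>if T \<subseteq> S then c else u\<close> for all \<open>T\<close> of a family onto \<open>F S\<close> multiplies
  by \<open>c\<close> once for each member contained in \<open>S\<close>. The order of the factors is irrelevant since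
  they all are \<open>c\<close> or the unit.\<close>

lemma cubes_right_iterate_count:
  assumes F: "F \<in> cubes A s R" and "finite \<T>"
    and ind: "\<And>T. T \<in> \<T> \<Longrightarrow> (\<lambda>S. if T \<subseteq> S then c else u) \<in> cubes A s R"
    and R: "\<And>i. R i \<subseteq> A \<times> A" and c: "c \<in> A"
  shows "(\<lambda>S. ((\<lambda>z. s z c) ^^ card {T \<in> \<T>. T \<subseteq> S}) (F S)) \<in> cubes A s R"
  using \<open>finite \<T>\<close> ind
proof (induction \<T>)
  case empty
  then show ?case using F by simp
next
  case (insert T \<T>)
  let ?G = "\<lambda>\<T> S. ((\<lambda>z. s z c) ^^ card {T \<in> \<T>. T \<subseteq> S}) (F S)"
  have "F S \<in> A" for S by (rule cubes_in[OF F closed R])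
  then have GA: "?G \<T> S \<in> A" for S using c by (simp add: right_iterate_in)
  have "s (?G \<T> S) (if T \<subseteq> S then c else u) = ?G (insert T \<T>) S" for S
  proof (cases "T \<subseteq> S")
    case True
    then have "{T' \<in> insert T \<T>. T' \<subseteq> S} = insert T {T' \<in> \<T>. T' \<subseteq> S}" by auto
    then show ?thesis using True insert.hyps by simp
  next
    case False
    then have "{T' \<in> insert T \<T>. T' \<subseteq> S} = {T' \<in> \<T>. T' \<subseteq> S}" by auto
    then show ?thesis using False GA by (simp add: right_unit)
  qed
  then show ?case using cubes.mult[OF insert.IH insert.prems[of T]] insert.prems by simp
qed

text \<open>The interpolant of a symmetric cube \<open>g\<close> is a cube, and so is the function with value \<open>\<kappa>\<^sub>j\<^sub>+\<^sub>1\<close>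
  above a \<open>(j + 1)\<close>-set \<open>T\<close> and the unit elsewhere: it is the left quotient of \<open>g\<close> by the
  previous interpolant, both restricted to the face below \<open>T\<close>, where they differ at the top
  corner only. Multiplying these functions over all \<open>T\<close> yields the next interpolant, as \<open>S\<close> has
  \<open>card S choose (j + 1)\<close> subsets of that size.\<close>

lemma newton_cubes:
  assumes g: "g \<in> cubes A s (\<lambda>_. A \<times> A)" and g\<gamma>: "\<And>S. S \<subseteq> {..<n} \<Longrightarrow> g S = \<gamma> (card S)"
    and \<gamma>0: "\<gamma> 0 = u"
  shows "j \<le> n \<Longrightarrow> (\<lambda>S. newton \<gamma> j (card (S \<inter> {..<n}))) \<in> cubes A s (\<lambda>_. A \<times> A)"
    and "Suc j \<le> n \<Longrightarrow> T \<subseteq> {..<n} \<Longrightarrow> card T = Suc j \<Longrightarrow>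
      (\<lambda>S. if T \<subseteq> S then ldiv (newton \<gamma> j (Suc j)) (\<gamma> (Suc j)) else u) \<in> cubes A s (\<lambda>_. A \<times> A)"
proof -
  let ?\<kappa> = "\<lambda>j. ldiv (newton \<gamma> j (Suc j)) (\<gamma> (Suc j))"
  have \<gamma>A: "\<gamma> i \<in> A" if "i \<le> n" for i
  proof -
    have "{..<i} \<subseteq> {..<n}" using that by auto
    then have "\<gamma> i = g {..<i}" using g\<gamma>[of "{..<i}"] by simp
    then show ?thesis using cubes_in[OF g closed] by simp
  qed
  note nA = newton_in[of n \<gamma>, OF \<gamma>A] and nE = newton_eq[of n \<gamma>, OF \<gamma>A \<gamma>0]
  have ind: "(\<lambda>S. if T \<subseteq> S then ?\<kappa> j else u) \<in> cubes A s (\<lambda>_. A \<times> A)"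
    if F: "(\<lambda>S. newton \<gamma> j (card (S \<inter> {..<n}))) \<in> cubes A s (\<lambda>_. A \<times> A)"
      and j: "Suc j \<le> n" and T: "T \<subseteq> {..<n}" "card T = Suc j" for j T
  proof -
    have finT: "finite T" using T finite_subset by blast
    have "(\<lambda>S. ldiv (newton \<gamma> j (card (S \<inter> T \<inter> {..<n}))) (g (S \<inter> T))) \<in> cubes A s (\<lambda>_. A \<times> A)"
    proof (intro cubes_derived[OF ldiv_derived])
      have re: "(\<exists>b. \<forall>S. i \<in> S \<inter> T \<longleftrightarrow> b) \<or> (\<exists>j. \<forall>S. i \<in> S \<inter> T \<longleftrightarrow> j \<in> S)" for i
        by (cases "i \<in> T") auto
      show "(\<lambda>S. newton \<gamma> j (card (S \<inter> T \<inter> {..<n}))) \<in> cubes A s (\<lambda>_. A \<times> A)"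
        using cubes_reindex[OF F re] by simp
      show "(\<lambda>S. g (S \<inter> T)) \<in> cubes A s (\<lambda>_. A \<times> A)" using cubes_reindex[OF g re] by simp
    qed
    moreover have "ldiv (newton \<gamma> j (card (S \<inter> T \<inter> {..<n}))) (g (S \<inter> T)) = (if T \<subseteq> S then ?\<kappa> j else u)" for S
    proof (cases "T \<subseteq> S")
      case True
      then have "S \<inter> T = T" "S \<inter> T \<inter> {..<n} = T" using T by auto
      then show ?thesis using True g\<gamma>[OF T(1)] T(2) by simp
    next
      case False
      have e: "S \<inter> T \<inter> {..<n} = S \<inter> T" using T by auto
      have "card (S \<inter> T) < card T" by (rule psubset_card_mono[OF finT]) (use False in auto)
      then have c: "card (S \<inter> T) \<le> j" using T by simp
      have "newton \<gamma> j (card (S \<inter> T)) = g (S \<inter> T)"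
        using nE[OF _ _ c] j g\<gamma>[of "S \<inter> T"] T(1) by (simp add: le_infI2)
      moreover have "g (S \<inter> T) \<in> A" by (rule cubes_in[OF g closed]) auto
      ultimately show ?thesis using False e by (simp add: ldiv_self)
    qed
    ultimately show ?thesis by simp
  qed
  have main: "j \<le> n \<Longrightarrow> (\<lambda>S. newton \<gamma> j (card (S \<inter> {..<n}))) \<in> cubes A s (\<lambda>_. A \<times> A)" for j
  proof (induction j)
    case 0
    then show ?case by (simp add: cubes.const unit_in)
  next
    case (Suc j)
    let ?\<T> = "{T. T \<subseteq> {..<n} \<and> card T = Suc j}"
    have "finite ?\<T>" by (rule finite_subset[of _ "Pow {..<n}"]) auto
    have \<kappa>A: "?\<kappa> j \<in> A" using nA[of j] \<gamma>A Suc.prems by (simp add: ldiv_in)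
    have F: "(\<lambda>S. newton \<gamma> j (card (S \<inter> {..<n}))) \<in> cubes A s (\<lambda>_. A \<times> A)" using Suc by simp
    have c: "card {T \<in> ?\<T>. T \<subseteq> S} = card (S \<inter> {..<n}) choose Suc j" for S
    proof -
      have "{T \<in> ?\<T>. T \<subseteq> S} = {T. T \<subseteq> S \<inter> {..<n} \<and> card T = Suc j}" by auto
      then show ?thesis using n_subsets[of "S \<inter> {..<n}" "Suc j"] by (simp only: finite_Int finite_lessThan simp_thms)
    qed
    have "(\<lambda>S. ((\<lambda>z. s z (?\<kappa> j)) ^^ card {T \<in> ?\<T>. T \<subseteq> S}) (newton \<gamma> j (card (S \<inter> {..<n}))))
        \<in> cubes A s (\<lambda>_. A \<times> A)"
    proof (rule cubes_right_iterate_count[OF F \<open>finite ?\<T>\<close> _ subset_refl \<kappa>A])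
      fix T assume "T \<in> ?\<T>"
      then show "(\<lambda>S. if T \<subseteq> S then ?\<kappa> j else u) \<in> cubes A s (\<lambda>_. A \<times> A)"
        using ind[OF F Suc.prems] by blast
    qed
    then show ?case by (simp only: c newton.simps(2))
  qed
  show "j \<le> n \<Longrightarrow> (\<lambda>S. newton \<gamma> j (card (S \<inter> {..<n}))) \<in> cubes A s (\<lambda>_. A \<times> A)" by (rule main)
  show "Suc j \<le> n \<Longrightarrow> T \<subseteq> {..<n} \<Longrightarrow> card T = Suc j \<Longrightarrow>
      (\<lambda>S. if T \<subseteq> S then ?\<kappa> j else u) \<in> cubes A s (\<lambda>_. A \<times> A)"
    by (rule ind[OF main]) simp_all
qed

text \<open>For \<open>j\<close> beyond the class \<open>k\<close>, the cube that is \<open>\<kappa>\<^sub>j\<close> at its top corner and the unit elsewhere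
  forces \<open>\<kappa>\<^sub>j\<close> to be trivial modulo \<open>\<theta>\<close>. For \<open>2 \<le> j \<le> k\<close> the factor \<open>\<kappa>\<^sub>j\<close> occurs a multiple of
  \<open>fact (card A)\<close> times, which is the identity. So only the \<open>n\<close> factors \<open>\<kappa>\<^sub>1 = \<gamma> 1\<close> remain.\<close>

lemma supernilpotent_sequence:
  assumes \<theta>: "congruence A {binop s} \<theta>" and tc: "term_cond A s (\<lambda>_. A \<times> A) k \<theta>"
    and n: "1 \<le> n" "\<And>j. 2 \<le> j \<Longrightarrow> j \<le> k \<Longrightarrow> fact (card A) dvd (n choose j)"
    and g: "g \<in> cubes A s (\<lambda>_. A \<times> A)" and g\<gamma>: "\<And>S. S \<subseteq> {..<n} \<Longrightarrow> g S = \<gamma> (card S)"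
    and \<gamma>0: "\<gamma> 0 = u"
  shows "(\<gamma> n, ((\<lambda>z. s z (\<gamma> 1)) ^^ n) u) \<in> \<theta>"
proof -
  let ?\<kappa> = "\<lambda>j. ldiv (newton \<gamma> j (Suc j)) (\<gamma> (Suc j))"
  have \<gamma>A: "\<gamma> i \<in> A" if "i \<le> n" for i
  proof -
    have "{..<i} \<subseteq> {..<n}" using that by auto
    then have "\<gamma> i = g {..<i}" using g\<gamma>[of "{..<i}"] by simp
    then show ?thesis using cubes_in[OF g closed] by simp
  qed
  note nA = newton_in[of n \<gamma>, OF \<gamma>A]
  have \<kappa>A: "?\<kappa> j \<in> A" if "Suc j \<le> n" for j using nA[of j] \<gamma>A that by (simp add: ldiv_in)
  have high: "(?\<kappa> j, u) \<in> \<theta>" if j: "k \<le> j" "Suc j \<le> n" for j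
  proof -
    let ?T = "{..<Suc j}"
    let ?I = "\<lambda>S. if ?T \<subseteq> S then ?\<kappa> j else u"
    have "?T \<subseteq> {..<n}" using j by auto
    then have "?I \<in> cubes A s (\<lambda>_. A \<times> A)"
      using newton_cubes(2)[OF g g\<gamma> \<gamma>0 j(2), of ?T] by simp
    then have F: "(\<lambda>S. ?I (S \<union> {k<..j})) \<in> cubes A s (\<lambda>_. A \<times> A)"
      by (rule cubes_reindex) auto
    have "(?I ({..<k} \<union> {k<..j}), ?I (insert k {..<k} \<union> {k<..j})) \<in> \<theta>"
    proof (rule term_condD[OF tc F])
      fix S assume "S \<subset> {..<k}"
      then obtain l where "l < k" "l \<notin> S" by auto
      then have "l \<in> ?T" "l \<notin> S \<union> {k<..j}" "l \<notin> insert k S \<union> {k<..j}" using j by auto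
      then have "\<not> ?T \<subseteq> S \<union> {k<..j}" "\<not> ?T \<subseteq> insert k S \<union> {k<..j}" by blast+
      then show "(?I (S \<union> {k<..j}), ?I (insert k S \<union> {k<..j})) \<in> \<theta>"
        using congrD(2)[OF \<theta> unit_in] by simp
    qed
    moreover have "?T \<subseteq> insert k {..<k} \<union> {k<..j}" by auto
    moreover have "k \<in> ?T" "k \<notin> {..<k} \<union> {k<..j}" using j by auto
    then have "\<not> ?T \<subseteq> {..<k} \<union> {k<..j}" by blast
    ultimately show ?thesis using congrD(3)[OF \<theta>] by simp
  qed
  have "(newton \<gamma> j n, ((\<lambda>z. s z (\<gamma> 1)) ^^ n) u) \<in> \<theta>" if "1 \<le> j" "j \<le> n" for j
    using that
  proof (induction j rule: dec_induct)
    case base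
    have "ldiv u (\<gamma> 1) = \<gamma> 1" using ldiv_mult[of u "\<gamma> 1"] \<gamma>A[OF n(1)] unit_in by (simp add: left_unit)
    then show ?case using congrD(2)[OF \<theta>] \<gamma>A[OF n(1)] unit_in by (simp add: right_iterate_in)
  next
    case (step j)
    have "(((\<lambda>z. s z (?\<kappa> j)) ^^ (n choose Suc j)) (newton \<gamma> j n), newton \<gamma> j n) \<in> \<theta>"
    proof (cases "Suc j \<le> k")
      case True
      then show ?thesis
        using right_iterate_period_dvd[OF \<kappa>A nA n(2)[of "Suc j"]] step congrD(2)[OF \<theta> nA] by simp
    next
      case False
      then have "(((\<lambda>z. s z (?\<kappa> j)) ^^ (n choose Suc j)) (newton \<gamma> j n),
          ((\<lambda>z. s z u) ^^ (n choose Suc j)) (newton \<gamma> j n)) \<in> \<theta>"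
        using step by (intro right_iterate_cong[OF \<theta>] high congrD(2)[OF \<theta>] nA) auto
      then show ?thesis using nA[of j n] step by (simp add: right_iterate_unit_arg)
    qed
    then show ?case using step congrD(4)[OF \<theta>] by simp
  qed
  from this[OF n(1) order_refl] show ?thesis using newton_eq[of n \<gamma>, OF \<gamma>A \<gamma>0] by simp
qed

lemma cubes_right_power_count:
  assumes x: "x \<in> A"
  shows "(\<lambda>S. ((\<lambda>z. s z x) ^^ (r * card (S \<inter> {..<m}))) u) \<in> cubes A s (\<lambda>_. A \<times> A)"
proof (induction m)
  case 0
  then show ?case by (simp add: cubes.const unit_in)
next
  case (Suc m)
  let ?P = "\<lambda>m S. ((\<lambda>z. s z x) ^^ (r * card (S \<inter> {..<m}))) u"
  let ?x = "\<lambda>S. if m \<in> S then x else u"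
  have "(\<lambda>S. ((\<lambda>z. s z (?x S)) ^^ i) (?P m S)) \<in> cubes A s (\<lambda>_. A \<times> A)" for i
  proof (induction i)
    case (Suc i)
    then show ?case using cubes.mult[OF Suc cubes.edge[of u x "\<lambda>_. A \<times> A" m]] x unit_in by simp
  qed (use Suc in simp)
  moreover have "((\<lambda>z. s z (?x S)) ^^ r) (?P m S) = ?P (Suc m) S" for S
  proof (cases "m \<in> S")
    case True
    then have "S \<inter> {..<Suc m} = insert m (S \<inter> {..<m})" by auto
    then show ?thesis using True by (simp add: funpow_funpow)
  next
    case False
    then have "S \<inter> {..<Suc m} = S \<inter> {..<m}" by (auto simp: less_Suc_eq)
    then show ?thesis using False x unit_in by (simp add: right_iterate_unit_arg right_iterate_in)
  qed
  ultimately show ?case by (metis (no_types, lifting) ext)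
qed

text \<open>Apply \<open>supernilpotent_sequence\<close> to the sequences \<open>i \<mapsto> x\<^sup>i \<cdot> y\<^sup>i\<close> and \<open>i \<mapsto> x\<^sup>n\<^sup>i\<close> of right
  powers, with \<open>n = N + 1\<close>. For the second one, \<open>n\<^sup>2\<close> and \<open>n\<close> give the same power as they differ
  by a multiple of \<open>fact (card A)\<close>.\<close>

lemma right_power_hom_idem:
  assumes \<theta>: "congruence A {binop s} \<theta>" and tc: "term_cond A s (\<lambda>_. A \<times> A) k \<theta>"
    and n: "\<And>j. 2 \<le> j \<Longrightarrow> j \<le> k \<Longrightarrow> fact (card A) dvd (Suc N choose j)" "fact (card A) dvd N * Suc N"
  shows "x \<in> A \<Longrightarrow> y \<in> A \<Longrightarrow> (s (right_power N x) (right_power N y), right_power N (s x y)) \<in> \<theta>"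
    and "x \<in> A \<Longrightarrow> (right_power N (right_power N x), right_power N x) \<in> \<theta>"
proof -
  let ?R = "\<lambda>x i. ((\<lambda>z. s z x) ^^ i) u"
  assume x: "x \<in> A"
  {
    assume y: "y \<in> A"
    let ?g = "\<lambda>S. s (?R x (1 * card (S \<inter> {..<Suc N}))) (?R y (1 * card (S \<inter> {..<Suc N})))"
    have "(s (?R x (Suc N)) (?R y (Suc N)), ?R (s (?R x 1) (?R y 1)) (Suc N)) \<in> \<theta>"
    proof (rule supernilpotent_sequence[OF \<theta> tc _ n(1), where \<gamma> = "\<lambda>i. s (?R x i) (?R y i)" and g = ?g])
      show "?g \<in> cubes A s (\<lambda>_. A \<times> A)" by (intro cubes.mult cubes_right_power_count x y)
      show "?g S = s (?R x (card S)) (?R y (card S))" if "S \<subseteq> {..<Suc N}" for S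
        using that by (simp add: Int_absorb2)
    qed (simp_all add: left_unit unit_in)
    then show "(s (right_power N x) (right_power N y), right_power N (s x y)) \<in> \<theta>"
      using x y by (simp add: right_power_eq closed left_unit del: funpow.simps(2)) (simp add: left_unit)
  }
  let ?g = "\<lambda>S. ?R x (Suc N * card (S \<inter> {..<Suc N}))"
  have "(?R x (Suc N * Suc N), ?R (?R x (Suc N * 1)) (Suc N)) \<in> \<theta>"
  proof (rule supernilpotent_sequence[OF \<theta> tc _ n(1), where \<gamma> = "\<lambda>i. ?R x (Suc N * i)" and g = ?g])
    show "?g \<in> cubes A s (\<lambda>_. A \<times> A)" by (intro cubes_right_power_count x)
    show "?g S = ?R x (Suc N * card S)" if "S \<subseteq> {..<Suc N}" for S
      using that by (simp add: Int_absorb2)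
  qed simp_all
  moreover have "?R x (Suc N * Suc N) = ?R x (Suc N)"
  proof -
    have "?R x (Suc N * Suc N) = ((\<lambda>z. s z x) ^^ (N * Suc N)) (?R x (Suc N))"
      unfolding funpow_funpow by (simp only: mult_Suc add.commute)
    also have "\<dots> = ?R x (Suc N)"
      by (rule right_iterate_period_dvd[OF x right_iterate_in[OF x unit_in] n(2)])
    finally show ?thesis .
  qed
  ultimately have "(?R x (Suc N), ?R (?R x (Suc N)) (Suc N)) \<in> \<theta>"
    by (simp only: mult_1_right)
  then have "(right_power N x, right_power N (right_power N x)) \<in> \<theta>"
    by (simp only: right_power_eq[OF x, symmetric] right_power_eq[OF right_power_in[OF x], symmetric])
  then show "(right_power N (right_power N x), right_power N x) \<in> \<theta>"
    by (rule congrD(3)[OF \<theta>])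
qed

lemma right_power_fixed_mult:
  assumes \<theta>: "congruence A {binop s} \<theta>"
    and hom: "(s (right_power N x) (right_power N y), right_power N (s x y)) \<in> \<theta>"
    and "(right_power N x, x) \<in> \<theta>" "(right_power N y, y) \<in> \<theta>"
  shows "(right_power N (s x y), s x y) \<in> \<theta>"
  by (rule congrD(4)[OF \<theta> congrD(3)[OF \<theta> hom] congrD(5)[OF \<theta> assms(3,4)]])

end

section \<open>Polynomial degree of integer functions modulo a prime\<close>

text \<open>Functions that modulo \<open>p\<close> are polynomials of degree at most \<open>D\<close> in the indicators of \<open>i \<in> S\<close>.
  Since these indicators are idempotent, the monomials are the indicators of \<open>T \<subseteq> S\<close>.\<close>

inductive degree_at_most :: "nat \<Rightarrow> nat \<Rightarrow> (nat set \<Rightarrow> int) \<Rightarrow> bool" for p :: nat and D :: nat where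
  monomial: "finite T \<Longrightarrow> card T \<le> D \<Longrightarrow> degree_at_most p D (\<lambda>S. c * of_bool (T \<subseteq> S))"
| add: "degree_at_most p D f \<Longrightarrow> degree_at_most p D g \<Longrightarrow> degree_at_most p D (\<lambda>S. f S + g S)"
| cong: "degree_at_most p D f \<Longrightarrow> (\<And>S. [f S = g S] (mod int p)) \<Longrightarrow> degree_at_most p D g"

lemma degree_const: "degree_at_most p D (\<lambda>S. c)"
  using degree_at_most.monomial[of "{}" D p c] by simp

lemma degree_mono:
  assumes "degree_at_most p D f" "D \<le> D'"
  shows "degree_at_most p D' f"
  using assms(1) by induction (auto intro: degree_at_most.intros assms(2) le_trans)

lemma degree_mult:
  assumes "degree_at_most p D f" "degree_at_most p D' g"
  shows "degree_at_most p (D + D') (\<lambda>S. f S * g S)"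
  using assms(1)
proof induction
  case f: (monomial T c)
  show ?case using assms(2)
  proof induction
    case (monomial T' c')
    have "degree_at_most p (D + D') (\<lambda>S. (c * c') * of_bool (T \<union> T' \<subseteq> S))"
      using f monomial card_Un_le[of T T'] by (intro degree_at_most.monomial) auto
    moreover have "(c * c') * of_bool (T \<union> T' \<subseteq> S) = c * of_bool (T \<subseteq> S) * (c' * of_bool (T' \<subseteq> S))" for S
      by auto
    ultimately show ?case by (simp only:)
  next
    case (add f g)
    then show ?case by (simp add: distrib_left degree_at_most.add)
  next
    case (cong f' g')
    show ?case by (rule degree_at_most.cong[OF cong.IH]) (intro cong_mult cong_refl cong.hyps)
  qed
next
  case (add f g)
  then show ?case by (simp add: distrib_right degree_at_most.add)
next
  case (cong f' g')
  show ?case by (rule degree_at_most.cong[OF cong.IH]) (intro cong_mult cong_refl cong.hyps)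
qed

lemma degree_sum:
  assumes "finite I" "\<And>i. i \<in> I \<Longrightarrow> degree_at_most p D (f i)"
  shows "degree_at_most p D (\<lambda>S. \<Sum>i\<in>I. f i S)"
  using assms by (induction I) (simp_all add: degree_const degree_at_most.add)

lemma degree_power:
  assumes "degree_at_most p D f"
  shows "degree_at_most p (D * e) (\<lambda>S. f S ^ e)"
  by (induction e) (use degree_mult[OF assms] in \<open>simp_all add: degree_const\<close>)

text \<open>A monomial of degree below \<open>card X\<close> misses some \<open>i \<in> X\<close>, and the terms for \<open>S\<close> and
  \<open>insert i S\<close> cancel.\<close>

lemma degree_alternating_sum:
  assumes "degree_at_most p D f" "finite X" "D < card X"
  shows "[(\<Sum>S\<in>Pow X. (-1) ^ card S * f S) = 0] (mod int p)"
  using assms(1)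
proof induction
  case (monomial T c)
  have "\<not> X \<subseteq> T" using monomial card_mono[of T X] assms(3) by auto
  then obtain i where i: "i \<in> X" "i \<notin> T" by blast
  define Y where "Y = X - {i}"
  have X: "X = insert i Y" and Y: "i \<notin> Y" "finite Y" using i assms(2) by (auto simp: Y_def)
  let ?f = "\<lambda>S. (-1) ^ card S * (c * of_bool (T \<subseteq> S)) :: int"
  have "(\<Sum>S\<in>Pow X. ?f S) = (\<Sum>S\<in>Pow Y. ?f S) + (\<Sum>S\<in>insert i ` Pow Y. ?f S)"
    unfolding X Pow_insert by (rule sum.union_disjoint) (use Y in auto)
  also have "(\<Sum>S\<in>insert i ` Pow Y. ?f S) = (\<Sum>S\<in>Pow Y. ?f (insert i S))"
    by (rule sum.reindex_cong[where l = "insert i"]) (use Y in \<open>auto intro!: inj_onI\<close>)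
  also have "\<dots> = (\<Sum>S\<in>Pow Y. - ?f S)"
  proof (rule sum.cong[OF refl])
    fix S assume S: "S \<in> Pow Y"
    then have "i \<notin> S" "finite S" using Y finite_subset by auto
    moreover have "T \<subseteq> insert i S \<longleftrightarrow> T \<subseteq> S" using i by auto
    ultimately show "?f (insert i S) = - ?f S" by simp
  qed
  finally show ?case by (simp add: sum_negf)
next
  case (add f g)
  then show ?case using cong_add[OF add.IH] by (simp add: distrib_left sum.distrib)
next
  case (cong f g)
  have "[(\<Sum>S\<in>Pow X. (-1) ^ card S * g S) = (\<Sum>S\<in>Pow X. (-1) ^ card S * f S)] (mod int p)"
    by (rule cong_sum) (intro cong_mult cong_refl cong_sym[OF cong.hyps(2)])
  then show ?case using cong.IH cong_trans by blast
qed

text \<open>By Fermat's little theorem, being congruent to \<open>i\<close> is a polynomial condition of degree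
  \<open>p - 1\<close>.\<close>

lemma indicator_mod_prime:
  assumes "prime p" "i < p"
  shows "[1 - (a - int i) ^ (p - 1) = of_bool (a mod int p = int i)] (mod int p)"
proof (cases "int p dvd a - int i")
  case True
  have "a mod int p = int i" using True assms(2) by (metis mod_eq_dvd_iff mod_pos_pos_trivial of_nat_0_le_iff of_nat_less_iff)
  moreover have "0 < p - 1" using prime_gt_1_nat[OF assms(1)] by simp
  then have "int p dvd (a - int i) ^ (p - 1)" using True by (meson dvd_power dvd_trans)
  ultimately show ?thesis by (simp add: cong_iff_dvd_diff)
next
  case False
  have "a mod int p \<noteq> int i" using False by (metis mod_eq_dvd_iff mod_mod_trivial of_nat_mod assms(2) mod_less)
  moreover have "[(a - int i) ^ (p - 1) = 1] (mod int p)"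
  proof -
    define b where "b = nat ((a - int i) mod int p)"
    have b: "int b = (a - int i) mod int p"
      unfolding b_def using prime_gt_0_nat[OF assms(1)] by simp
    then have "\<not> p dvd b" using False by (metis dvd_mod_iff dvd_refl int_dvd_int_iff)
    then have "[b ^ (p - 1) = 1] (mod p)" by (rule fermat_theorem[OF assms(1)])
    then have "[int b ^ (p - 1) = 1] (mod int p)" by (metis cong_int_iff of_nat_1 of_nat_power)
    moreover have "[(a - int i) ^ (p - 1) = int b ^ (p - 1)] (mod int p)"
      by (intro cong_pow) (simp add: b cong_def)
    ultimately show ?thesis using cong_trans by blast
  qed
  then have "[1 - (a - int i) ^ (p - 1) = 1 - 1] (mod int p)" by (intro cong_diff cong_refl)
  ultimately show ?thesis by simp
qed

section \<open>Loops on which all functions have bounded degree\<close>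

text \<open>On a subloop \<open>P\<close> this plays the part of "nilpotent of \<open>p\<close>-power order modulo \<open>\<alpha>\<close>": the degree
  \<open>D\<close> bounds all functions on \<open>P/\<alpha>\<close> along all polynomial operations at once.\<close>

definition bounded_degree ::
  "('a \<Rightarrow> 'a \<Rightarrow> 'a) \<Rightarrow> 'a set \<Rightarrow> 'a rel \<Rightarrow> nat \<Rightarrow> nat \<Rightarrow> bool" where
  "bounded_degree s P \<alpha> p D \<longleftrightarrow> (\<forall>F \<in> cubes P s (\<lambda>_. P \<times> P). \<forall>h :: 'a \<Rightarrow> int.
     (\<forall>x\<in>P. \<forall>y\<in>P. (x, y) \<in> \<alpha> \<longrightarrow> h x = h y) \<longrightarrow> degree_at_most p D (\<lambda>S. h (F S)))"

lemma bounded_degreeD: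
  assumes "bounded_degree s P \<alpha> p D" "F \<in> cubes P s (\<lambda>_. P \<times> P)"
    and "\<And>x y. x \<in> P \<Longrightarrow> y \<in> P \<Longrightarrow> (x, y) \<in> \<alpha> \<Longrightarrow> h x = h y"
  shows "degree_at_most p D (\<lambda>S. h (F S))"
  using assms unfolding bounded_degree_def by simp

lemma bounded_degree_total:
  assumes "P \<subseteq> A" "\<And>x y. x \<in> P \<Longrightarrow> y \<in> P \<Longrightarrow> s x y \<in> P"
  shows "bounded_degree s P (A \<times> A) p 0"
  unfolding bounded_degree_def
proof (intro ballI allI impI)
  fix F and h :: "'a \<Rightarrow> int"
  assume F: "F \<in> cubes P s (\<lambda>_. P \<times> P)" and h: "\<forall>x\<in>P. \<forall>y\<in>P. (x, y) \<in> A \<times> A \<longrightarrow> h x = h y"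
  have "F S \<in> P" for S using cubes_in[OF F assms(2)] by simp
  then have "h (F S) = h (F {})" for S using h assms(1) by blast
  then have "(\<lambda>S. h (F S)) = (\<lambda>S. h (F {}))" by blast
  then show "degree_at_most p 0 (\<lambda>S. h (F S))" using degree_const by metis
qed

context finite_loop
begin

lemma central_iterate_iff:
  assumes \<beta>: "congruence A {binop s} \<beta>" and st: "central_step A s \<alpha> \<beta> p \<rho>" and x: "x \<in> A"
  shows "((\<rho> ^^ i) x, (\<rho> ^^ j) x) \<in> \<beta> \<longleftrightarrow> [i = j] (mod p)"
proof -
  note d = central_mapD[OF central_map_iterate[OF \<beta> central_stepD(3)[OF st]]]
  note per = central_stepD(6)[OF st]
  have p: "0 < p" using central_stepD(2)[OF st] prime_gt_0_nat by blast
  define l where "l = i * (p - 1)"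
  have li: "l + i = i * p" using p unfolding l_def by (cases p) (auto simp: algebra_simps)
  have "((\<rho> ^^ i) x, (\<rho> ^^ j) x) \<in> \<beta> \<longleftrightarrow> p dvd l + j"
  proof
    assume "((\<rho> ^^ i) x, (\<rho> ^^ j) x) \<in> \<beta>"
    then have "((\<rho> ^^ (l + i)) x, (\<rho> ^^ (l + j)) x) \<in> \<beta>"
      using d(2)[of "(\<rho> ^^ i) x" "(\<rho> ^^ j) x" l] by (simp only: funpow_funpow)
    moreover have "((\<rho> ^^ (l + i)) x, x) \<in> \<beta>" using per[OF x] li by simp
    ultimately have "((\<rho> ^^ (l + j)) x, x) \<in> \<beta>" using congrD(3,4)[OF \<beta>] by meson
    then show "p dvd l + j" using per[OF x] by simp
  next
    assume "p dvd l + j"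
    then have "((\<rho> ^^ (l + j)) x, x) \<in> \<beta>" using per[OF x] by simp
    then have "((\<rho> ^^ (i + (l + j))) x, (\<rho> ^^ i) x) \<in> \<beta>"
      using d(2)[of "(\<rho> ^^ (l + j)) x" x i] by (simp only: funpow_funpow)
    moreover have "((\<rho> ^^ (l + i)) ((\<rho> ^^ j) x), (\<rho> ^^ j) x) \<in> \<beta>"
      using per[OF d(1)[OF x]] li by simp
    then have "((\<rho> ^^ (i + (l + j))) x, (\<rho> ^^ j) x) \<in> \<beta>"
      by (simp add: funpow_funpow add.assoc add.left_commute)
    ultimately show "((\<rho> ^^ i) x, (\<rho> ^^ j) x) \<in> \<beta>" using congrD(3,4)[OF \<beta>] by meson
  qed
  also have "\<dots> \<longleftrightarrow> [l + i = l + j] (mod p)"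
    unfolding li by (auto simp: cong_def mod_eq_0_iff_dvd)
  also have "\<dots> \<longleftrightarrow> [i = j] (mod p)" by (rule cong_add_lcancel_nat)
  finally show ?thesis .
qed

text \<open>Fix representatives of the \<open>\<alpha>\<close>-classes, and let \<open>hc x\<close> be the central coordinate of \<open>x\<close>: the
  number of steps \<open>\<rho>\<close> from the representative to \<open>x\<close>. Then \<open>hc (x \<cdot> y) - hc x - hc y\<close> depends on
  the representatives only, hence has degree at most \<open>2 D\<close> along cubes. Summing over all
  products in a polynomial operation leaves the degree of \<open>hc\<close> bounded, however long the
  operation is. Every function modulo \<open>\<beta>\<close> is a combination of indicators of the representative
  and of the coordinate modulo \<open>p\<close>.\<close>

lemma bounded_degree_same_prime:
  assumes \<alpha>: "congruence A {binop s} \<alpha>" and \<beta>: "congruence A {binop s} \<beta>"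
    and st: "central_step A s \<alpha> \<beta> p \<rho>"
    and PA: "P \<subseteq> A" and Pcl: "\<And>x y. x \<in> P \<Longrightarrow> y \<in> P \<Longrightarrow> s x y \<in> P"
    and bd: "bounded_degree s P \<alpha> p D"
  shows "\<exists>D'. bounded_degree s P \<beta> p D'"
proof -
  note a = congrD[OF \<alpha>] and b = congrD[OF \<beta>]
  note d = central_mapD[OF central_map_iterate[OF \<beta> central_stepD(3)[OF st]]]
  note iff = central_iterate_iff[OF \<beta> st]
  have pr: "prime p" using central_stepD(2)[OF st] .
  define rep where "rep x = (SOME y. y \<in> \<alpha> `` {x})" for x
  have rep: "(x, rep x) \<in> \<alpha>" if "x \<in> A" for x
    using someI[of "\<lambda>y. y \<in> \<alpha> `` {x}" x] a(2)[OF that] unfolding rep_def by simp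
  have repA: "rep x \<in> A" if "x \<in> A" for x using rep[OF that] a(1) by blast
  have rep_eq: "rep x = rep y" if "(x, y) \<in> \<alpha>" for x y
    using equiv_class_eq[of A \<alpha> x y] \<alpha> that unfolding rep_def congruence_binop_iff by simp
  define hc where "hc x = (SOME i. (x, (\<rho> ^^ i) (rep x)) \<in> \<beta>)" for x
  have hc: "(x, (\<rho> ^^ hc x) (rep x)) \<in> \<beta>" if "x \<in> A" for x
    unfolding hc_def by (rule someI_ex) (rule central_stepD(5)[OF st rep[OF that]])
  have key: "[int (hc (s x y)) = int (hc x) + int (hc y) + int (hc (s (rep x) (rep y)))] (mod int p)"
    if xy: "x \<in> A" "y \<in> A" for x y
  proof -
    let ?x = "rep x" and ?y = "rep y" and ?i = "hc x" and ?j = "hc y"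
    let ?z = "s ?x ?y" and ?l = "hc (s ?x ?y)"
    have zA: "?z \<in> A" using repA xy closed by simp
    have 1: "(s x y, s ((\<rho> ^^ ?i) ?x) ((\<rho> ^^ ?j) ?y)) \<in> \<beta>" using b(5) hc xy by blast
    have 2: "((\<rho> ^^ ?i) (s ?x ((\<rho> ^^ ?j) ?y)), s ((\<rho> ^^ ?i) ?x) ((\<rho> ^^ ?j) ?y)) \<in> \<beta>"
      using d(3)[OF repA[OF xy(1)] d(1)[OF repA[OF xy(2)]]] .
    have 3: "((\<rho> ^^ ?i) ((\<rho> ^^ ?j) ?z), (\<rho> ^^ ?i) (s ?x ((\<rho> ^^ ?j) ?y))) \<in> \<beta>"
      using d(2)[OF d(4)[OF repA[OF xy(1)] repA[OF xy(2)]]] .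
    have 4: "((\<rho> ^^ (?i + ?j)) ?z, (\<rho> ^^ (?i + ?j)) ((\<rho> ^^ ?l) (rep ?z))) \<in> \<beta>"
      using d(2)[OF hc[OF zA]] .
    have "(s x y, ?z) \<in> \<alpha>" using a(5) rep xy by blast
    then have r: "rep ?z = rep (s x y)" using rep_eq by simp
    have "(s x y, (\<rho> ^^ (?i + ?j + ?l)) (rep (s x y))) \<in> \<beta>"
      using b(4)[OF 1 b(4)[OF b(3)[OF 2] b(4)[OF b(3)[OF 3]]]] 4
      unfolding funpow_funpow r by blast
    then have "((\<rho> ^^ hc (s x y)) (rep (s x y)), (\<rho> ^^ (?i + ?j + ?l)) (rep (s x y))) \<in> \<beta>"
      using b(4)[OF b(3)[OF hc[OF closed[OF xy]]]] by blast
    then have "[hc (s x y) = ?i + ?j + ?l] (mod p)"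
      using iff[OF repA[OF closed[OF xy]]] by simp
    then show ?thesis by (simp flip: cong_int_iff)
  qed
  let ?E = "2 * D + 1"
  have FP: "F S \<in> P" if "F \<in> cubes P s (\<lambda>_. P \<times> P)" for F S using cubes_in[OF that Pcl] by simp
  have deg_rep: "degree_at_most p D (\<lambda>S. of_bool (rep (F S) = r))"
    if F: "F \<in> cubes P s (\<lambda>_. P \<times> P)" for F r
    by (rule bounded_degreeD[OF bd F, where h = "\<lambda>x. of_bool (rep x = r)"]) (use rep_eq in auto)
  \<comment> \<open>The \<open>+ 1\<close> in the bound pays for the edges, which are of degree \<open>1\<close> even if \<open>D = 0\<close>.\<close>
  have deg_hc: "degree_at_most p ?E (\<lambda>S. int (hc (F S)))" if "F \<in> cubes P s (\<lambda>_. P \<times> P)" for F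
    using that
  proof induction
    case (const c)
    show ?case by (rule degree_const)
  next
    case (edge c c' i)
    have "degree_at_most p ?E (\<lambda>S. int (hc c) + (int (hc c') - int (hc c)) * of_bool ({i} \<subseteq> S))"
      by (intro degree_at_most.add degree_const degree_at_most.monomial) auto
    then show ?case by (rule degree_at_most.cong) auto
  next
    case (mult F G)
    have "degree_at_most p ?E (\<lambda>S. int (hc (F S)) + int (hc (G S)) +
      (\<Sum>r\<in>A. \<Sum>q\<in>A. int (hc (s r q)) * (of_bool (rep (F S) = r) * of_bool (rep (G S) = q))))"
    proof (intro degree_at_most.add mult.IH degree_sum fin)
      fix r q
      have "degree_at_most p (0 + (D + D)) (\<lambda>S. int (hc (s r q)) * (of_bool (rep (F S) = r) * of_bool (rep (G S) = q)))"
        by (intro degree_mult degree_const deg_rep mult.hyps)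
      then show "degree_at_most p ?E (\<lambda>S. int (hc (s r q)) * (of_bool (rep (F S) = r) * of_bool (rep (G S) = q)))"
        by (rule degree_mono) simp
    qed
    then show ?case
    proof (rule degree_at_most.cong)
      fix S
      have A: "F S \<in> A" "G S \<in> A" using FP mult.hyps PA by blast+
      have "(\<Sum>r\<in>A. \<Sum>q\<in>A. int (hc (s r q)) * (of_bool (rep (F S) = r) * of_bool (rep (G S) = q))) =
        (\<Sum>r\<in>A. if rep (F S) = r then (\<Sum>q\<in>A. if rep (G S) = q then int (hc (s r q)) else 0) else 0)"
        by (intro sum.cong refl) (auto intro!: sum.cong)
      also have "\<dots> = int (hc (s (rep (F S)) (rep (G S))))" using repA A fin by simp
      finally show "[int (hc (F S)) + int (hc (G S)) +
        (\<Sum>r\<in>A. \<Sum>q\<in>A. int (hc (s r q)) * (of_bool (rep (F S) = r) * of_bool (rep (G S) = q))) =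
        int (hc (s (F S) (G S)))] (mod int p)"
        using cong_sym[OF key[OF A]] by simp
    qed
  qed
  have "bounded_degree s P \<beta> p (D + ?E * (p - 1))"
    unfolding bounded_degree_def
  proof (intro ballI allI impI)
    fix F and h :: "'a \<Rightarrow> int"
    assume F: "F \<in> cubes P s (\<lambda>_. P \<times> P)" and h: "\<forall>x\<in>P. \<forall>y\<in>P. (x, y) \<in> \<beta> \<longrightarrow> h x = h y"
    define H where "H r i = h (SOME x. x \<in> P \<and> rep x = r \<and> hc x mod p = i)" for r i
    have H: "H (rep x) (hc x mod p) = h x" if x: "x \<in> P" for x
    proof -
      define y where "y = (SOME y. y \<in> P \<and> rep y = rep x \<and> hc y mod p = hc x mod p)"
      have y: "y \<in> P \<and> rep y = rep x \<and> hc y mod p = hc x mod p"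
        unfolding y_def by (rule someI[of _ x]) (use x in simp)
      have xyA: "x \<in> A" "y \<in> A" using x y PA by auto
      have "((\<rho> ^^ hc y) (rep x), (\<rho> ^^ hc x) (rep x)) \<in> \<beta>"
        using iff[OF repA[OF xyA(1)]] y by (simp add: cong_def)
      then have "(y, x) \<in> \<beta>" using hc[OF xyA(1)] hc[OF xyA(2)] y b(3,4) by metis
      then show ?thesis using h x y unfolding H_def y_def[symmetric] by blast
    qed
    have "degree_at_most p (D + ?E * (p - 1)) (\<lambda>S. \<Sum>r\<in>A. \<Sum>i<p. H r i *
      (of_bool (rep (F S) = r) * (1 - (int (hc (F S)) - int i) ^ (p - 1))))"
    proof (intro degree_sum fin finite_lessThan)
      fix r i
      have "degree_at_most p ?E (\<lambda>S. int (hc (F S)) + (- int i))"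
        by (intro degree_at_most.add deg_hc[OF F] degree_const)
      then have "degree_at_most p ?E (\<lambda>S. int (hc (F S)) - int i)" by simp
      then have "degree_at_most p (0 + ?E * (p - 1)) (\<lambda>S. (- 1) * (int (hc (F S)) - int i) ^ (p - 1))"
        by (intro degree_mult[OF degree_const] degree_power)
      then have "degree_at_most p (?E * (p - 1)) (\<lambda>S. 1 + (- 1) * (int (hc (F S)) - int i) ^ (p - 1))"
        by (intro degree_at_most.add degree_const) (simp only: add_0)
      then have "degree_at_most p (?E * (p - 1)) (\<lambda>S. 1 - (int (hc (F S)) - int i) ^ (p - 1))" by simp
      then have "degree_at_most p (0 + (D + ?E * (p - 1))) (\<lambda>S. H r i *
        (of_bool (rep (F S) = r) * (1 - (int (hc (F S)) - int i) ^ (p - 1))))"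
        by (intro degree_mult degree_const deg_rep F)
      then show "degree_at_most p (D + ?E * (p - 1)) (\<lambda>S. H r i *
        (of_bool (rep (F S) = r) * (1 - (int (hc (F S)) - int i) ^ (p - 1))))" by simp
    qed
    then show "degree_at_most p (D + ?E * (p - 1)) (\<lambda>S. h (F S))"
    proof (rule degree_at_most.cong)
      fix S
      have xA: "F S \<in> A" using FP[OF F] PA by blast
      let ?r = "rep (F S)" and ?c = "hc (F S)"
      have "[(\<Sum>r\<in>A. \<Sum>i<p. H r i * (of_bool (?r = r) * (1 - (int ?c - int i) ^ (p - 1)))) =
        (\<Sum>r\<in>A. \<Sum>i<p. H r i * (of_bool (?r = r) * of_bool (int ?c mod int p = int i)))] (mod int p)"
        by (intro cong_sum cong_mult cong_refl indicator_mod_prime[OF pr]) simp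
      also have "(\<Sum>r\<in>A. \<Sum>i<p. H r i * (of_bool (?r = r) * of_bool (int ?c mod int p = int i))) =
        (\<Sum>r\<in>A. if ?r = r then (\<Sum>i<p. if ?c mod p = i then H r i else 0) else 0)"
        by (intro sum.cong refl) (auto intro!: sum.cong simp flip: of_nat_mod)
      also have "\<dots> = H ?r (?c mod p)" using repA[OF xA] fin prime_gt_0_nat[OF pr] by simp
      also have "\<dots> = h (F S)" using H FP[OF F] by simp
      finally show "[(\<Sum>r\<in>A. \<Sum>i<p. H r i * (of_bool (?r = r) * (1 - (int ?c - int i) ^ (p - 1)))) = h (F S)] (mod int p)" .
    qed
  qed
  then show ?thesis by blast
qed

text \<open>If \<open>y\<close> is moved by \<open>i\<close> central steps of order \<open>q\<close>, then its \<open>(N + 1)\<close>-st power is moved by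
  \<open>(N + 1) i\<close> steps, that is, not at all. As the elements of \<open>P\<close> are their own powers, \<open>\<alpha>\<close> and
  \<open>\<beta>\<close> agree on \<open>P\<close>.\<close>

lemma bounded_degree_other_prime:
  assumes \<beta>: "congruence A {binop s} \<beta>" and st: "central_step A s \<alpha> \<beta> q \<rho>"
    and "\<theta> \<subseteq> \<beta>" "q dvd Suc N" "\<And>x. x \<in> P \<Longrightarrow> x \<in> A \<and> (right_power N x, x) \<in> \<theta>"
    and bd: "bounded_degree s P \<alpha> p D"
  shows "bounded_degree s P \<beta> p D"
proof -
  note b = congrD[OF \<beta>]
  have "(x, y) \<in> \<beta>" if xy: "x \<in> P" "y \<in> P" "(x, y) \<in> \<alpha>" for x y
  proof -
    have A: "x \<in> A" "y \<in> A" and E: "(right_power N x, x) \<in> \<beta>" "(right_power N y, y) \<in> \<beta>"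
      using xy assms(3,5) by blast+
    obtain i where "(x, (\<rho> ^^ i) y) \<in> \<beta>" using central_stepD(5)[OF st xy(3)] by blast
    then have 1: "(right_power N x, right_power N ((\<rho> ^^ i) y)) \<in> \<beta>" by (rule right_power_cong[OF \<beta>])
    have 2: "(right_power N ((\<rho> ^^ i) y), ((\<rho> ^^ i) ^^ Suc N) (right_power N y)) \<in> \<beta>"
      by (rule right_power_central[OF \<beta> central_map_iterate[OF \<beta> central_stepD(3)[OF st]] A(2)])
    have "((\<rho> ^^ (Suc N * i)) (right_power N y), right_power N y) \<in> \<beta>"
      using central_stepD(6)[OF st right_power_in[OF A(2)]] dvd_mult2[OF assms(4)] by blast
    then have 3: "(((\<rho> ^^ i) ^^ Suc N) (right_power N y), right_power N y) \<in> \<beta>"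
      by (simp only: funpow_mult mult.commute)
    show ?thesis using b(4)[OF b(3)[OF E(1)] b(4)[OF 1 b(4)[OF 2 b(4)[OF 3 E(2)]]]] .
  qed
  then show ?thesis using bd unfolding bounded_degree_def by meson
qed

end

section \<open>Straightening the multiplication along a central step\<close>

text \<open>Absorb twice: \<open>j (j - 1) (n choose j) = n (n - 1) (n - 2 choose j - 2)\<close> for \<open>n = N + 1\<close>.\<close>

lemma dvd_binomial_fact: "2 \<le> j \<Longrightarrow> N * Suc N dvd (Suc N choose j) * fact j"
proof -
  assume "2 \<le> j"
  then obtain i where j: "j = Suc (Suc i)" by (metis add_2_eq_Suc le_Suc_ex)
  show ?thesis
  proof (cases N)
    case (Suc N')
    have "(Suc N choose j) * fact j = (Suc j - 1) * (Suc N choose j) * (Suc i * fact i)"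
      by (simp add: j algebra_simps)
    also have "\<dots> = Suc N * ((N choose Suc i) * Suc i) * fact i"
      using Suc_times_binomial[of "Suc i" N] by (simp add: j algebra_simps)
    also have "(N choose Suc i) * Suc i = N * (N' choose i)"
      using Suc_times_binomial[of i N'] Suc by (simp add: algebra_simps)
    finally have "(Suc N choose j) * fact j = N * Suc N * ((N' choose i) * fact i)"
      by (simp only: ac_simps)
    then show ?thesis by (metis dvd_triv_left)
  qed (simp add: j)
qed

text \<open>With \<open>M * fact k = p\<^sup>a l\<close> and \<open>l\<close> prime to \<open>p\<close>, the Chinese remainder theorem gives
  \<open>n = N + 1\<close> that is \<open>1\<close> modulo \<open>p\<^sup>a\<^sup>+\<^sup>1\<close> and \<open>0\<close> modulo \<open>l\<close>. The factor \<open>fact k\<close> absorbs the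
  denominators of the binomial coefficients, and the exponent \<open>a + 1\<close> ensures that \<open>n\<close> is \<open>1\<close>
  modulo \<open>p\<close> also in the case \<open>a = 0\<close>.\<close>

lemma exists_power_exponent:
  assumes "prime p" "0 < M"
  obtains N where "p dvd N" "M dvd N * Suc N"
    "\<And>q. prime q \<Longrightarrow> q \<noteq> p \<Longrightarrow> q dvd M \<Longrightarrow> q dvd Suc N"
    "\<And>j. 2 \<le> j \<Longrightarrow> j \<le> k \<Longrightarrow> M dvd (Suc N choose j)"
proof -
  define W where "W = M * fact k"
  have "W \<noteq> 0" using assms(2) by (simp add: W_def)
  then obtain a l where W: "W = p ^ a * l" "\<not> p dvd l"
    using multiplicity_decompose'[of W p] assms(1) not_prime_unit by (metis mult.commute)
  have cop: "coprime (p ^ Suc a) l"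
    using W(2) assms(1) by (metis coprime_power_left_iff prime_imp_coprime_nat)
  obtain x where x: "[x = 1] (mod p ^ Suc a)" "[x = 0] (mod l)"
    using binary_chinese_remainder_nat[OF cop] by blast
  have "x \<noteq> 0"
  proof
    assume "x = 0"
    then have "p ^ Suc a dvd 1" using x(1) by (simp add: cong_0_iff cong_sym_eq[of 0])
    then show False using assms(1) by (metis dvd_mult_left not_prime_unit power_Suc)
  qed
  then obtain N where N: "x = Suc N" by (cases x) auto
  have pN: "p ^ Suc a dvd N" using x(1) unfolding N by (simp add: cong_altdef_nat)
  have lN: "l dvd Suc N" using x(2) unfolding N by (simp add: cong_0_iff)
  have WN: "W dvd N * Suc N"
    unfolding W(1) by (rule mult_dvd_mono[OF _ lN]) (use pN dvd_trans[of "p ^ a" "p ^ Suc a" N] in simp)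
  show thesis
  proof (rule that[of N])
    show "p dvd N" using pN by (metis dvd_mult_left power_Suc)
    show "M dvd N * Suc N" using WN by (metis W_def dvd_mult_left)
    show "q dvd Suc N" if "prime q" "q \<noteq> p" "q dvd M" for q
    proof -
      have "q dvd p ^ a * l" using that(3) W(1) by (metis W_def dvd_mult2)
      then have "q dvd l" using that assms(1)
        by (metis prime_dvd_mult_nat prime_dvd_power primes_dvd_imp_eq)
      then show ?thesis using lN dvd_trans by blast
    qed
    show "M dvd (Suc N choose j)" if j: "2 \<le> j" "j \<le> k" for j
    proof -
      have "M * fact j dvd W" unfolding W_def using j by (intro mult_dvd_mono fact_dvd) auto
      then have "M * fact j dvd (Suc N choose j) * fact j"
        by (rule dvd_trans[OF dvd_trans[OF _ WN] dvd_binomial_fact[OF j(1)]])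
      then show ?thesis by simp
    qed
  qed
qed

lemma exists_minimal_congruence:
  assumes "finite A" "congruence A {binop s} \<alpha>\<^sub>0" "Q \<alpha>\<^sub>0"
  obtains \<alpha> where "congruence A {binop s} \<alpha>" "Q \<alpha>"
    "\<forall>\<beta>. congruence A {binop s} \<beta> \<longrightarrow> Q \<beta> \<longrightarrow> \<not> \<beta> \<subset> \<alpha>"
proof -
  obtain \<alpha> where \<alpha>: "congruence A {binop s} \<alpha> \<and> Q \<alpha>"
    and min: "\<forall>\<beta>. congruence A {binop s} \<beta> \<and> Q \<beta> \<longrightarrow> card \<alpha> \<le> card \<beta>"
    using ex_has_least_nat[of "\<lambda>\<alpha>. congruence A {binop s} \<alpha> \<and> Q \<alpha>" \<alpha>\<^sub>0 card] assms(2,3) by blast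
  have "\<alpha> \<subseteq> A \<times> A" using congrD(1) \<alpha> by fast
  then have "finite \<alpha>" by (rule finite_subset) (simp add: assms(1))
  show thesis
  proof (rule that[of \<alpha>])
    show "\<forall>\<beta>. congruence A {binop s} \<beta> \<longrightarrow> Q \<beta> \<longrightarrow> \<not> \<beta> \<subset> \<alpha>"
      using min psubset_card_mono[OF \<open>finite \<alpha>\<close>] by (metis not_less)
  qed (use \<alpha> in auto)
qed

context finite_loop
begin

lemma total_congruence: "congruence A {binop s} (A \<times> A)"
  by (rule congrI) (auto simp: closed)

text \<open>The first \<open>q\<close> translates of the unit are distinct, so \<open>q \<le> card A\<close>.\<close>

lemma central_prime_dvd:
  assumes \<beta>: "congruence A {binop s} \<beta>" and st: "central_step A s \<alpha> \<beta> q \<rho>"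
  shows "q dvd fact (card A)"
proof -
  note d = central_mapD[OF central_map_iterate[OF \<beta> central_stepD(3)[OF st]]]
  have "inj_on (\<lambda>i. (\<rho> ^^ i) u) {..<q}"
  proof (rule inj_onI)
    fix i j assume "i \<in> {..<q}" "j \<in> {..<q}" "(\<rho> ^^ i) u = (\<rho> ^^ j) u"
    then show "i = j"
      using central_iterate_iff[OF \<beta> st unit_in, of i j] congrD(2)[OF \<beta> d(1)[OF unit_in, of j]]
      by (simp add: cong_def)
  qed
  then have "card {..<q} \<le> card A"
    by (rule card_inj_on_le) (use d(1)[OF unit_in] fin in auto)
  moreover have "1 \<le> q" using central_stepD(2)[OF st] prime_gt_0_nat by (simp add: Suc_leI)
  ultimately show ?thesis by (intro dvd_fact) auto
qed

text \<open>Descend from \<open>A \<times> A\<close> to \<open>\<theta>\<close> along central steps of prime order: steps of order \<open>p\<close> raise the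
  degree, all others are trivial on \<open>P\<close>. The predicate \<open>C\<close> restricts the congruences of the
  chain; it stands for the congruences of a second multiplication of which \<open>s\<close> is a term
  function.\<close>

lemma chain_bounded_degree:
  assumes step: "\<And>\<alpha>. \<lbrakk>congruence A {binop s} \<alpha>; C \<alpha>; \<theta> \<subset> \<alpha>\<rbrakk> \<Longrightarrow>
      \<exists>\<beta> q \<rho>. congruence A {binop s} \<beta> \<and> C \<beta> \<and> \<theta> \<subseteq> \<beta> \<and> \<beta> \<subset> \<alpha> \<and> central_step A s \<alpha> \<beta> q \<rho>"
    and C: "C (A \<times> A)" and \<theta>: "congruence A {binop s} \<theta>"
    and N: "\<And>q. prime q \<Longrightarrow> q \<noteq> p \<Longrightarrow> q dvd fact (card A) \<Longrightarrow> q dvd Suc N"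
    and P: "\<And>x. x \<in> P \<Longrightarrow> x \<in> A \<and> (right_power N x, x) \<in> \<theta>"
    and Pcl: "\<And>x y. x \<in> P \<Longrightarrow> y \<in> P \<Longrightarrow> s x y \<in> P"
  shows "\<exists>D. bounded_degree s P \<theta> p D"
proof -
  have PA: "P \<subseteq> A" using P by blast
  have "\<theta> \<subseteq> A \<times> A" using congrD(1)[OF \<theta>] by auto
  moreover have "bounded_degree s P (A \<times> A) p 0" by (rule bounded_degree_total[OF PA]) (rule Pcl)
  ultimately have top: "C (A \<times> A) \<and> \<theta> \<subseteq> A \<times> A \<and> (\<exists>D. bounded_degree s P (A \<times> A) p D)"
    using C by blast
  obtain \<alpha> where a: "congruence A {binop s} \<alpha>"
    and \<alpha>: "C \<alpha> \<and> \<theta> \<subseteq> \<alpha> \<and> (\<exists>D. bounded_degree s P \<alpha> p D)"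
    and min: "\<forall>\<beta>. congruence A {binop s} \<beta> \<longrightarrow>
      C \<beta> \<and> \<theta> \<subseteq> \<beta> \<and> (\<exists>D. bounded_degree s P \<beta> p D) \<longrightarrow> \<not> \<beta> \<subset> \<alpha>"
    using top by (rule exists_minimal_congruence[OF fin total_congruence,
        where Q = "\<lambda>\<alpha>. C \<alpha> \<and> \<theta> \<subseteq> \<alpha> \<and> (\<exists>D. bounded_degree s P \<alpha> p D)"])
  obtain D where D: "bounded_degree s P \<alpha> p D" using \<alpha> by blast
  have "\<alpha> = \<theta>"
  proof (rule ccontr)
    assume ne: "\<alpha> \<noteq> \<theta>"
    have "C \<alpha>" "\<theta> \<subset> \<alpha>" using ne \<alpha> by auto
    from step[OF a this] obtain \<beta> q \<rho> where
      \<beta>: "congruence A {binop s} \<beta>" "C \<beta>" "\<theta> \<subseteq> \<beta>" "\<beta> \<subset> \<alpha>" and st: "central_step A s \<alpha> \<beta> q \<rho>"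
      by (elim exE conjE)
    have "\<exists>D. bounded_degree s P \<beta> p D"
    proof (cases "q = p")
      case True
      show ?thesis
        by (rule bounded_degree_same_prime[OF a \<beta>(1) st[unfolded True] PA Pcl D]) assumption+
    next
      case False
      have q: "q dvd Suc N"
        by (rule N[OF central_stepD(2)[OF st] False central_prime_dvd[OF \<beta>(1) st]])
      have "bounded_degree s P \<beta> p D"
        by (rule bounded_degree_other_prime[OF \<beta>(1) st \<beta>(3) q P D])
      then show ?thesis by blast
    qed
    with \<beta> show False using min[rule_format, OF \<beta>(1)] by blast
  qed
  then show ?thesis using D by blast
qed

lemma ldiv_central:
  assumes \<beta>: "congruence A {binop s} \<beta>" and \<sigma>: "central_map A s \<beta> \<sigma>" and ab: "a \<in> A" "b \<in> A"
  shows "(ldiv (\<sigma> a) (\<sigma> b), ldiv a b) \<in> \<beta>"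
proof -
  note d = central_mapD[OF \<sigma>]
  have "(\<sigma> (s a (ldiv a b)), s (\<sigma> a) (ldiv a b)) \<in> \<beta>" by (rule d(3)) (use ab ldiv_in in auto)
  then have "(s (\<sigma> a) (ldiv (\<sigma> a) (\<sigma> b)), s (\<sigma> a) (ldiv a b)) \<in> \<beta>"
    using ab d(1) by (simp add: mult_ldiv)
  then show ?thesis by (rule congr_left_cancel[OF \<beta>]) (use ab d(1) ldiv_in in auto)
qed

text \<open>The failure of the power map to be a homomorphism.\<close>

definition defect :: "nat \<Rightarrow> 'a \<Rightarrow> 'a \<Rightarrow> 'a" where
  "defect N x y = ldiv (right_power N (s x y)) (s (right_power N x) (right_power N y))"

text \<open>The power map preserves central factors of order \<open>p\<close>, so multiplying the product by its defect
  multiplies the power of the product by the same defect, which turns it into the product of the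
  powers.\<close>

definition straightened :: "nat \<Rightarrow> 'a \<Rightarrow> 'a \<Rightarrow> 'a" where
  "straightened N x y = s (s x y) (defect N x y)"

lemma defect_in: "x \<in> A \<Longrightarrow> y \<in> A \<Longrightarrow> defect N x y \<in> A"
  by (simp add: defect_def ldiv_in right_power_in closed)

lemma straightened_in: "x \<in> A \<Longrightarrow> y \<in> A \<Longrightarrow> straightened N x y \<in> A"
  by (simp add: straightened_def defect_in closed)

lemma straightened_derived: "straightened N \<in> derived s"
proof -
  note l = derived.left[of s] and r = derived.right[of s]
  have "defect N \<in> derived s"
    unfolding defect_def[abs_def]
    by (intro derived_derived[OF ldiv_derived derived_self] right_power_derived derived.comp right_power_derived l r)
  then show ?thesis unfolding straightened_def[abs_def] by (intro derived.comp l r)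
qed

lemma straightened_unit: "x \<in> A \<Longrightarrow> straightened N u x = x" "x \<in> A \<Longrightarrow> straightened N x u = x"
  by (simp_all add: straightened_def defect_def right_power_unit left_unit right_unit right_power_in unit_in ldiv_self)

text \<open>Moving \<open>x\<close> by \<open>\<sigma>\<close> moves both sides of the defect by \<open>\<sigma>\<close> to the power \<open>N + 1\<close>, hence leaves the
  defect unchanged.\<close>

lemma straightened_central_map:
  assumes \<beta>: "congruence A {binop s} \<beta>" and \<sigma>: "central_map A s \<beta> \<sigma>"
  shows "central_map A (straightened N) \<beta> \<sigma>"
proof -
  note b = congrD[OF \<beta>] and d = central_mapD[OF \<sigma>]
  let ?\<tau> = "\<sigma> ^^ Suc N"
  have \<tau>: "central_map A s \<beta> ?\<tau>" by (rule central_map_iterate[OF \<beta> \<sigma>])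
  note t = central_mapD[OF \<tau>]
  have ld: "(ldiv x y, ldiv x' y') \<in> \<beta>" if "(x, x') \<in> \<beta>" "(y, y') \<in> \<beta>" for x y x' y'
    by (rule congrD(5)[OF congr_derived[OF \<beta> ldiv_derived] that])
  have key: "(\<sigma> (s w (ldiv (right_power N w) z)), s w' (ldiv (right_power N w') z')) \<in> \<beta>"
    if w: "w \<in> A" "z \<in> A" "(\<sigma> w, w') \<in> \<beta>" "(?\<tau> z, z') \<in> \<beta>" for w z w' z'
  proof -
    let ?d = "ldiv (right_power N w) z"
    have dA: "?d \<in> A" using w by (simp add: ldiv_in right_power_in)
    have "(right_power N w', ?\<tau> (right_power N w)) \<in> \<beta>"
      using b(4)[OF right_power_cong[OF \<beta> b(3)[OF w(3)]] right_power_central[OF \<beta> \<sigma> w(1)]] .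
    then have "(ldiv (right_power N w') z', ldiv (?\<tau> (right_power N w)) (?\<tau> z)) \<in> \<beta>"
      using ld b(3)[OF w(4)] by blast
    then have 1: "(?d, ldiv (right_power N w') z') \<in> \<beta>"
      using ldiv_central[OF \<beta> \<tau> right_power_in[OF w(1)] w(2)] b(3,4) by meson
    have "(\<sigma> (s w ?d), s (\<sigma> w) ?d) \<in> \<beta>" by (rule d(3)[OF w(1) dA])
    moreover have "(s (\<sigma> w) ?d, s w' (ldiv (right_power N w') z')) \<in> \<beta>" by (rule b(5)[OF w(3) 1])
    ultimately show ?thesis by (rule b(4))
  qed
  show ?thesis
    unfolding central_map_def
  proof (intro conjI ballI allI impI)
    fix x y assume xy: "x \<in> A" "y \<in> A"
    have p: "right_power N x \<in> A" "right_power N y \<in> A" using xy right_power_in by auto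
    have zA: "s (right_power N x) (right_power N y) \<in> A" using p closed by simp
    have "(?\<tau> (s (right_power N x) (right_power N y)), s (right_power N (\<sigma> x)) (right_power N y)) \<in> \<beta>"
      by (rule b(4)[OF t(3)[OF p] b(5)[OF b(3)[OF right_power_central[OF \<beta> \<sigma> xy(1)]] b(2)[OF p(2)]]])
    from key[OF closed[OF xy] zA d(3)[OF xy] this]
    show "(\<sigma> (straightened N x y), straightened N (\<sigma> x) y) \<in> \<beta>" unfolding straightened_def defect_def .
    have "(?\<tau> (s (right_power N x) (right_power N y)), s (right_power N x) (right_power N (\<sigma> y))) \<in> \<beta>"
      by (rule b(4)[OF t(4)[OF p] b(5)[OF b(2)[OF p(1)] b(3)[OF right_power_central[OF \<beta> \<sigma> xy(2)]]]])
    from key[OF closed[OF xy] zA d(4)[OF xy] this]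
    show "(\<sigma> (straightened N x y), straightened N x (\<sigma> y)) \<in> \<beta>" unfolding straightened_def defect_def .
  qed (use d(1,2) in auto)
qed

lemma straightened_central_step:
  assumes "congruence A {binop s} \<beta>" "central_step A s \<alpha> \<beta> p \<rho>"
  shows "central_step A (straightened N) \<alpha> \<beta> p \<rho>"
  using straightened_central_map[OF assms(1) central_stepD(3)[OF assms(2)]] assms(2)
  by (simp add: central_step_def)

text \<open>If \<open>f\<close> is a translation of \<open>t\<close> with \<open>f x = f y\<close>, consider a minimal congruence that relates
  \<open>x\<close> and \<open>y\<close>. Across the central step below it, \<open>x\<close> is \<open>y\<close> moved by some \<open>\<rho>\<^sup>i\<close>, and so \<open>f x\<close> is
  \<open>f y\<close> moved by the same \<open>\<rho>\<^sup>i\<close>. Thus \<open>\<rho>\<^sup>i\<close> is trivial, and a smaller congruence relates \<open>x\<close> and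
  \<open>y\<close>.\<close>

lemma finite_loop_if_central_maps:
  assumes t: "t \<in> derived s" and tA: "\<And>x y. x \<in> A \<Longrightarrow> y \<in> A \<Longrightarrow> t x y \<in> A"
    and tu: "\<And>x. x \<in> A \<Longrightarrow> t u x = x" "\<And>x. x \<in> A \<Longrightarrow> t x u = x"
    and tc: "\<And>\<beta> \<sigma>. congruence A {binop s} \<beta> \<Longrightarrow> central_map A s \<beta> \<sigma> \<Longrightarrow> central_map A t \<beta> \<sigma>"
    and step: "\<And>\<alpha>. \<lbrakk>congruence A {binop s} \<alpha>; C \<alpha>; Id_on A \<subset> \<alpha>\<rbrakk> \<Longrightarrow>
      \<exists>\<beta> q \<rho>. congruence A {binop s} \<beta> \<and> C \<beta> \<and> \<beta> \<subset> \<alpha> \<and> central_step A s \<alpha> \<beta> q \<rho>"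
    and C: "C (A \<times> A)"
  shows "finite_loop A t u"
proof -
  have main: "x = y" if xy: "x \<in> A" "y \<in> A" and f: "f x = f y" "\<And>z. z \<in> A \<Longrightarrow> f z \<in> A"
    "\<And>\<beta> z z'. congruence A {binop s} \<beta> \<Longrightarrow> (z, z') \<in> \<beta> \<Longrightarrow> (f z, f z') \<in> \<beta>"
    "\<And>\<beta> \<sigma> z. congruence A {binop s} \<beta> \<Longrightarrow> central_map A s \<beta> \<sigma> \<Longrightarrow> z \<in> A \<Longrightarrow> (\<sigma> (f z), f (\<sigma> z)) \<in> \<beta>"
    for x y f
  proof (rule ccontr)
    assume "x \<noteq> y"
    have "C (A \<times> A) \<and> (x, y) \<in> A \<times> A" using C xy by simp
    then obtain \<alpha> where "congruence A {binop s} \<alpha>" "C \<alpha> \<and> (x, y) \<in> \<alpha>"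
      and min: "\<forall>\<beta>. congruence A {binop s} \<beta> \<longrightarrow> C \<beta> \<and> (x, y) \<in> \<beta> \<longrightarrow> \<not> \<beta> \<subset> \<alpha>"
      by (rule exists_minimal_congruence[OF fin total_congruence, where Q = "\<lambda>\<alpha>. C \<alpha> \<and> (x, y) \<in> \<alpha>"])
    then have a: "congruence A {binop s} \<alpha>" "C \<alpha>" "(x, y) \<in> \<alpha>" by auto
    have "Id_on A \<subseteq> \<alpha>" using congrD(2)[OF a(1)] by auto
    then have "Id_on A \<subset> \<alpha>" using a(3) \<open>x \<noteq> y\<close> by auto
    from step[OF a(1,2) this] obtain \<beta> q \<rho> where
      \<beta>: "congruence A {binop s} \<beta>" "C \<beta>" "\<beta> \<subset> \<alpha>" and st: "central_step A s \<alpha> \<beta> q \<rho>"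
      by (elim exE conjE)
    note b = congrD[OF \<beta>(1)]
    obtain i where i: "(x, (\<rho> ^^ i) y) \<in> \<beta>" using central_stepD(5)[OF st a(3)] by blast
    have "((\<rho> ^^ i) (f y), f ((\<rho> ^^ i) y)) \<in> \<beta>"
      by (rule f(4)[OF \<beta>(1) central_map_iterate[OF \<beta>(1) central_stepD(3)[OF st]] xy(2)])
    moreover have "(f ((\<rho> ^^ i) y), f x) \<in> \<beta>" using f(3)[OF \<beta>(1) b(3)[OF i]] .
    ultimately have "((\<rho> ^^ i) (f y), f y) \<in> \<beta>" using b(4) f(1) by metis
    then have "q dvd i" using central_stepD(6)[OF st f(2)[OF xy(2)]] by simp
    then have "((\<rho> ^^ i) y, y) \<in> \<beta>" using central_stepD(6)[OF st xy(2)] by simp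
    then have "(x, y) \<in> \<beta>" by (rule b(4)[OF i])
    then show False using min[rule_format, OF \<beta>(1)] \<beta>(2,3) by simp
  qed
  have ct: "congruence A {binop t} \<beta>" if "congruence A {binop s} \<beta>" for \<beta>
    using congr_derived[OF that t] .
  show ?thesis
  proof
    show "x = y" if "a \<in> A" "x \<in> A" "y \<in> A" "t a x = t a y" for a x y
      by (rule main[of x y "t a"])
        (use that tA central_mapD(4)[OF tc] congrD(5)[OF ct congrD(2)] in auto)
    show "x = y" if "a \<in> A" "x \<in> A" "y \<in> A" "t x a = t y a" for a x y
      by (rule main[of x y "\<lambda>z. t z a"])
        (use that tA central_mapD(3)[OF tc] congrD(5)[OF ct _ congrD(2)] in auto)
  qed (use fin unit_in tA tu in auto)
qed

text \<open>The last two corners of a cube are compared modulo \<open>\<theta>\<close>, where the straightened product agrees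
  with \<open>s\<close>, and after applying the power map, which turns the cube into one of \<open>s\<close> inside the
  subloop of fixed points modulo \<open>\<theta>\<close>, where functions have bounded degree. Together, the two
  comparisons determine the corner modulo \<open>\<eta>\<close>.\<close>

lemma straightened_term_cond:
  assumes \<theta>: "congruence A {binop s} \<theta>" and \<eta>: "congruence A {binop s} \<eta>"
    and st: "central_step A s \<theta> \<eta> p \<rho>"
    and tc: "term_cond A s (\<lambda>_. A \<times> A) k \<theta>"
    and N: "p dvd N" "fact (card A) dvd N * Suc N"
      "\<And>j. 2 \<le> j \<Longrightarrow> j \<le> k \<Longrightarrow> fact (card A) dvd (Suc N choose j)"
    and bd: "\<exists>D. bounded_degree s {x \<in> A. (right_power N x, x) \<in> \<theta>} \<theta> p D"
  shows "\<And>x y. x \<in> A \<Longrightarrow> y \<in> A \<Longrightarrow> (straightened N x y, s x y) \<in> \<theta>"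
    and "\<exists>k'. term_cond A (straightened N) (\<lambda>_. A \<times> A) k' \<eta>"
proof -
  note t = congrD[OF \<theta>] and h = congrD[OF \<eta>]
  note d = central_mapD[OF central_map_iterate[OF \<eta> central_stepD(3)[OF st]]]
  have E: "(s (right_power N x) (right_power N y), right_power N (s x y)) \<in> \<theta>" if "x \<in> A" "y \<in> A" for x y
    by (rule right_power_hom_idem(1)[OF \<theta> tc _ N(2) that]) (rule N(3))
  have EE: "(right_power N (right_power N x), right_power N x) \<in> \<theta>" if "x \<in> A" for x
    by (rule right_power_hom_idem(2)[OF \<theta> tc _ N(2) that]) (rule N(3))
  let ?P = "{x \<in> A. (right_power N x, x) \<in> \<theta>}" and ?E = "right_power N"
  have defect\<theta>: "(defect N x y, u) \<in> \<theta>" if "x \<in> A" "y \<in> A" for x y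
  proof -
    have "(defect N x y, ldiv (?E (s x y)) (?E (s x y))) \<in> \<theta>"
      unfolding defect_def
      by (rule congrD(5)[OF congr_derived[OF \<theta> ldiv_derived] t(2) E])
        (use that closed right_power_in in auto)
    then show ?thesis using that by (simp add: ldiv_self closed right_power_in)
  qed
  show tw\<theta>: "(straightened N x y, s x y) \<in> \<theta>" if "x \<in> A" "y \<in> A" for x y
  proof -
    have "(straightened N x y, s (s x y) u) \<in> \<theta>"
      unfolding straightened_def by (rule t(5)[OF t(2) defect\<theta>]) (use that closed in auto)
    then show ?thesis using that by (simp add: right_unit closed)
  qed
  have n1: "((\<rho> ^^ (i * Suc N)) z, (\<rho> ^^ i) z) \<in> \<eta>" if "z \<in> A" for i z
    using N(1) by (simp add: central_iterate_iff[OF \<eta> st that] cong_altdef_nat)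
  have E\<rho>: "(?E ((\<rho> ^^ i) z), (\<rho> ^^ i) (?E z)) \<in> \<eta>" if "z \<in> A" for i z
  proof -
    have "(?E ((\<rho> ^^ i) z), ((\<rho> ^^ i) ^^ Suc N) (?E z)) \<in> \<eta>"
      by (rule right_power_central[OF \<eta> central_map_iterate[OF \<eta> central_stepD(3)[OF st]] that])
    then have "(?E ((\<rho> ^^ i) z), (\<rho> ^^ (i * Suc N)) (?E z)) \<in> \<eta>" by (simp only: funpow_mult mult.commute)
    then show ?thesis using n1[OF right_power_in[OF that]] by (rule h(4))
  qed
  \<comment> \<open>Modulo \<open>\<eta>\<close> the defect is a power of the central generator, which the power map preserves.\<close>
  have hom: "(?E (straightened N x y), s (?E x) (?E y)) \<in> \<eta>" if xy: "x \<in> A" "y \<in> A" for x y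
  proof -
    let ?w = "s x y" and ?d = "defect N x y"
    have A: "?w \<in> A" "?d \<in> A" "?E ?w \<in> A" "?E x \<in> A" "?E y \<in> A"
      using xy closed defect_in right_power_in by auto
    obtain j where j: "(?d, (\<rho> ^^ j) u) \<in> \<eta>" using central_stepD(5)[OF st defect\<theta>[OF xy]] by blast
    have shift: "(s z ?d, (\<rho> ^^ j) z) \<in> \<eta>" if z: "z \<in> A" for z
    proof -
      have "(s z ?d, s z ((\<rho> ^^ j) u)) \<in> \<eta>" by (rule h(5)[OF h(2)[OF z] j])
      moreover have "((\<rho> ^^ j) (s z u), s z ((\<rho> ^^ j) u)) \<in> \<eta>" by (rule d(4)[OF z unit_in])
      ultimately show ?thesis using h(3,4) right_unit[OF z] by metis
    qed
    have "(?E (straightened N x y), ?E ((\<rho> ^^ j) ?w)) \<in> \<eta>"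
      unfolding straightened_def by (rule right_power_cong[OF \<eta> shift[OF A(1)]])
    moreover have "(?E ((\<rho> ^^ j) ?w), (\<rho> ^^ j) (?E ?w)) \<in> \<eta>" by (rule E\<rho>[OF A(1)])
    moreover have "((\<rho> ^^ j) (?E ?w), s (?E ?w) ?d) \<in> \<eta>" by (rule h(3)[OF shift[OF A(3)]])
    moreover have "s (?E ?w) ?d = s (?E x) (?E y)"
      unfolding defect_def using A closed by (simp add: mult_ldiv)
    ultimately show ?thesis using h(4) by metis
  qed
  have PE: "?E x \<in> ?P" if "x \<in> A" for x using that EE right_power_in by simp
  have Pcl: "s x y \<in> ?P" if "x \<in> ?P" "y \<in> ?P" for x y
    using right_power_fixed_mult[OF \<theta> E] that closed by blast
  obtain D where "bounded_degree s ?P \<theta> p D" using bd by blast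
  then obtain D' where D': "bounded_degree s ?P \<eta> p D'"
    using bounded_degree_same_prime[OF \<theta> \<eta> st, of ?P D] Pcl by auto
  define K where "K = max k D'"
  have tcK: "term_cond A s (\<lambda>_. A \<times> A) K \<theta>" by (rule term_cond_mono[OF tc]) (simp add: K_def)
  have "term_cond A (straightened N) (\<lambda>_. A \<times> A) K \<eta>"
    unfolding term_cond_def
  proof (intro ballI impI)
    fix F assume F: "F \<in> cubes A (straightened N) (\<lambda>_. A \<times> A)"
      and prem: "\<forall>S. S \<subset> {..<K} \<longrightarrow> (F S, F (insert K S)) \<in> \<eta>"
    have FA: "F S \<in> A" if "F \<in> cubes A (straightened N) (\<lambda>_. A \<times> A)" for F S
      using cubes_in[OF that straightened_in] by simp
    have "\<exists>G \<in> cubes A s (\<lambda>_. A \<times> A). \<forall>S. (F S, G S) \<in> \<theta>"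
      using F
    proof induction
      case (const a)
      show ?case by (rule bexI[OF _ cubes.const[OF const]]) (use const t(2) in simp)
    next
      case (edge a b i)
      show ?case
        by (rule bexI[OF _ cubes.edge[where R = "\<lambda>_. A \<times> A" and i = i, OF edge]]) (use edge t(2) in simp)
    next
      case (mult F1 F2)
      obtain G1 G2 where G: "G1 \<in> cubes A s (\<lambda>_. A \<times> A)" "\<And>S. (F1 S, G1 S) \<in> \<theta>"
        "G2 \<in> cubes A s (\<lambda>_. A \<times> A)" "\<And>S. (F2 S, G2 S) \<in> \<theta>" using mult.IH by blast
      have "(straightened N (F1 S) (F2 S), s (G1 S) (G2 S)) \<in> \<theta>" for S
        using t(4)[OF tw\<theta> t(5)[OF G(2,4)]] FA mult.hyps by blast
      then show ?case by (intro bexI[OF _ cubes.mult[OF G(1,3)]] allI)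
    qed
    then obtain G where G: "G \<in> cubes A s (\<lambda>_. A \<times> A)" "\<And>S. (F S, G S) \<in> \<theta>" by blast
    have "(G {..<K}, G (insert K {..<K})) \<in> \<theta>"
    proof (rule term_condD[OF tcK G(1)])
      fix S assume "S \<subset> {..<K}"
      then have "(F S, F (insert K S)) \<in> \<theta>" using prem central_stepD(1)[OF st] by blast
      then show "(G S, G (insert K S)) \<in> \<theta>" using t(4)[OF t(3)[OF G(2)] t(4)[OF _ G(2)]] by blast
    qed
    then have F\<theta>: "(F {..<K}, F (insert K {..<K})) \<in> \<theta>"
      using t(4)[OF G(2) t(4)[OF _ t(3)[OF G(2)]]] by blast
    have "\<exists>H \<in> cubes ?P s (\<lambda>_. ?P \<times> ?P). \<forall>S. (?E (F S), H S) \<in> \<eta>"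
      using F
    proof induction
      case (const a)
      show ?case by (rule bexI[OF _ cubes.const[OF PE[OF const]]]) (use const h(2) right_power_in in simp)
    next
      case (edge a b i)
      then have ab: "a \<in> A" "b \<in> A" by auto
      then have "(?E a, ?E b) \<in> ?P \<times> ?P" using PE by blast
      from cubes.edge[where R = "\<lambda>_. ?P \<times> ?P" and i = i, OF this]
      show ?case by (rule bexI[rotated]) (use ab h(2) right_power_in in simp)
    next
      case (mult F1 F2)
      obtain H1 H2 where H: "H1 \<in> cubes ?P s (\<lambda>_. ?P \<times> ?P)" "\<And>S. (?E (F1 S), H1 S) \<in> \<eta>"
        "H2 \<in> cubes ?P s (\<lambda>_. ?P \<times> ?P)" "\<And>S. (?E (F2 S), H2 S) \<in> \<eta>" using mult.IH by blast
      have "(?E (straightened N (F1 S) (F2 S)), s (H1 S) (H2 S)) \<in> \<eta>" for S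
        using h(4)[OF hom h(5)[OF H(2,4)]] FA mult.hyps by blast
      then show ?case by (intro bexI[OF _ cubes.mult[OF H(1,3)]] allI)
    qed
    then obtain H where H: "H \<in> cubes ?P s (\<lambda>_. ?P \<times> ?P)" "\<And>S. (?E (F S), H S) \<in> \<eta>" by blast
    \<comment> \<open>The alternating sum of this indicator over the whole cube vanishes modulo \<open>p\<close>; by the premises, all pairs
    of neighbours in direction \<open>K\<close> cancel, except for the last pair.\<close>
    define \<chi> where "\<chi> x = (of_bool ((x, H {..<K}) \<in> \<eta>) :: int)" for x
    have \<chi>: "\<chi> x = \<chi> y" if "(x, y) \<in> \<eta>" for x y
    proof -
      have "(x, H {..<K}) \<in> \<eta> \<longleftrightarrow> (y, H {..<K}) \<in> \<eta>" using h(3,4) that by meson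
      then show ?thesis by (simp add: \<chi>_def)
    qed
    have "degree_at_most p D' (\<lambda>S. \<chi> (H S))" by (rule bounded_degreeD[OF D' H(1) \<chi>])
    then have alt: "[(\<Sum>S\<in>Pow {..<Suc K}. (-1) ^ card S * \<chi> (H S)) = 0] (mod int p)"
      by (rule degree_alternating_sum) (simp_all add: K_def)
    have "(\<Sum>S\<in>Pow {..<Suc K}. (-1) ^ card S * \<chi> (H S)) =
      (\<Sum>S\<in>Pow {..<K}. (-1) ^ card S * \<chi> (H S)) + (\<Sum>S\<in>insert K ` Pow {..<K}. (-1) ^ card S * \<chi> (H S))"
      unfolding lessThan_Suc Pow_insert by (rule sum.union_disjoint) auto
    also have "(\<Sum>S\<in>insert K ` Pow {..<K}. (-1) ^ card S * \<chi> (H S)) =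
      (\<Sum>S\<in>Pow {..<K}. - ((-1) ^ card S * \<chi> (H (insert K S))))"
    proof (rule sum.reindex_cong[where l = "insert K"])
      show "inj_on (insert K) (Pow {..<K})" by (auto intro!: inj_onI)
      fix S assume "S \<in> Pow {..<K}"
      then have "K \<notin> S" "finite S" using finite_subset by auto
      then show "(-1) ^ card (insert K S) * \<chi> (H (insert K S)) = - ((-1) ^ card S * \<chi> (H (insert K S)))"
        by simp
    qed simp
    also have "(\<Sum>S\<in>Pow {..<K}. (-1) ^ card S * \<chi> (H S)) + \<dots> =
      (\<Sum>S\<in>Pow {..<K}. (-1) ^ card S * (\<chi> (H S) - \<chi> (H (insert K S))))"
      by (simp add: sum_negf sum_subtractf right_diff_distrib)
    also have "\<dots> = (\<Sum>S\<in>{{..<K}}. (-1) ^ card S * (\<chi> (H S) - \<chi> (H (insert K S))))"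
    proof (rule sum.mono_neutral_right)
      show "\<forall>S\<in>Pow {..<K} - {{..<K}}. (-1) ^ card S * (\<chi> (H S) - \<chi> (H (insert K S))) = 0"
      proof
        fix S assume "S \<in> Pow {..<K} - {{..<K}}"
        then have "(F S, F (insert K S)) \<in> \<eta>" using prem by blast
        then have "(H S, H (insert K S)) \<in> \<eta>"
          using h(4)[OF h(3)[OF H(2)] h(4)[OF right_power_cong[OF \<eta>] H(2)]] by blast
        then show "(-1) ^ card S * (\<chi> (H S) - \<chi> (H (insert K S))) = 0" using \<chi> by simp
      qed
    qed auto
    finally have "[(-1) ^ K * (\<chi> (H {..<K}) - \<chi> (H (insert K {..<K}))) = 0] (mod int p)" using alt by simp
    then have "int p dvd (-1) ^ K * (\<chi> (H {..<K}) - \<chi> (H (insert K {..<K})))" by (simp add: cong_0_iff)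
    moreover have "(-1) ^ K = (1::int) \<or> (-1) ^ K = (-1::int)" by (simp add: minus_one_power_iff)
    ultimately have dv: "int p dvd \<chi> (H {..<K}) - \<chi> (H (insert K {..<K}))"
      by (auto simp: dvd_diff_commute)
    have HP: "H S \<in> A" for S using cubes_in[OF H(1) Pcl] by auto
    have "\<chi> (H {..<K}) = 1" unfolding \<chi>_def using h(2)[OF HP] by simp
    moreover have "\<not> int p dvd 1" using prime_gt_1_nat[OF central_stepD(2)[OF st]] by simp
    ultimately have "\<chi> (H (insert K {..<K})) \<noteq> 0" using dv by auto
    then have "(H (insert K {..<K}), H {..<K}) \<in> \<eta>" unfolding \<chi>_def by (auto split: if_splits)
    then have E\<eta>: "(?E (F (insert K {..<K})), ?E (F {..<K})) \<in> \<eta>"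
      using h(4)[OF H(2) h(4)[OF _ h(3)[OF H(2)]]] by blast
    obtain i where i: "(F (insert K {..<K}), (\<rho> ^^ i) (F {..<K})) \<in> \<eta>"
      using central_stepD(5)[OF st t(3)[OF F\<theta>]] by blast
    have "((\<rho> ^^ i) (?E (F {..<K})), ?E ((\<rho> ^^ i) (F {..<K}))) \<in> \<eta>"
      by (rule h(3)[OF E\<rho>[OF FA[OF F]]])
    then have "((\<rho> ^^ i) (?E (F {..<K})), ?E (F {..<K})) \<in> \<eta>"
      using h(4)[OF h(4)[OF _ right_power_cong[OF \<eta> h(3)[OF i]]] E\<eta>] by blast
    then have "p dvd i" using central_stepD(6)[OF st right_power_in[OF FA[OF F]]] by simp
    then have "((\<rho> ^^ i) (F {..<K}), F {..<K}) \<in> \<eta>" using central_stepD(6)[OF st FA[OF F]] by simp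
    then show "(F {..<K}, F (insert K {..<K})) \<in> \<eta>" using h(3)[OF h(4)[OF i]] by blast
  qed
  then show "\<exists>k'. term_cond A (straightened N) (\<lambda>_. A \<times> A) k' \<eta>" by blast
qed

end

section \<open>Term equivalence and the descent to equality\<close>

lemma term_ops_restrict: "f \<in> term_ops A F n \<Longrightarrow> restrict f (tuples A n) = f"
  by (induction rule: term_ops.induct) (simp_all add: restrict_def fun_eq_iff)

lemma term_ops_in:
  assumes "algebra_on A F" "f \<in> term_ops A F n" "xs \<in> tuples A n"
  shows "f xs \<in> A"
  using assms(2)
proof induction
  case (proj i)
  then show ?case using assms(3) by (auto simp: tuples_def)
next
  case (comp k f gs)
  have "map (\<lambda>g. g xs) gs \<in> tuples A k" using comp by (auto simp: tuples_def)
  then show ?case using comp assms(1,3) by (auto simp: algebra_on_def)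
qed

lemma term_ops_binop:
  assumes "binop m \<in> F" "f \<in> term_ops A F n" "g \<in> term_ops A F n"
  shows "restrict (\<lambda>xs. m (f xs) (g xs)) (tuples A n) \<in> term_ops A F n"
  using term_ops.comp[of 2 "\<lambda>xs. m (xs ! 0) (xs ! 1)" F "[f, g]" A n] assms by (simp add: binop_def)

lemma term_ops_derived:
  assumes "binop m \<in> F" "t \<in> derived m" "f \<in> term_ops A F n" "g \<in> term_ops A F n"
  shows "restrict (\<lambda>xs. t (f xs) (g xs)) (tuples A n) \<in> term_ops A F n"
proof -
  let ?X = "{h. restrict h (tuples A n) \<in> term_ops A F n}"
  have "(\<lambda>xs. m (h xs) (k xs)) \<in> ?X" if "h \<in> ?X" "k \<in> ?X" for h k
    using term_ops_binop[OF assms(1), of "restrict h (tuples A n)" A n "restrict k (tuples A n)"] that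
    by (simp cong: restrict_cong)
  then have "(\<lambda>xs. t (f xs) (g xs)) \<in> ?X"
    by (rule derived_closed[OF assms(2)]) (use assms(3,4) in \<open>simp_all add: term_ops_restrict\<close>)
  then show ?thesis by simp
qed

lemma binop_term_ops_subset:
  assumes "\<And>t f g. \<lbrakk>t \<in> T; f \<in> term_ops A G n; g \<in> term_ops A G n\<rbrakk> \<Longrightarrow>
    restrict (\<lambda>xs. t (f xs) (g xs)) (tuples A n) \<in> term_ops A G n"
  shows "term_ops A (binop ` T) n \<subseteq> term_ops A G n"
proof
  fix h assume "h \<in> term_ops A (binop ` T) n"
  then show "h \<in> term_ops A G n"
  proof induction
    case (proj i)
    then show ?case by (rule term_ops.proj)
  next
    case (comp k f gs)
    then obtain t where t: "t \<in> T" "k = 2" "f = (\<lambda>xs. t (xs ! 0) (xs ! 1))" by (auto simp: binop_def)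
    then obtain g1 g2 where "gs = [g1, g2]" using comp(2)
      by (auto simp: numeral_2_eq_2 length_Suc_conv)
    then show ?case using comp(3) assms[OF t(1), of g1 g2] t by (simp add: restrict_def)
  qed
qed

text \<open>As \<open>s\<close> and \<open>r\<close> are term functions of \<open>m\<close>, only the recovery of \<open>m\<close> from them needs an
  argument, and that is \<open>eq\<close>.\<close>

lemma term_equivalent_binops:
  assumes m: "\<And>x y. x \<in> A \<Longrightarrow> y \<in> A \<Longrightarrow> m x y \<in> A"
    and sr: "s \<in> derived m" "r \<in> derived m"
    and eq: "\<And>x y. x \<in> A \<Longrightarrow> y \<in> A \<Longrightarrow> m x y = s (s x y) (r x y)"
  shows "term_equivalent A {binop m} {binop s, binop r}"
  unfolding term_equivalent_def
proof
  fix n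
  let ?M = "{binop m}" and ?S = "{binop s, binop r}"
  have "term_ops A (binop ` {s, r}) n \<subseteq> term_ops A ?M n"
    by (rule binop_term_ops_subset) (use sr in \<open>auto intro: term_ops_derived[of m]\<close>)
  then have sub: "term_ops A ?S n \<subseteq> term_ops A ?M n" by simp
  have inA: "f xs \<in> A" if "f \<in> term_ops A ?S n" "xs \<in> tuples A n" for f xs
    using term_ops_in[of A ?M f n xs] sub that m by (auto simp: algebra_on_binop)
  have "restrict (\<lambda>xs. m (f xs) (g xs)) (tuples A n) \<in> term_ops A ?S n"
    if f: "f \<in> term_ops A ?S n" "g \<in> term_ops A ?S n" for f g
  proof -
    let ?s = "restrict (\<lambda>xs. s (f xs) (g xs)) (tuples A n)"
    let ?r = "restrict (\<lambda>xs. r (f xs) (g xs)) (tuples A n)"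
    have "restrict (\<lambda>xs. s (?s xs) (?r xs)) (tuples A n) \<in> term_ops A ?S n"
      using f by (intro term_ops_binop) auto
    moreover have "restrict (\<lambda>xs. s (?s xs) (?r xs)) (tuples A n) =
        restrict (\<lambda>xs. m (f xs) (g xs)) (tuples A n)"
      by (rule restrict_ext) (use inA f eq in simp)
    ultimately show ?thesis by simp
  qed
  then have "term_ops A (binop ` {m}) n \<subseteq> term_ops A ?S n"
    by (intro binop_term_ops_subset) simp
  then show "term_ops A ?M n = term_ops A ?S n" using sub by simp
qed

text \<open>Choose \<open>\<theta>\<close> minimal such that some term function \<open>s\<close> of \<open>m\<close> is a loop multiplication that
  agrees with \<open>m\<close> modulo \<open>\<theta>\<^sub>0\<close> and is supernilpotent modulo \<open>\<theta>\<close>. If \<open>\<theta>\<close> were not equality,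
  straightening \<open>s\<close> across a central step below \<open>\<theta>\<close> would give a smaller one. The central steps
  of \<open>m\<close> are carried along: that they are central steps of \<open>s\<close> as well replaces the nilpotence
  of \<open>s\<close>.\<close>

lemma exists_supernilpotent_derived_loop:
  assumes m: "finite_loop A m u" and nil: "nilpotent A {binop m}"
    and \<theta>\<^sub>0: "congruence A {binop m} \<theta>\<^sub>0" and tc\<^sub>0: "term_cond A m (\<lambda>_. A \<times> A) k\<^sub>0 \<theta>\<^sub>0"
  obtains s k where "s \<in> derived m" "finite_loop A s u" "term_cond A s (\<lambda>_. A \<times> A) k (Id_on A)"
    "\<And>x y. x \<in> A \<Longrightarrow> y \<in> A \<Longrightarrow> (s x y, m x y) \<in> \<theta>\<^sub>0"
proof -
  interpret m: finite_loop A m u by (rule m)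
  define inherits where "inherits s \<longleftrightarrow> (\<forall>\<alpha> \<beta> p \<rho>. congruence A {binop m} \<beta> \<longrightarrow>
      central_step A m \<alpha> \<beta> p \<rho> \<longrightarrow> central_step A s \<alpha> \<beta> p \<rho>)" for s
  define good where "good \<theta> s \<longleftrightarrow> s \<in> derived m \<and> finite_loop A s u \<and> inherits s \<and>
      (\<exists>k. term_cond A s (\<lambda>_. A \<times> A) k \<theta>) \<and> (\<forall>x\<in>A. \<forall>y\<in>A. (s x y, m x y) \<in> \<theta>\<^sub>0)" for \<theta> s
  have "\<theta>\<^sub>0 \<subseteq> \<theta>\<^sub>0 \<and> (\<exists>s. good \<theta>\<^sub>0 s)"
  proof -
    have "good \<theta>\<^sub>0 m"
      using m tc\<^sub>0 congrD(2)[OF \<theta>\<^sub>0] m.closed by (auto simp: good_def inherits_def derived_self)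
    then show ?thesis by blast
  qed
  then obtain \<theta> where \<theta>: "congruence A {binop m} \<theta>" and ex: "\<theta> \<subseteq> \<theta>\<^sub>0 \<and> (\<exists>s. good \<theta> s)"
    and min: "\<forall>\<beta>. congruence A {binop m} \<beta> \<longrightarrow> \<beta> \<subseteq> \<theta>\<^sub>0 \<and> (\<exists>s. good \<beta> s) \<longrightarrow> \<not> \<beta> \<subset> \<theta>"
    by (rule exists_minimal_congruence[OF m.fin \<theta>\<^sub>0, where Q = "\<lambda>\<theta>. \<theta> \<subseteq> \<theta>\<^sub>0 \<and> (\<exists>s. good \<theta> s)"])
  from ex obtain s k where s: "s \<in> derived m" "finite_loop A s u" "inherits s"
    "term_cond A s (\<lambda>_. A \<times> A) k \<theta>" "\<And>x y. x \<in> A \<Longrightarrow> y \<in> A \<Longrightarrow> (s x y, m x y) \<in> \<theta>\<^sub>0"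
    by (auto simp: good_def)
  interpret s: finite_loop A s u by (rule s(2))
  have ms: "congruence A {binop s} \<alpha>" if "congruence A {binop m} \<alpha>" for \<alpha>
    by (rule congr_derived[OF that s(1)])
  have down: "\<exists>\<beta> q \<rho>. congruence A {binop s} \<beta> \<and> congruence A {binop m} \<beta> \<and> \<gamma> \<subseteq> \<beta> \<and> \<beta> \<subset> \<alpha> \<and>
      central_step A s \<alpha> \<beta> q \<rho>"
    if \<gamma>: "congruence A {binop m} \<gamma>" "congruence A {binop m} \<alpha>" "\<gamma> \<subset> \<alpha>" for \<alpha> \<gamma>
  proof -
    obtain \<beta> p \<rho> where \<beta>: "congruence A {binop m} \<beta>" "\<gamma> \<subseteq> \<beta>" "\<beta> \<subset> \<alpha>" "central_step A m \<alpha> \<beta> p \<rho>"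
      using m.exists_central_step[OF nil \<gamma>] by (elim exE conjE)
    then have "central_step A s \<alpha> \<beta> p \<rho>" using s(3) unfolding inherits_def by simp
    with \<beta>(1-3) ms[OF \<beta>(1)] show ?thesis by (intro exI conjI)
  qed
  have Id: "congruence A {binop m} (Id_on A)" by (rule congrI) (auto simp: m.closed)
  have "\<theta> = Id_on A"
  proof (rule ccontr)
    assume "\<theta> \<noteq> Id_on A"
    moreover have "Id_on A \<subseteq> \<theta>" using congrD(2)[OF \<theta>] by auto
    ultimately have "Id_on A \<subset> \<theta>" by auto
    from down[OF Id \<theta> this] obtain \<eta> p \<rho> where
      \<eta>: "congruence A {binop s} \<eta>" "congruence A {binop m} \<eta>" "\<eta> \<subset> \<theta>" and st: "central_step A s \<theta> \<eta> p \<rho>"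
      by (elim exE conjE)
    obtain N where N: "p dvd N" "fact (card A) dvd N * Suc N"
      "\<And>q. prime q \<Longrightarrow> q \<noteq> p \<Longrightarrow> q dvd fact (card A) \<Longrightarrow> q dvd Suc N"
      "\<And>j. 2 \<le> j \<Longrightarrow> j \<le> k \<Longrightarrow> fact (card A) dvd (Suc N choose j)"
      by (rule exists_power_exponent[OF central_stepD(2)[OF st], of "fact (card A)" k]) (simp, blast)
    let ?P = "{x \<in> A. (s.right_power N x, x) \<in> \<theta>}"
    have Pcl: "s x y \<in> ?P" if "x \<in> ?P" "y \<in> ?P" for x y
    proof -
      have xy: "x \<in> A" "y \<in> A" using that by auto
      have "(s (s.right_power N x) (s.right_power N y), s.right_power N (s x y)) \<in> \<theta>"
        by (rule s.right_power_hom_idem(1)[OF ms[OF \<theta>] s(4) _ N(2) xy]) (rule N(4))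
      then show ?thesis using s.right_power_fixed_mult[OF ms[OF \<theta>]] that s.closed by blast
    qed
    have bd: "\<exists>D. bounded_degree s ?P \<theta> p D"
    proof (rule s.chain_bounded_degree[where C = "\<lambda>\<alpha>. congruence A {binop m} \<alpha>" and N = N])
      show "\<exists>\<beta> q \<rho>. congruence A {binop s} \<beta> \<and> congruence A {binop m} \<beta> \<and> \<theta> \<subseteq> \<beta> \<and> \<beta> \<subset> \<alpha> \<and>
          central_step A s \<alpha> \<beta> q \<rho>" if "congruence A {binop m} \<alpha>" "\<theta> \<subset> \<alpha>" for \<alpha>
        by (rule down[OF \<theta> that])
      show "q dvd Suc N" if "prime q" "q \<noteq> p" "q dvd fact (card A)" for q by (rule N(3)[OF that])
      show "s x y \<in> ?P" if "x \<in> ?P" "y \<in> ?P" for x y by (rule Pcl[OF that])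
    qed (use m.total_congruence ms[OF \<theta>] in auto)
    have tw: "(s.straightened N x y, s x y) \<in> \<theta>" if "x \<in> A" "y \<in> A" for x y
      by (rule s.straightened_term_cond(1)[OF ms[OF \<theta>] \<eta>(1) st s(4) N(1,2) _ bd that]) (rule N(4))
    have tc: "\<exists>k. term_cond A (s.straightened N) (\<lambda>_. A \<times> A) k \<eta>"
      by (rule s.straightened_term_cond(2)[OF ms[OF \<theta>] \<eta>(1) st s(4) N(1,2) _ bd]) (rule N(4))
    have "finite_loop A (s.straightened N) u"
    proof (rule s.finite_loop_if_central_maps[where C = "\<lambda>\<alpha>. congruence A {binop m} \<alpha>"])
      show "\<exists>\<beta> q \<rho>. congruence A {binop s} \<beta> \<and> congruence A {binop m} \<beta> \<and> \<beta> \<subset> \<alpha> \<and>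
          central_step A s \<alpha> \<beta> q \<rho>" if "congruence A {binop m} \<alpha>" "Id_on A \<subset> \<alpha>" for \<alpha>
        using down[OF Id that] by (elim exE conjE) (intro exI conjI)
    qed (use s.straightened_derived s.straightened_in s.straightened_unit s.straightened_central_map m.total_congruence in auto)
    moreover have "s.straightened N \<in> derived m" by (rule derived_trans[OF s.straightened_derived s(1)])
    moreover have "inherits (s.straightened N)"
      using s.straightened_central_step ms s(3) unfolding inherits_def by simp
    moreover have "(s.straightened N x y, m x y) \<in> \<theta>\<^sub>0" if "x \<in> A" "y \<in> A" for x y
      using tw[OF that] ex s(5)[OF that] congrD(4)[OF \<theta>\<^sub>0] by blast
    ultimately have "good \<eta> (s.straightened N)" using tc unfolding good_def by simp
    then show False using min[rule_format, OF \<eta>(2)] \<eta>(3) ex by blast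
  qed
  then show thesis using that[OF s(1,2)] s(4,5) by simp
qed

theorem corollary1p2:
  fixes A N :: "'a set" and m :: "'a \<Rightarrow> 'a \<Rightarrow> 'a"
  assumes "finite A"
    and "is_loop A m"
    and "nilpotent A {binop m}"
    and "normal_subloop A m N"
    and "supernilpotent (A // loop_cong A m N) {binop (quotient_op (loop_cong A m N) m)}"
  shows "\<exists>s r :: 'a \<Rightarrow> 'a \<Rightarrow> 'a.
    term_equivalent A {binop m} {binop s, binop r} \<and>
    is_loop A s \<and>
    supernilpotent A {binop s} \<and>
    congruence A {binop s} (loop_cong A m N) \<and>
    (\<forall>C \<in> A // loop_cong A m N. \<forall>D \<in> A // loop_cong A m N.
      quotient_op (loop_cong A m N) s C D = quotient_op (loop_cong A m N) m C D) \<and>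
    (\<forall>x \<in> A. \<forall>y \<in> A. r x y \<in> N)"
proof -
  let ?\<theta> = "loop_cong A m N"
  obtain u where u: "finite_loop A m u" by (rule finite_loop_of_is_loop[OF assms(1,2)])
  interpret m: finite_loop A m u by (rule u)
  have \<theta>: "congruence A {binop m} ?\<theta>" by (rule loop_quotient(3)[OF assms(2,4)])
  obtain k0 where k0: "term_cond A m (\<lambda>_. A \<times> A) k0 ?\<theta>"
    using term_cond_of_supernilpotent_quotient[OF assms(1) m.closed \<theta> assms(5)] by blast
  obtain s k where s: "s \<in> derived m" "finite_loop A s u" "term_cond A s (\<lambda>_. A \<times> A) k (Id_on A)"
    "\<And>x y. x \<in> A \<Longrightarrow> y \<in> A \<Longrightarrow> (s x y, m x y) \<in> ?\<theta>"
    using exists_supernilpotent_derived_loop[OF u assms(3) \<theta> k0] by metis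
  interpret s: finite_loop A s u by (rule s(2))
  have \<theta>s: "congruence A {binop s} ?\<theta>" by (rule congr_derived[OF \<theta> s(1)])
  have eqv: "equiv A ?\<theta>" using \<theta> by (simp add: congruence_binop_iff)
  define r where "r x y = s.ldiv (s x y) (m x y)" for x y
  have rm: "r \<in> derived m"
    unfolding r_def[abs_def] by (rule derived_derived[OF s.ldiv_derived s(1) s(1) derived_self])
  have rN: "r x y \<in> N" if xy: "x \<in> A" "y \<in> A" for x y
  proof -
    have A: "s x y \<in> A" "m x y \<in> A" "r x y \<in> A"
      using xy s.closed m.closed s.ldiv_in by (auto simp: r_def)
    have "(r x y, s.ldiv (s x y) (s x y)) \<in> ?\<theta>"
      unfolding r_def
      by (rule congrD(5)[OF congr_derived[OF \<theta>s s.ldiv_derived] congrD(2)[OF \<theta>s A(1)] congrD(3)[OF \<theta>s s(4)[OF xy]]])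
    then have "rdiv A m (r x y) u \<in> N" using A by (simp add: s.ldiv_self loop_cong_def)
    moreover have "rdiv A m (r x y) u = r x y"
      unfolding rdiv_def using A by (intro the_equality) (auto simp: m.right_unit)
    ultimately show ?thesis by simp
  qed
  have eq: "m x y = s (s x y) (r x y)" if "x \<in> A" "y \<in> A" for x y
    using that by (simp add: r_def s.mult_ldiv s.closed m.closed)
  have "supernilpotent A {binop s}"
    by (rule supernilpotent_if_term_cond[where k = "max 1 k"])
      (use s.closed term_cond_mono[OF s(3)] in auto)
  moreover have "quotient_op ?\<theta> s C D = quotient_op ?\<theta> m C D" if "C \<in> A // ?\<theta>" "D \<in> A // ?\<theta>" for C D
  proof -
    have sub: "C \<subseteq> A" "D \<subseteq> A" using that in_quotient_imp_subset[OF eqv] by blast+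
    have "?\<theta> `` {s x y} = ?\<theta> `` {m x y}" if "x \<in> C" "y \<in> D" for x y
      using equiv_class_eq[OF eqv s(4)] that sub by blast
    then show ?thesis unfolding quotient_op_def by simp
  qed
  ultimately show ?thesis
    using term_equivalent_binops[OF m.closed s(1) rm eq] s.is_loop \<theta>s rN by blast
qed

end
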